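(* Let $\mathcal{D}$ be an $\mathbb{N}$-valued random variable with distribution $H$, $E[\mathcal{D}]<\infty$, and pmf $h(d)=H(d)-H(d-1)=P(\mathcal{D}=d)$, $d\in\mathbb{N}$. Let $\mathcal{N}_\emptyset$ be the in-degree of the root of $\mathcal{T}^c(\chi)$ (the marked continuous-time branching process driven by $f$ and $H$, stopped at an independent exponential time $\chi$ whose rate is the Malthusian rate $\lambda$ of $\xi_f$; see context). (1) Preferential attachment. If $f(k)=k+\beta$ with $\beta>-1$, then for any $x\in\mathbb{N}\cup\{0\}$, $$P(\mathcal{N}_\emptyset=x)=\sum_{d=1}^\infty h(d)(2+\beta)\frac{\Gamma(2+\beta+d(\beta+1))\,\Gamma(x+d(\beta+1))}{\Gamma(d(\beta+1))\,\Gamma(x+d(\beta+1)+3+\beta)},$$ where $\Gamma$ is the Gamma function. In particular, if $h(d)=d^{-\gamma}L(d)$ for some finite $\gamma\ge2$ and slowly varying function $L$ (with $E[\mathcal{D}]<\infty$), then $$P(\mathcal{N}_\emptyset=x)=(1+o(1))\,K_\gamma\,P(XY>x)\qquad\text{as }x\to\infty,$$ where $X$ is a (Type II Pareto) random variable with $P(X>x)=(1+\beta+x)^{-3-\beta}$ for $x>-\beta$, independent of $Y$, and $P(Y=d)=d^{-\gamma-1}l(d)L(d)/K_\gamma$ for $d\in\mathbb{N}$, with $K_\gamma=\sum_{d=1}^\infty d^{-\gamma-1}l(d)L(d)$ and $$l(d):=\frac{(2+\beta)\Gamma(2+\beta+d(\beta+1))}{d^{2+\beta}\,\Gamma(d(\beta+1))}\to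 l(\infty):=(2+\beta)(\beta+1)^{2+\beta},\qquad d\to\infty.$$ Moreover, $x\mapsto P(XY>x)$ is regularly varying with tail index $\min\{3+\beta,\gamma\}$, and, as $x\to\infty$, $$K_\gamma P(XY>x)=(1+o(1))\begin{cases}K_\gamma E[Y^{3+\beta}]\,x^{-3-\beta},&\text{if }\gamma>3+\beta,\\[2pt] E[(X^+)^\gamma]\,l(\infty)L(x)\,x^{-\gamma},&\text{if }2\le\gamma<3+\beta.\end{cases}$$ (2) Uniform attachment. If $f(k)\equiv\beta$ for some $\beta>0$, then for any $x\in\mathbb{N}\cup\{0\}$, $$P(\mathcal{N}_\emptyset=x)=\sum_{d=1}^\infty h(d)\frac1{d+1}\Big(1+\frac1d\Big)^{-x}.$$ In particular, if $h(d)=d^{-\gamma}L(d)$ for some finite $\gamma\ge2$ and slowly varying function $L$ (with $E[\mathcal{D}]<\infty$), then $$P(\mathcal{N}_\emptyset=x)=(1+o(1))\,E[W^\gamma]\,x^{-\gamma}L(x)\qquad\text{as }x\to\infty,$$ where $W$ is an exponential random variable with mean one.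
   Context: Throughout $\mathbb{N}=\{1,2,\dots\}$ and $X^+=\max(X,0)$. For $f:\mathbb{N}\to\mathbb{R}_+$, $\{\xi_f(t):t\ge0\}$ is the Markovian pure birth process with $\xi_f(0)=0$ and birth rates $P(\xi_f(t+dt)=k+1\mid\xi_f(t)=k)=f(k+1)\,dt+o(dt)$, $k\ge0$. Its Malthusian rate is the $\lambda>0$ with $\hat\rho(\lambda)=1$, where $\hat\rho(\theta)=E[\int_0^\infty e^{-\theta s}\xi_f(ds)]=\sum_{n\ge1}\prod_{i=1}^n\frac{f(i)}{\theta+f(i)}$. Standing assumption. $E[\mathcal D]<\infty$; there is $\lambda>0$ with $\hat\rho(\lambda)=1$; $f(k)\le C_fk$ for all $k\geq 1$, for some $C_f<\infty$; $\inf_{i\ge1}f(i)>0$; and with $\underline\theta=\inf\{\theta>0:\hat\rho(\theta)<\infty\}$, $\lim_{\theta\searrow\underline\theta}\hat\rho(\theta)>1$. $\mathcal{T}^c(t)$ is the discrete skeleton at time $t$ (edges directed from offspring to parent) of the marked continuous-time branching process whose root is born at time $0$ and in which the $k$th node to be born has mark $\mathcal{D}_k$ and, from its birth on, reproduces according to $\bar\xi_f^{(k)}=\sum_{i=1}^{\mathcal{D}_k}\xi_f^{k,i}$, where $\{\mathcal{D}_k\}$ are i.i.d. with distribution $H$ and $\{\xi_f^{k,i}\}$ are i.i.d. copies of $\xi_f$, independent of $\{\mathcal D_k\}$. The time $\chi$ is exponential with rate $\lambda$, independent of the process. In particular the root's in-degree is $\mathcal{N}_\emptyset\overset{d}{=}\sum_{i=1}^{\mathcal{D}}\xi_f^{(i)}(\chi)$,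 with $\xi_f^{(i)}$ i.i.d. copies of $\xi_f$, and $\mathcal{D}$ (with distribution $H$), $\chi$ and $\{\xi_f^{(i)}\}$ independent.
   Formalization: The constants E[(X^+)^γ] (part 1, γ<3+β) and E[W^γ] (part 2) are divided by γ, as the printed ones are off by that factor; P(N=x)~K_γ P(XY>x) is claimed only if β≥0 or γ≥3+β, since for −1<β<0, γ<3+β the ratio tends to a constant >1. *)

theory Defs
  imports
    "HOL-Probability.Probability"
    "HOL-Library.Landau_Symbols"
    "Graph_Theory.Digraph"
begin

text \<open>
  The birth rates \<open>f 1, f 2, \<dots>\<close> are indexed from 1 (the value \<open>f 0\<close> is never used): the rate in
  state \<open>k\<close> is \<open>f (k + 1)\<close>.  The function \<open>p\<close> is the (time-homogeneous) transition function, i.e.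
  \<open>p s k j\<close> is the probability of being in state \<open>j\<close> a time \<open>s\<close> after being in state \<open>k\<close>.  Only the
  value of \<open>p\<close> at states of positive probability is constrained by the Markov property.  The
  expansion of \<open>p h k k\<close> expresses that from \<open>k\<close> there are no transitions other than to \<open>k + 1\<close>.
\<close>

definition pure_birth_process ::
  "'a measure \<Rightarrow> (nat \<Rightarrow> real) \<Rightarrow> (real \<Rightarrow> 'a \<Rightarrow> nat) \<Rightarrow> bool" where
  "pure_birth_process M f \<xi> \<longleftrightarrow>
     (\<forall>t\<ge>0. \<xi> t \<in> measurable M (count_space UNIV)) \<and>
     (\<forall>\<omega>\<in>space M. \<xi> 0 \<omega> = 0 \<and> mono_on {0..} (\<lambda>t. \<xi> t \<omega>) \<and>
        (\<forall>t\<ge>0. \<forall>\<^sub>F s in at_right t. \<xi> s \<omega> = \<xi> t \<omega>)) \<and>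
     (\<exists>p :: real \<Rightarrow> nat \<Rightarrow> nat \<Rightarrow> real.
        (\<forall>(n :: nat) (t :: nat \<Rightarrow> real) (x :: nat \<Rightarrow> nat).
           0 \<le> t 0 \<and> (\<forall>i\<le>n. t i < t (Suc i)) \<longrightarrow>
           \<P>(\<omega> in M. \<forall>i\<le>Suc n. \<xi> (t i) \<omega> = x i) =
             \<P>(\<omega> in M. \<forall>i\<le>n. \<xi> (t i) \<omega> = x i) * p (t (Suc n) - t n) (x n) (x (Suc n))) \<and>
        (\<forall>k. (\<lambda>h. p h k (Suc k) - f (Suc k) * h) \<in> o[at_right 0](\<lambda>h. h) \<and>
             (\<lambda>h. p h k k - (1 - f (Suc k) * h)) \<in> o[at_right 0](\<lambda>h. h)))"

text \<open>
  The Laplace transform of the reproduction intensity,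
  \<open>\<rho>(\<theta>) = \<Sum>n\<ge>1. \<Prod>i=1..n. f i / (\<theta> + f i)\<close>, which may be infinite.
\<close>

definition rho_hat :: "(nat \<Rightarrow> real) \<Rightarrow> real \<Rightarrow> ennreal" where
  "rho_hat f \<theta> = (\<Sum>n. ennreal (\<Prod>i=1..Suc n. f i / (\<theta> + f i)))"

definition malthusian_rate :: "(nat \<Rightarrow> real) \<Rightarrow> real \<Rightarrow> bool" where
  "malthusian_rate f lam \<longleftrightarrow> lam > 0 \<and> rho_hat f lam = 1"

definition standing_assumption :: "(nat \<Rightarrow> real) \<Rightarrow> nat pmf \<Rightarrow> bool" where
  "standing_assumption f H \<longleftrightarrow>
     integrable (measure_pmf H) real \<and>
     (\<forall>k\<ge>1. 0 \<le> f k) \<and>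
     (\<exists>lam. malthusian_rate f lam) \<and>
     (\<exists>C. \<forall>k\<ge>1. f k \<le> C * real k) \<and>
     0 < (INF i\<in>{1..}. f i) \<and>
     (\<exists>l>1. (rho_hat f \<longlongrightarrow> l) (at_right (Inf {\<theta>. 0 < \<theta> \<and> rho_hat f \<theta> < \<infinity>})))"


datatype source = Mark nat | Reproduction nat nat

fun source_events ::
  "'a measure \<Rightarrow> (nat \<Rightarrow> 'a \<Rightarrow> nat) \<Rightarrow> (nat \<Rightarrow> nat \<Rightarrow> real \<Rightarrow> 'a \<Rightarrow> nat) \<Rightarrow> source \<Rightarrow> 'a set set"
where
  "source_events M D \<xi> (Mark k) =
     sets (vimage_algebra (space M) (D k) (count_space UNIV))"
| "source_events M D \<xi> (Reproduction k i) =
     sets (vimage_algebra (space M) (\<lambda>\<omega>. \<lambda>t\<in>{0..}. \<xi> k i t \<omega>)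
       (Pi\<^sub>M {0..} (\<lambda>_. count_space UNIV)))"

definition process_events ::
  "'a measure \<Rightarrow> (nat \<Rightarrow> 'a \<Rightarrow> nat) \<Rightarrow> (nat \<Rightarrow> nat \<Rightarrow> real \<Rightarrow> 'a \<Rightarrow> nat) \<Rightarrow> 'a set set" where
  "process_events M D \<xi> = sigma_sets (space M) (\<Union>s. source_events M D \<xi> s)"

text \<open>
  Nodes are numbered in order of birth, starting with the root \<open>0\<close>, and the i.i.d. copies of the
  pure birth process that drive the reproduction of node \<open>k\<close> are \<open>\<xi> k 0, \<dots>, \<xi> k (D k - 1)\<close>.
  The node \<open>k\<close> has mark \<open>D k\<close>, birth time \<open>\<sigma> k\<close> and, if \<open>k > 0\<close>, parent \<open>\<pi> k\<close>.  The last
  conjunct of \<open>genealogy\<close> says that the number of children a node has had up to age \<open>t\<close> is the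
  superposition of its processes at \<open>t\<close>; up to null events this determines \<open>\<sigma>\<close> and \<open>\<pi>\<close>.
\<close>

locale marked_ctbp = prob_space M
  for M :: "'a measure" and f :: "nat \<Rightarrow> real" and H :: "nat pmf"
    and D :: "nat \<Rightarrow> 'a \<Rightarrow> nat" and \<xi> :: "nat \<Rightarrow> nat \<Rightarrow> real \<Rightarrow> 'a \<Rightarrow> nat"
    and \<sigma> :: "nat \<Rightarrow> 'a \<Rightarrow> real" and \<pi> :: "nat \<Rightarrow> 'a \<Rightarrow> nat" +
  assumes mark_measurable: "\<And>k. D k \<in> measurable M (count_space UNIV)"
    and mark_distr: "\<And>k. distr M (count_space UNIV) (D k) = measure_pmf H"
    and reproduction: "\<And>k i. pure_birth_process M f (\<xi> k i)"
    and independence: "indep_sets (source_events M D \<xi>) UNIV"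
    and birth_time_measurable: "\<And>k. \<sigma> k \<in> borel_measurable M"
    and parent_measurable: "\<And>k. \<pi> k \<in> measurable M (count_space UNIV)"
    and genealogy: "AE \<omega> in M.
      \<sigma> 0 \<omega> = 0 \<and>
      (\<forall>j. \<sigma> j \<omega> \<le> \<sigma> (Suc j) \<omega>) \<and>
      (\<forall>j>0. \<pi> j \<omega> < j) \<and>
      (\<forall>k. \<forall>t\<ge>0. finite {j. 0 < j \<and> \<pi> j \<omega> = k \<and> \<sigma> j \<omega> \<le> \<sigma> k \<omega> + t} \<and>
         card {j. 0 < j \<and> \<pi> j \<omega> = k \<and> \<sigma> j \<omega> \<le> \<sigma> k \<omega> + t} = (\<Sum>i<D k \<omega>. \<xi> k i t \<omega>))"

definition skeleton ::
  "(nat \<Rightarrow> 'a \<Rightarrow> real) \<Rightarrow> (nat \<Rightarrow> 'a \<Rightarrow> nat) \<Rightarrow> real \<Rightarrow> 'a \<Rightarrow> (nat, nat \<times> nat) pre_digraph" where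
  "skeleton \<sigma> \<pi> t \<omega> =
     \<lparr> verts = {k. \<sigma> k \<omega> \<le> t}, arcs = {(j, \<pi> j \<omega>) | j. 0 < j \<and> \<sigma> j \<omega> \<le> t},
       tail = fst, head = snd \<rparr>"

definition root_in_degree ::
  "(nat \<Rightarrow> 'a \<Rightarrow> real) \<Rightarrow> (nat \<Rightarrow> 'a \<Rightarrow> nat) \<Rightarrow> ('a \<Rightarrow> real) \<Rightarrow> 'a \<Rightarrow> nat" where
  "root_in_degree \<sigma> \<pi> \<tau> \<omega> = in_degree (skeleton \<sigma> \<pi> (\<tau> \<omega>) \<omega>) 0"


text \<open>Regular variation at infinity with index \<open>\<rho>\<close>; a tail has tail index \<open>\<alpha>\<close> if \<open>\<rho> = - \<alpha>\<close>.\<close>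

definition regularly_varying :: "real \<Rightarrow> (real \<Rightarrow> real) \<Rightarrow> bool" where
  "regularly_varying \<rho> g \<longleftrightarrow>
     g \<in> borel_measurable borel \<and> (\<forall>\<^sub>F x in at_top. 0 < g x) \<and>
     (\<forall>c>0. ((\<lambda>x. g (c * x) / g x) \<longlongrightarrow> c powr \<rho>) at_top)"

definition slowly_varying :: "(real \<Rightarrow> real) \<Rightarrow> bool" where
  "slowly_varying L \<longleftrightarrow> regularly_varying 0 L"


definition pa_l :: "real \<Rightarrow> nat \<Rightarrow> real" where
  "pa_l \<beta> d = (2 + \<beta>) * Gamma (2 + \<beta> + real d * (\<beta> + 1)) /
     (real d powr (2 + \<beta>) * Gamma (real d * (\<beta> + 1)))"

definition pa_l_inf :: "real \<Rightarrow> real" where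
  "pa_l_inf \<beta> = (2 + \<beta>) * (\<beta> + 1) powr (2 + \<beta>)"

definition pa_weight :: "real \<Rightarrow> real \<Rightarrow> (real \<Rightarrow> real) \<Rightarrow> nat \<Rightarrow> real" where
  "pa_weight \<beta> \<gamma> L d = real d powr (- \<gamma> - 1) * pa_l \<beta> d * L (real d)"

text \<open>
  The normalising constant of the law of \<open>Y\<close>.  As the weights are asymptotic to
  \<open>l(\<infinity>) d powr (- \<gamma> - 1) L(d)\<close>, Karamata's theorem gives
  \<open>K P(Y > y) \<sim> l(\<infinity>) L(y) y powr (- \<gamma>) / \<gamma>\<close>; this is the origin of the factor \<open>1 / \<gamma>\<close> that
  accompanies the moments \<open>E[(X\<^sup>+) powr \<gamma>]\<close> and \<open>E[W powr \<gamma>]\<close> in the asymptotics.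
\<close>

definition pa_K :: "real \<Rightarrow> real \<Rightarrow> (real \<Rightarrow> real) \<Rightarrow> real" where
  "pa_K \<beta> \<gamma> L = (\<Sum>\<^sub>\<infinity>d\<in>{1..}. pa_weight \<beta> \<gamma> L d)"

text \<open>
  \<open>X\<close> is supported on \<open>{- \<beta><..}\<close>, so for \<open>\<beta> < 0\<close> the power formula for its tail does not apply
  below \<open>- \<beta> > 0\<close>, where the tail equals 1 while the power exceeds 1.  If \<open>\<gamma> < 3 + \<beta>\<close>, the
  event \<open>Y > x / (- \<beta>)\<close> is not asymptotically negligible, so the in-degree probabilities are
  comparable to \<open>K P(X Y > x)\<close> only when \<open>\<beta> \<ge> 0\<close> or \<open>\<gamma> \<ge> 3 + \<beta>\<close>.
\<close>

definition pa_limit_pair ::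
  "'b measure \<Rightarrow> real \<Rightarrow> real \<Rightarrow> (real \<Rightarrow> real) \<Rightarrow> ('b \<Rightarrow> real) \<Rightarrow> ('b \<Rightarrow> nat) \<Rightarrow> bool" where
  "pa_limit_pair N \<beta> \<gamma> L X Y \<longleftrightarrow>
     prob_space N \<and>
     X \<in> borel_measurable N \<and> Y \<in> measurable N (count_space UNIV) \<and>
     prob_space.indep_var N borel X borel (\<lambda>\<omega>. real (Y \<omega>)) \<and>
     (\<forall>x>-\<beta>. \<P>(\<omega> in N. X \<omega> > x) = (1 + \<beta> + x) powr (-3 - \<beta>)) \<and>
     (\<forall>d\<ge>1. \<P>(\<omega> in N. Y \<omega> = d) = pa_weight \<beta> \<gamma> L d / pa_K \<beta> \<gamma> L)"

end

theory Submission
  imports Defs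
begin

text \<open>
  Conditionally on its mark \<open>d\<close>, the in-degree of the root is the superposition of \<open>d\<close> independent
  pure birth processes, stopped at an independent exponential time.  Both rate functions of the
  statement are affine, \<open>f k = c * k + b\<close>, and for affine rates such a superposition is again a pure
  birth process, with rate \<open>c * j + d * (c + b)\<close> in state \<open>j\<close>.  This is read off from the Kolmogorov
  forward equations, which are stable under convolution (\<open>forward_equations_convolution\<close>).  Stopping
  at an exponential time turns the forward equations into a first-order recurrence
  (\<open>forward_equations_exponential_time\<close>), so that no transition probability has to be computed:
  the recurrence is solved by a quotient of Gamma functions if \<open>c = 1\<close> and by a geometric law if
  \<open>c = 0\<close>.  The rate of the exponential time is \<open>2 * c + b\<close>, because the series that defines it
  telescopes (\<open>malthusian_rate_affine\<close>).

  With \<open>h(d) = d powr (- \<gamma>) * L(d)\<close>, the mixtures obtained in this way, as well as \<open>K P(X Y > x)\<close>,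
  are sums over \<open>d\<close> of \<open>d powr (- \<gamma> - 1) * l(d) * L(d) * k(x, d)\<close>, where the kernel \<open>k(x, d)\<close> tends to
  a limit \<open>\<phi>(t)\<close> when \<open>d\<close> is close to \<open>x * t\<close>.  Divided by \<open>x powr (- \<gamma>) * L(x)\<close>, such a sum is a
  Riemann sum, which converges to \<open>l(\<infinity>)\<close> times the integral of \<open>t powr (- \<gamma> - 1) * \<phi>(t)\<close> as soon as
  \<open>k(x, d)\<close> is bounded and decays faster than \<open>(d / x) powr \<gamma>\<close> (\<open>regularly_varying_weighted_sum\<close>);
  the domination comes from Potter's bounds for slowly varying functions, which in turn follow from
  the uniform convergence theorem.

  This single theorem yields the asymptotics for uniform attachment, and those for preferential
  attachment when \<open>\<gamma> < 3 + \<beta>\<close>; the moments \<open>E[W powr \<gamma>]\<close> and \<open>E[(X\<^sup>+) powr \<gamma>]\<close> are \<open>\<gamma>\<close> times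
  the integrals in question (\<open>moment_from_tail\<close>).  If \<open>\<gamma> > 3 + \<beta>\<close> the sum is instead carried by bounded \<open>d\<close>, and each
  summand may be replaced by its limit.  In the critical case \<open>\<gamma> = 3 + \<beta>\<close> there is no explicit
  constant, but \<open>K P(X Y > x)\<close> is of larger order than \<open>x powr (- \<gamma>) * L(x)\<close> (\<open>V_dominates\<close>), whereas
  \<open>c powr \<gamma> * P(X Y > c * x) - P(X Y > x)\<close> is only of that order (\<open>V_critical\<close>).

  Finally \<open>\<Gamma>(z) / \<Gamma>(z + 3 + \<beta>)\<close> is asymptotic to \<open>z powr (- 3 - \<beta>)\<close>.  Used at \<open>z = x + d * (\<beta> + 1)\<close>,
  which is at least \<open>x\<close> for every \<open>d\<close>, this replaces the Gamma functions in the in-degree law by the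
  power \<open>(1 + \<beta> + x / d) powr (- 3 - \<beta>)\<close>, uniformly in \<open>d\<close> (\<open>gamma_mixture_asymp_U\<close>).  The power is the
  tail of \<open>X\<close> at \<open>x / d\<close> unless \<open>\<beta> < 0\<close> and \<open>d > x / (- \<beta>)\<close>, and these exceptional \<open>d\<close> are negligible if
  \<open>\<gamma> \<ge> 3 + \<beta>\<close> (\<open>U_asymp_V\<close>).
\<close>

section \<open>Slowly varying functions\<close>

lemma slowly_varyingD:
  assumes "slowly_varying L"
  shows "L \<in> borel_measurable borel" "\<forall>\<^sub>F x in at_top. 0 < L x"
    "c > 0 \<Longrightarrow> ((\<lambda>x. L (c * x) / L x) \<longlongrightarrow> 1) at_top"
  using assms unfolding slowly_varying_def regularly_varying_def by auto

text \<open>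
  For large \<open>x\<close>, the shifts \<open>u\<close> for which \<open>h (x + u)\<close> is not close to \<open>h x\<close> form a set of small
  measure, by dominated convergence.  If \<open>c\<close> is in \<open>{0..A}\<close>, the exceptional sets of \<open>x\<close> and of
  \<open>x + c\<close>, placed on the same axis, cannot cover an interval of length at least \<open>A\<close>; any point that
  they leave out links \<open>h (x + c)\<close> to \<open>h x\<close>.  Measurability of \<open>h\<close> is essential here.
\<close>

lemma additive_uniform_convergence:
  fixes h :: "real \<Rightarrow> real"
  assumes meas [measurable]: "h \<in> borel_measurable borel"
    and lim: "\<And>u. ((\<lambda>x. h (x + u) - h x) \<longlongrightarrow> 0) at_top"
    and A: "A > 0" and e: "\<epsilon> > 0"
  shows "\<forall>\<^sub>F x in at_top. \<forall>c\<in>{0..A}. \<bar>h (x + c) - h x\<bar> < \<epsilon>"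
proof -
  define E where "E x = {u \<in> {0..2*A}. \<bar>h (x + u) - h x\<bar> \<ge> \<epsilon> / 2}" for x
  have E_meas [measurable]: "E x \<in> sets lborel" for x
    unfolding E_def by measurable
  have "((\<lambda>x. \<integral>u. (indicator (E x) u :: real) \<partial>lborel) \<longlongrightarrow> (\<integral>u. 0 \<partial>(lborel :: real measure))) at_top"
  proof (rule integral_dominated_convergence_at_top[where w = "indicator {0..2*A}"])
    show "integrable lborel (indicator {0..2*A} :: real \<Rightarrow> real)"
      using A by simp
    show "AE u in lborel. ((\<lambda>x. indicator (E x) u) \<longlongrightarrow> (0::real)) at_top"
    proof (rule AE_I2)
      fix u :: real
      have "\<forall>\<^sub>F x in at_top. \<bar>h (x + u) - h x\<bar> < \<epsilon> / 2"
        using tendstoD[OF lim[of u], of "\<epsilon> / 2"] e by (simp add: dist_real_def)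
      then have "\<forall>\<^sub>F x in at_top. indicator (E x) u = (0::real)"
        by eventually_elim (auto simp: E_def)
      then show "((\<lambda>x. indicator (E x) u) \<longlongrightarrow> (0::real)) at_top"
        by (rule tendsto_eventually)
    qed
    show "\<forall>\<^sub>F x in at_top. AE u in lborel. norm (indicator (E x) u :: real) \<le> indicator {0..2*A} u"
      by (intro always_eventually allI AE_I2) (auto simp: E_def indicator_def)
  qed measurable
  then have "((\<lambda>x. measure lborel (E x)) \<longlongrightarrow> 0) at_top"
    by simp
  then have "\<forall>\<^sub>F x in at_top. measure lborel (E x) < A / 2"
    using A by (intro order_tendstoD(2)) auto
  then obtain x0 where x0: "\<And>x. x \<ge> x0 \<Longrightarrow> measure lborel (E x) < A / 2"
    by (auto simp: eventually_at_top_linorder)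
  have "\<bar>h (x + c) - h x\<bar> < \<epsilon>" if x: "x \<ge> x0" and c: "c \<in> {0..A}" for x c
  proof (rule ccontr)
    assume neg: "\<not> ?thesis"
    \<comment> \<open>the exceptional set of \<open>x + c\<close> in the coordinates of \<open>x\<close>\<close>
    define E' where "E' = (\<lambda>u. u + c) ` E (x + c)"
    have fin: "E y \<in> fmeasurable lborel" for y
    proof (rule fmeasurableI2[of "{0..2*A}"])
      show "{0..2*A} \<in> fmeasurable lborel"
        by (metis cbox_interval fmeasurable_cbox)
    qed (auto simp: E_def)
    have E'_eq: "E' = (\<lambda>u. u - c) -` E (x + c)"
      unfolding E'_def by (force simp: image_iff)
    have E_borel: "E y \<in> sets borel" for y using E_meas[of y] by simp
    have E'_meas: "E' \<in> sets lborel"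
      unfolding E'_eq using measurable_sets[of "\<lambda>u. u - c" borel borel "E (x + c)"] E_borel by simp
    have E'_em: "emeasure lborel E' = emeasure lborel (E (x + c))"
    proof -
      have "emeasure lborel (E (x + c)) = emeasure (distr lborel borel ((+) (-c))) (E (x + c))"
        using lborel_distr_plus[of "-c"] by simp
      also have "\<dots> = emeasure lborel E'"
        by (subst emeasure_distr) (auto simp: E'_eq vimage_def E_borel intro!: arg_cong2[where f = emeasure])
      finally show ?thesis by simp
    qed
    have E'_fin: "E' \<in> fmeasurable lborel"
      using E'_meas E'_em fin[of "x + c"] by (auto simp: fmeasurable_def)
    have "{c..2*A} \<subseteq> E x \<union> E'"
    proof
      fix t assume t: "t \<in> {c..2*A}"
      show "t \<in> E x \<union> E'"
      proof (rule ccontr)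
        assume "t \<notin> E x \<union> E'"
        then have "t \<notin> E x" "t - c \<notin> E (x + c)" by (auto simp: E'_eq)
        then have "\<bar>h (x + t) - h x\<bar> < \<epsilon> / 2" "\<bar>h (x + t) - h (x + c)\<bar> < \<epsilon> / 2"
          using t c by (auto simp: E_def not_le)
        with neg show False by linarith
      qed
    qed
    then have "measure lborel {c..2*A} \<le> measure lborel (E x \<union> E')"
      using fin E'_fin by (intro measure_mono_fmeasurable) auto
    also have "\<dots> \<le> measure lborel (E x) + measure lborel E'"
      using E'_meas E_borel by (intro measure_Un_le) auto
    also have "\<dots> < A / 2 + A / 2"
      using x0[OF x] x0[of "x + c"] x c E'_em by (intro add_strict_mono) (auto simp: measure_def)
    finally show False using c by simp
  qed
  then show ?thesis
    unfolding eventually_at_top_linorder by blast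
qed

text \<open>
  The uniform convergence theorem for slowly varying functions: the logarithmic form of
  slow variation in the variable \<open>ln x\<close> is the additive statement above.
\<close>

lemma slowly_varying_uniform:
  assumes L: "slowly_varying L" and b: "b > 1" and e: "\<epsilon> > 0"
  shows "\<exists>x0>0. (\<forall>x\<ge>x0. L x > 0) \<and>
    (\<forall>x\<ge>x0. \<forall>y\<ge>x0. y \<le> b * x \<longrightarrow> x \<le> b * y \<longrightarrow> \<bar>ln (L y) - ln (L x)\<bar> < \<epsilon>)"
proof -
  note L' = slowly_varyingD[OF L]
  note [measurable] = L'(1)
  define h where "h t = ln (L (exp t))" for t
  have "\<forall>\<^sub>F x in at_top. \<forall>c\<in>{0..ln b}. \<bar>h (x + c) - h x\<bar> < \<epsilon>"
  proof (rule additive_uniform_convergence)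
    show "h \<in> borel_measurable borel" unfolding h_def by measurable
    show "((\<lambda>x. h (x + u) - h x) \<longlongrightarrow> 0) at_top" for u
    proof -
      have "((\<lambda>x. L (exp u * exp x) / L (exp x)) \<longlongrightarrow> 1) at_top"
        using filterlim_compose[OF L'(3)[of "exp u"] exp_at_top] by simp
      then have "((\<lambda>x. ln (L (exp u * exp x) / L (exp x))) \<longlongrightarrow> ln 1) at_top"
        by (rule tendsto_ln) simp
      moreover have "\<forall>\<^sub>F x in at_top. ln (L (exp u * exp x) / L (exp x)) = h (x + u) - h x"
      proof -
        have "filterlim (\<lambda>x::real. exp u * exp x) at_top at_top"
          by (rule filterlim_tendsto_pos_mult_at_top[OF tendsto_const _ exp_at_top]) simp
        then have "\<forall>\<^sub>F x in at_top. L (exp u * exp x) > 0"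
          using L'(2) by (auto simp: filterlim_iff)
        moreover have "\<forall>\<^sub>F x in at_top. L (exp x) > 0"
          using L'(2) exp_at_top by (auto simp: filterlim_iff)
        ultimately show ?thesis
          by eventually_elim (simp add: h_def exp_add ln_div mult.commute)
      qed
      ultimately show ?thesis
        by (simp add: tendsto_cong)
    qed
  qed (use b e in auto)
  then obtain t0 where t0: "\<And>x c. x \<ge> t0 \<Longrightarrow> c \<in> {0..ln b} \<Longrightarrow> \<bar>h (x + c) - h x\<bar> < \<epsilon>"
    unfolding eventually_at_top_linorder by blast
  from L'(2) obtain x1 where x1: "\<And>x. x \<ge> x1 \<Longrightarrow> L x > 0"
    by (auto simp: eventually_at_top_linorder)
  define x0 where "x0 = max x1 (exp t0)"
  have x0_pos: "x0 > 0" unfolding x0_def by (simp add: less_max_iff_disj)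
  have key: "\<bar>ln (L y) - ln (L x)\<bar> < \<epsilon>" if "x \<ge> x0" "x \<le> y" "y \<le> b * x" for x y
  proof -
    have x: "x > 0" "y > 0" using that x0_pos by linarith+
    have "t0 \<le> ln x" using that x by (simp add: x0_def ln_ge_iff)
    moreover have "ln (y / x) \<in> {0..ln b}" using that x b
      by (auto simp: field_simps)
    ultimately have "\<bar>h (ln x + ln (y / x)) - h (ln x)\<bar> < \<epsilon>" by (rule t0)
    then show ?thesis using x by (simp add: h_def ln_div)
  qed
  show ?thesis
  proof (intro exI[of _ x0] conjI allI impI)
    show "L x > 0" if "x \<ge> x0" for x using that by (intro x1) (simp add: x0_def)
    fix x y assume "x \<ge> x0" "y \<ge> x0" "y \<le> b * x" "x \<le> b * y"
    then show "\<bar>ln (L y) - ln (L x)\<bar> < \<epsilon>"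
      using key[of x y] key[of y x] by (cases "x \<le> y") (auto simp: abs_minus_commute)
  qed (rule x0_pos)
qed

text \<open>
  The form in which uniform convergence enters the Riemann sums: a pointwise limit \<open>t\<close> of
  \<open>y x / x\<close> keeps \<open>y x\<close> within a compact range of multiples of \<open>x\<close>.
\<close>

lemma slowly_varying_compose:
  assumes L: "slowly_varying L" and t: "t > 0"
    and y: "((\<lambda>x. y x / x) \<longlongrightarrow> t) at_top"
  shows "((\<lambda>x. L (y x) / L x) \<longlongrightarrow> 1) at_top"
proof -
  define b where "b = max (2 * t) (2 / t) + 1"
  have b: "b > 1" "2 * t \<le> b" "2 / t \<le> b" using t by (auto simp: b_def less_max_iff_disj)
  have range: "\<forall>\<^sub>F x in at_top. x > 0 \<and> t / 2 * x < y x \<and> y x < 2 * t * x"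
  proof -
    have "\<forall>\<^sub>F x in at_top. y x / x > t / 2" "\<forall>\<^sub>F x in at_top. y x / x < 2 * t"
      using order_tendstoD(1)[OF y, of "t / 2"] order_tendstoD(2)[OF y, of "2 * t"] t by simp_all
    then show ?thesis
      using eventually_gt_at_top[of 0] by eventually_elim (auto simp: field_simps)
  qed
  have "((\<lambda>x. ln (L (y x)) - ln (L x)) \<longlongrightarrow> 0) at_top"
  proof (rule tendstoI)
    fix e :: real assume "e > 0"
    from slowly_varying_uniform[OF L b(1) this] obtain x0 where x0: "x0 > 0"
      "\<And>x y. x \<ge> x0 \<Longrightarrow> y \<ge> x0 \<Longrightarrow> y \<le> b * x \<Longrightarrow> x \<le> b * y \<Longrightarrow> \<bar>ln (L y) - ln (L x)\<bar> < e"
      by blast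
    show "\<forall>\<^sub>F x in at_top. dist (ln (L (y x)) - ln (L x)) 0 < e"
      using range eventually_ge_at_top[of x0] eventually_ge_at_top[of "2 * x0 / t"]
    proof eventually_elim
      case (elim x)
      have "y x \<ge> x0" using elim t by (auto simp: field_simps)
      moreover have "y x \<le> b * x"
        using elim b(2) order.trans[OF less_imp_le mult_right_mono[of "2 * t" b x]] by simp
      moreover have "x \<le> b * y x"
      proof -
        have "x = 2 / t * (t / 2 * x)" using t by simp
        also have "\<dots> \<le> 2 / t * y x" using elim t by (intro mult_left_mono) auto
        also have "\<dots> \<le> b * y x" using elim t b x0
          by (intro mult_right_mono order.trans[OF less_imp_le[OF x0(1)] \<open>y x \<ge> x0\<close>]) auto
        finally show ?thesis .
      qed
      ultimately show ?case using x0(2)[of x "y x"] elim by (simp add: dist_real_def)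
    qed
  qed
  then have "((\<lambda>x. exp (ln (L (y x)) - ln (L x))) \<longlongrightarrow> exp 0) at_top"
    by (rule tendsto_exp)
  moreover have "\<forall>\<^sub>F x in at_top. exp (ln (L (y x)) - ln (L x)) = L (y x) / L x"
  proof -
    have "filterlim y at_top at_top"
    proof (rule filterlim_at_top_mono)
      show "filterlim (\<lambda>x. t / 2 * x) at_top at_top"
        using t by (intro filterlim_tendsto_pos_mult_at_top[OF tendsto_const] filterlim_ident) auto
      show "\<forall>\<^sub>F x in at_top. t / 2 * x \<le> y x" using range by eventually_elim auto
    qed
    then have "\<forall>\<^sub>F x in at_top. L (y x) > 0"
      using slowly_varyingD(2)[OF L] by (auto simp: filterlim_iff)
    then show ?thesis
      using slowly_varyingD(2)[OF L] by eventually_elim (simp add: exp_diff)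
  qed
  ultimately show ?thesis by (simp add: tendsto_cong)
qed

text \<open>
  Each factor \<open>e\<close> in the argument costs at most \<open>\<delta>\<close> in \<open>ln L\<close>, so the number of
  steps from \<open>x\<close> to \<open>y\<close> bounds the oscillation by a small power of their ratio.
\<close>

lemma potter_bound:
  assumes L: "slowly_varying L" and d: "\<delta> > 0"
  shows "\<exists>C>0. \<exists>x0\<ge>1. \<forall>x\<ge>x0. L x > 0 \<and>
    (\<forall>y\<ge>x0. L y \<le> C * L x * max ((y / x) powr \<delta>) ((x / y) powr \<delta>))"
proof -
  from slowly_varying_uniform[OF L, of "exp 1" \<delta>] d obtain x1 where x1: "x1 > 0"
    "\<And>x. x \<ge> x1 \<Longrightarrow> L x > 0"
    "\<And>x y. x \<ge> x1 \<Longrightarrow> y \<ge> x1 \<Longrightarrow> y \<le> exp 1 * x \<Longrightarrow> x \<le> exp 1 * y \<Longrightarrow> \<bar>ln (L y) - ln (L x)\<bar> < \<delta>"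
    by auto
  \<comment> \<open>chain the bound along the points \<open>x e\<^sup>i\<close>\<close>
  have step: "\<bar>ln (L (x * exp s)) - ln (L x)\<bar> \<le> \<delta> * (s + 1)" if "x \<ge> x1" "s \<ge> 0" for x s
  proof -
    have chain: "\<bar>ln (L (x * exp s)) - ln (L x)\<bar> \<le> \<delta> * real n"
      if "x \<ge> x1" "s \<ge> 0" "s \<le> real n" for n x s
      using that
    proof (induction n arbitrary: x s)
      case (Suc n)
      define r where "r = min s 1"
      have r: "0 \<le> r" "r \<le> 1" "r \<le> s" "s - r \<le> real n" using Suc.prems by (auto simp: r_def)
      have e: "exp r * exp (s - r) = exp s" by (simp flip: exp_add)
      have xe: "x \<le> x * exp r" using Suc.prems r x1(1) by simp
      have "\<bar>ln (L (x * exp r * exp (s - r))) - ln (L (x * exp r))\<bar> \<le> \<delta> * real n"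
        using Suc.prems r xe by (intro Suc.IH) auto
      moreover have "\<bar>ln (L (x * exp r)) - ln (L x)\<bar> < \<delta>"
      proof (rule x1(3))
        show "x * exp r \<le> exp 1 * x" using r Suc.prems x1(1) by simp
        have "1 * x \<le> exp 1 * (x * exp r)"
          using xe Suc.prems x1(1) by (intro mult_mono) auto
        then show "x \<le> exp 1 * (x * exp r)" by simp
      qed (use Suc.prems xe in auto)
      ultimately show ?case by (simp add: algebra_simps e)
    qed simp
    have "\<bar>ln (L (x * exp s)) - ln (L x)\<bar> \<le> \<delta> * real (nat \<lceil>s\<rceil>)"
      using that by (intro chain) auto
    also have "\<dots> \<le> \<delta> * (s + 1)" using d that by (intro mult_left_mono) linarith+
    finally show ?thesis .
  qed
  define x0 where "x0 = max 1 x1"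
  have bound: "L y \<le> exp \<delta> * L x * max ((y / x) powr \<delta>) ((x / y) powr \<delta>)" if "x \<ge> x0" "y \<ge> x0" for x y
  proof -
    have xy: "x \<ge> x1" "y \<ge> x1" "x > 0" "y > 0" "L x > 0" "L y > 0"
      using that x1(1,2) by (auto simp: x0_def)
    have "ln (L y) - ln (L x) \<le> \<delta> * (\<bar>ln (y / x)\<bar> + 1)"
    proof (cases "x \<le> y")
      case True
      then show ?thesis using step[of x "ln (y / x)"] xy by simp
    next
      case False
      then have "\<bar>ln (y / x)\<bar> = ln (x / y)" using xy by (simp add: ln_div)
      then show ?thesis using step[of y "ln (x / y)"] xy False by simp
    qed
    then have "exp (ln (L y) - ln (L x)) \<le> exp (\<delta> * (\<bar>ln (y / x)\<bar> + 1))" by simp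
    then have "L y \<le> L x * (exp \<delta> * exp (\<delta> * \<bar>ln (y / x)\<bar>))"
      using xy by (simp add: exp_diff field_simps exp_add)
    also have "exp (\<delta> * \<bar>ln (y / x)\<bar>) \<le> max ((y / x) powr \<delta>) ((x / y) powr \<delta>)"
      using xy by (auto simp: powr_def abs_if ln_div max_def algebra_simps)
    finally show ?thesis using xy by (simp add: mult_ac)
  qed
  show ?thesis
    using bound x1(2) by (intro exI[of _ "exp \<delta>"] exI[of _ x0] conjI) (auto simp: x0_def)
qed

text \<open>
  At small integers \<open>L\<close> is not controlled by slow variation and need not be positive, but there
  are finitely many of them, and \<open>L x\<close> is at least a constant times \<open>x powr (- \<delta>)\<close>.  The sum of both
  powers therefore dominates at every positive integer, with a lower bound on \<open>x\<close> alone.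
\<close>

lemma potter_bound_nat:
  assumes L: "slowly_varying L" and d: "\<delta> > 0"
  shows "\<exists>C>0. \<exists>x0\<ge>1. \<forall>x\<ge>x0. L x > 0 \<and>
    (\<forall>n\<ge>1. \<bar>L (real n)\<bar> \<le> C * L x * ((real n / x) powr \<delta> + (real n / x) powr (- \<delta>)))"
proof -
  from potter_bound[OF L d] obtain C x0 where C: "C > 0" "x0 \<ge> 1"
    "\<And>x. x \<ge> x0 \<Longrightarrow> L x > 0"
    "\<And>x y. x \<ge> x0 \<Longrightarrow> y \<ge> x0 \<Longrightarrow> L y \<le> C * L x * max ((y / x) powr \<delta>) ((x / y) powr \<delta>)"
    by blast
  define B where "B = Max ((\<lambda>n. \<bar>L (real n)\<bar>) ` {..nat \<lceil>x0\<rceil>})"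
  have B: "\<bar>L (real n)\<bar> \<le> B" if "real n \<le> x0" for n
  proof -
    have "n \<le> nat \<lceil>x0\<rceil>" using that by linarith
    then show ?thesis unfolding B_def by (intro Max_ge) auto
  qed
  have B0: "B \<ge> 0" using B[of 0] C by auto
  define C' where "C' = C + B * C / L x0"
  have "C' > 0" using C B0 unfolding C'_def by (intro add_pos_nonneg) (auto simp: less_imp_le)
  have main: "\<bar>L (real n)\<bar> \<le> C' * L x * ((real n / x) powr \<delta> + (real n / x) powr (- \<delta>))"
    if x: "x \<ge> x0" and n: "n \<ge> 1" for x n
  proof (cases "real n \<ge> x0")
    case True
    have "\<bar>L (real n)\<bar> \<le> C * L x * max ((real n / x) powr \<delta>) ((x / real n) powr \<delta>)"
      using C(3)[OF True] C(4)[OF x True] by simp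
    also have "\<dots> \<le> C' * L x * ((real n / x) powr \<delta> + (real n / x) powr (- \<delta>))"
    proof (intro mult_mono)
      show "C \<le> C'" using C B0 unfolding C'_def by (auto simp: less_imp_le)
      have "(x / real n) powr \<delta> = (real n / x) powr (- \<delta>)"
        using n x C(2) by (simp add: powr_minus powr_divide)
      then show "max ((real n / x) powr \<delta>) ((x / real n) powr \<delta>) \<le> (real n / x) powr \<delta> + (real n / x) powr (- \<delta>)"
        by simp
    qed (use C(3)[OF x] \<open>C' > 0\<close> in \<open>auto simp: less_imp_le le_max_iff_disj\<close>)
    finally show ?thesis .
  next
    case False
    have xpos: "x > 0" "x0 > 0" using x C(2) by linarith+
    have "L x0 \<le> C * L x * max ((x0 / x) powr \<delta>) ((x / x0) powr \<delta>)"
      using x by (intro C(4)) auto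
    also have "max ((x0 / x) powr \<delta>) ((x / x0) powr \<delta>) \<le> (x / real n) powr \<delta>"
    proof (rule max.boundedI)
      have "x0 / x \<le> x / real n"
      proof -
        have "x0 / x \<le> 1" using x xpos by simp
        also have "1 \<le> x / real n" using False x n by simp
        finally show ?thesis .
      qed
      then show "(x0 / x) powr \<delta> \<le> (x / real n) powr \<delta>"
        using xpos d by (intro powr_mono2) auto
      have "x / x0 \<le> x / real n" using False n xpos by (intro divide_left_mono) auto
      then show "(x / x0) powr \<delta> \<le> (x / real n) powr \<delta>"
        using xpos d by (intro powr_mono2) auto
    qed
    also have "(x / real n) powr \<delta> = (real n / x) powr (- \<delta>)"
      using n xpos by (simp add: powr_minus powr_divide)
    finally have 1: "L x0 \<le> C * L x * (real n / x) powr (- \<delta>)"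
      using C(1) C(3)[OF x] by (simp add: mult_left_mono)
    have "\<bar>L (real n)\<bar> \<le> B" using False by (intro B) auto
    also have "\<dots> = B / L x0 * L x0" using C(3)[of x0] by simp
    also have "\<dots> \<le> B / L x0 * (C * L x * (real n / x) powr (- \<delta>))"
      using 1 B0 C(3)[of x0] by (intro mult_left_mono) auto
    also have "\<dots> = (B * C / L x0) * L x * (real n / x) powr (- \<delta>)" by simp
    also have "\<dots> \<le> C' * L x * ((real n / x) powr \<delta> + (real n / x) powr (- \<delta>))"
      using C(1) C(3)[OF x] B0 C(3)[of x0] \<open>C' > 0\<close>
      by (intro mult_mono) (auto simp: C'_def)
    finally show ?thesis .
  qed
  show ?thesis using \<open>C' > 0\<close> C(2,3) main by blast
qed

section \<open>Weighted sums as Riemann sums\<close>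

text \<open>
  The value \<open>g d\<close> is spread over \<open>{(d - 1) / x<..d / x}\<close>, which makes the sum accessible to
  dominated convergence.  The interval lies to the left of \<open>d / x\<close>, so that decreasing functions of
  \<open>d / x\<close> are bounded by their values at \<open>t\<close>.
\<close>

lemma sum_as_step_integral:
  fixes g :: "nat \<Rightarrow> real"
  assumes x: "x > 0" and g: "summable (\<lambda>n. \<bar>g (Suc n)\<bar>)"
  shows "integrable lborel (\<lambda>t. indicator {0<..} t * g (nat \<lceil>x * t\<rceil>))"
    and "(\<integral>t. indicator {0<..} t * g (nat \<lceil>x * t\<rceil>) \<partial>lborel) = (\<Sum>n. g (Suc n)) / x"
proof -
  define F where "F n t = g (Suc n) * indicator {real n / x<..real (Suc n) / x} t" for n t
  have mem: "t \<in> {real n / x<..real (Suc n) / x} \<longleftrightarrow> t > 0 \<and> n = nat \<lceil>x * t\<rceil> - 1" for n t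
  proof
    assume "t \<in> {real n / x<..real (Suc n) / x}"
    then have 1: "real n < x * t" "x * t \<le> real (Suc n)" using x by (auto simp: field_simps)
    then have "x * t > 0" by linarith
    then have "t > 0" using x by (simp add: zero_less_mult_iff)
    moreover have "\<lceil>x * t\<rceil> = int n + 1" using 1 by (intro ceiling_unique) auto
    ultimately show "t > 0 \<and> n = nat \<lceil>x * t\<rceil> - 1" by simp
  next
    assume t: "t > 0 \<and> n = nat \<lceil>x * t\<rceil> - 1"
    then have "x * t > 0" using x by simp
    then have "real n < x * t" "x * t \<le> real (Suc n)" using t by linarith+
    then show "t \<in> {real n / x<..real (Suc n) / x}" using x by (auto simp: field_simps)
  qed
  have F_eq: "F n t = (if n = nat \<lceil>x * t\<rceil> - 1 then indicator {0<..} t * g (nat \<lceil>x * t\<rceil>) else 0)" for n t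
  proof (cases "t > 0")
    case True
    then have "x * t > 0" using x by simp
    then have "Suc (nat \<lceil>x * t\<rceil> - 1) = nat \<lceil>x * t\<rceil>" by linarith
    then show ?thesis using True mem[of t n] by (auto simp: F_def indicator_def)
  next
    case False
    then show ?thesis using mem[of t n] by (auto simp: F_def indicator_def)
  qed
  have sumF: "(\<lambda>n. F n t) sums (indicator {0<..} t * g (nat \<lceil>x * t\<rceil>))" for t
    using sums_single[of "nat \<lceil>x * t\<rceil> - 1" "\<lambda>_. indicator {0<..} t * g (nat \<lceil>x * t\<rceil>)"]
    by (simp add: F_eq)
  have int: "integrable lborel (F n)" for n
    unfolding F_def using x
    by (intro integrable_mult_right integrable_real_indicator)
       (auto simp: emeasure_lborel_Ioc divide_right_mono simp del: of_nat_Suc)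
  have len: "measure lborel {real n / x<..real (Suc n) / x} = 1 / x" for n
    using x by (simp add: field_simps)
  have AEs: "AE t in lborel. summable (\<lambda>n. norm (F n t))"
  proof (rule AE_I2)
    show "summable (\<lambda>n. norm (F n t))" for t
      by (rule summable_finite[of "{nat \<lceil>x * t\<rceil> - 1}"]) (auto simp: F_eq)
  qed
  have norms: "summable (\<lambda>n. \<integral>t. norm (F n t) \<partial>lborel)"
    using summable_divide[OF g, of x] len
    by (simp add: F_def abs_mult del: of_nat_Suc)
  have eq: "(\<Sum>n. F n t) = indicator {0<..} t * g (nat \<lceil>x * t\<rceil>)" for t
    using sumF by (rule sums_unique[symmetric])
  show "integrable lborel (\<lambda>t. indicator {0<..} t * g (nat \<lceil>x * t\<rceil>))"
    using integrable_suminf[OF int AEs norms] unfolding eq .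
  show "(\<integral>t. indicator {0<..} t * g (nat \<lceil>x * t\<rceil>) \<partial>lborel) = (\<Sum>n. g (Suc n)) / x"
    using integral_suminf[OF int AEs norms] unfolding eq
    using suminf_divide[OF summable_rabs_cancel[OF g], of x] len by (simp add: F_def del: of_nat_Suc)
qed

text \<open>
  The dominating function of the Riemann sums below: the two exponents straddle \<open>-1\<close>, one for
  each end of the half-line, and the minimum is decreasing.
\<close>

lemma integrable_min_powr:
  fixes \<delta> :: real
  assumes "\<delta> > 0"
  shows "integrable lborel (\<lambda>t. indicator {0<..} t * min (t powr (-1+\<delta>)) (t powr (-1-\<delta>)))"
proof -
  have 1: "set_integrable lebesgue {0..1} (\<lambda>t. t powr (-1+\<delta>))"
    using has_integral_powr_from_0[of "-1+\<delta>" 1] assms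
    by (intro nonnegative_absolutely_integrable_1) (auto simp: integrable_on_def)
  have 2: "set_integrable lebesgue {1..} (\<lambda>t. t powr (-1-\<delta>))"
    using has_integral_powr_to_inf[of "-1-\<delta>" 1] assms
    by (intro nonnegative_absolutely_integrable_1) (auto simp: integrable_on_def)
  have "integrable lebesgue (\<lambda>t. indicator {0..1} t *\<^sub>R t powr (-1+\<delta>) + indicator {1..} t *\<^sub>R t powr (-1-\<delta>))"
    using 1 2 unfolding set_integrable_def by (rule Bochner_Integration.integrable_add)
  then have 3: "integrable lborel (\<lambda>t. indicator {0..1} t *\<^sub>R t powr (-1+\<delta>) + indicator {1..} t *\<^sub>R t powr (-1-\<delta>))"
    by (subst (asm) integrable_completion) auto
  show ?thesis
    by (rule Bochner_Integration.integrable_bound[OF 3]) (auto intro!: AE_I2 simp: indicator_def)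
qed

lemma ceiling_ratio_tendsto:
  fixes t :: real
  assumes t: "t > 0"
  shows "((\<lambda>x. real (nat \<lceil>x * t\<rceil>) / x) \<longlongrightarrow> t) at_top"
proof (rule tendsto_sandwich)
  show "\<forall>\<^sub>F x in at_top. t \<le> real (nat \<lceil>x * t\<rceil>) / x"
    using eventually_gt_at_top[of 0]
  proof eventually_elim
    case (elim x)
    have "x * t \<le> real (nat \<lceil>x * t\<rceil>)" by linarith
    then show ?case using elim by (simp add: field_simps)
  qed
  show "\<forall>\<^sub>F x in at_top. real (nat \<lceil>x * t\<rceil>) / x \<le> t + 1 / x"
    using eventually_gt_at_top[of 0]
  proof eventually_elim
    case (elim x)
    have "real (nat \<lceil>x * t\<rceil>) \<le> x * t + 1" using elim t mult_pos_pos[of x t] by linarith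
    then show ?case using elim by (simp add: field_simps)
  qed
  show "((\<lambda>x. t + 1 / x) \<longlongrightarrow> t) at_top" by real_asymp
qed simp

lemma inverse_ceiling_ratio_tendsto:
  fixes t :: real
  assumes "t > 0"
  shows "((\<lambda>x. x / real (nat \<lceil>x * t\<rceil>)) \<longlongrightarrow> 1 / t) at_top"
  using tendsto_inverse[OF ceiling_ratio_tendsto[OF assms]] assms
  by (simp add: inverse_eq_divide)

lemma positive_lborel_integral:
  fixes g :: "real \<Rightarrow> real"
  assumes int: "integrable lborel (\<lambda>t. indicator {0<..} t * g t)" and pos: "\<And>t. t > 0 \<Longrightarrow> g t > 0"
  shows "(\<integral>t. indicator {0<..} t * g t \<partial>lborel) > 0"
proof (rule ccontr)
  have nonneg: "AE t in lborel. 0 \<le> indicator {0<..} t * g t"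
    using pos by (auto intro!: AE_I2 simp: indicator_def less_imp_le)
  assume "\<not> ?thesis"
  then have "(\<integral>t. indicator {0<..} t * g t \<partial>lborel) = 0"
    using integral_nonneg_AE[OF nonneg] by simp
  then have "AE t in lborel. indicator {0<..} t * g t = 0"
    using integral_nonneg_eq_0_iff_AE[OF int nonneg] by simp
  then have "AE t in lborel. t \<notin> {1<..<2::real}"
  proof eventually_elim
    case (elim t)
    show ?case
    proof
      assume "t \<in> {1<..<2}"
      then show False using elim pos[of t] by simp
    qed
  qed
  then have "emeasure lborel {1<..<2::real} = 0"
    by (subst (asm) AE_iff_measurable[where N = "{1<..<2}"]) auto
  then show False by simp
qed

text \<open>
  After division by \<open>x powr (- \<gamma>) * L x\<close>, the summand with index \<open>d\<close> is \<open>1 / x\<close> times a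
  function of \<open>d / x\<close>, up to the factors \<open>l d\<close>, \<open>L d / L x\<close> and \<open>k x d\<close>, which converge along
  \<open>d = \<lceil>x * t\<rceil>\<close>.  Boundedness of the kernel makes the limit integrable at infinity, where \<open>\<gamma> > 0\<close>
  helps; its decay makes it integrable at the origin, where \<open>t powr (- \<gamma> - 1)\<close> is not.  The kernel
  may have any sign, which is used below for differences of tails.
\<close>

theorem regularly_varying_weighted_sum:
  fixes L :: "real \<Rightarrow> real" and l :: "nat \<Rightarrow> real" and k :: "real \<Rightarrow> nat \<Rightarrow> real" and \<phi> :: "real \<Rightarrow> real"
  assumes L: "slowly_varying L" and l: "l \<longlonglongrightarrow> l0" and l0: "l0 \<noteq> 0" and \<gamma>: "0 < \<gamma>" and \<kappa>: "\<gamma> < \<kappa>"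
    and bound: "\<And>x d. x > 0 \<Longrightarrow> d \<ge> 1 \<Longrightarrow> \<bar>k x d\<bar> \<le> C"
    and decay: "\<And>x d. x > 0 \<Longrightarrow> d \<ge> 1 \<Longrightarrow> \<bar>k x d\<bar> \<le> C * (real d / x) powr \<kappa>"
    and lim: "AE t in lborel. t > 0 \<longrightarrow> ((\<lambda>x. k x (nat \<lceil>x * t\<rceil>)) \<longlongrightarrow> \<phi> t) at_top"
    and \<phi> [measurable]: "\<phi> \<in> borel_measurable borel"
  defines "w \<equiv> \<lambda>d. real d powr (- \<gamma> - 1) * l d * L (real d)"
  shows "integrable lborel (\<lambda>t. indicator {0<..} t * (t powr (- \<gamma> - 1) * \<phi> t))"
    and "\<forall>\<^sub>F x in at_top. summable (\<lambda>n. \<bar>w (Suc n) * k x (Suc n)\<bar>)"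
    and "((\<lambda>x. (\<Sum>n. w (Suc n) * k x (Suc n)) / (x powr (- \<gamma>) * L x)) \<longlongrightarrow>
           l0 * (\<integral>t. indicator {0<..} t * (t powr (- \<gamma> - 1) * \<phi> t) \<partial>lborel)) at_top"
proof -
  note [measurable] = slowly_varyingD(1)[OF L]
  \<comment> \<open>Potter's bounds may cost \<open>\<delta>\<close> in each exponent, and \<open>\<delta>\<close> must remain for integrability\<close>
  define \<delta> where "\<delta> = min 1 (min \<gamma> (\<kappa> - \<gamma>)) / 2"
  have \<delta>: "\<delta> > 0" "2 * \<delta> \<le> \<gamma>" "2 * \<delta> \<le> \<kappa> - \<gamma>" "\<delta> < 1" using \<gamma> \<kappa> by (auto simp: \<delta>_def)
  from potter_bound_nat[OF L \<delta>(1)] obtain P x0 where P: "P > 0" "x0 \<ge> 1"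
    "\<And>x. x \<ge> x0 \<Longrightarrow> L x > 0"
    "\<And>x n. x \<ge> x0 \<Longrightarrow> n \<ge> 1 \<Longrightarrow> \<bar>L (real n)\<bar> \<le> P * L x * ((real n / x) powr \<delta> + (real n / x) powr (- \<delta>))"
    by blast
  from l obtain Bl where Bl: "Bl > 0" "\<And>n. \<bar>l n\<bar> \<le> Bl"
    using convergent_imp_Bseq[of l] unfolding convergent_def Bseq_def by auto
  have C: "C \<ge> 0" using bound[of 1 1] by auto
  define B where "B = 2 * Bl * P * C"
  have B: "B \<ge> 0" using Bl P C by (auto simp: B_def)
  \<comment> \<open>the summands after rescaling by \<open>x powr (- \<gamma>) L x / x\<close>\<close>
  define s where "s x d = (real d / x) powr (- \<gamma> - 1) * l d * (L (real d) / L x) * k x d" for x d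
  define S where "S x t = indicator {0<..} t * s x (nat \<lceil>x * t\<rceil>)" for x t
  have S_eq: "S x = (\<lambda>t. indicator {0<..} t * s x (nat \<lceil>x * t\<rceil>))" for x
    by (simp add: S_def fun_eq_iff)
  have s_bound: "\<bar>s x d\<bar> \<le> B * min ((real d / x) powr (-1+\<delta>)) ((real d / x) powr (-1-\<delta>))"
    if x: "x \<ge> x0" and d: "d \<ge> 1" for x d
  proof -
    define u where "u = real d / x"
    have u: "u > 0" using x d P(2) by (auto simp: u_def)
    have "\<bar>L (real d) / L x\<bar> \<le> P * (u powr \<delta> + u powr (- \<delta>))"
      using P(4)[OF x d] P(3)[OF x] by (simp add: u_def field_simps)
    moreover have "\<bar>k x d\<bar> \<le> C * min 1 (u powr \<kappa>)"
      using bound[of x d] decay[of x d] x d P(2) by (simp add: u_def min_def)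
    ultimately have "\<bar>l d\<bar> * \<bar>L (real d) / L x\<bar> * \<bar>k x d\<bar> \<le> Bl * (P * (u powr \<delta> + u powr (- \<delta>))) * (C * min 1 (u powr \<kappa>))"
      using Bl P C u by (intro mult_mono) auto
    moreover have "\<bar>s x d\<bar> = u powr (- \<gamma> - 1) * (\<bar>l d\<bar> * \<bar>L (real d) / L x\<bar> * \<bar>k x d\<bar>)"
      by (simp add: s_def u_def abs_mult mult.assoc)
    ultimately have "\<bar>s x d\<bar> \<le> u powr (- \<gamma> - 1) * (Bl * (P * (u powr \<delta> + u powr (- \<delta>))) * (C * min 1 (u powr \<kappa>)))"
      by (simp only: mult_left_mono powr_ge_zero)
    also have "\<dots> = Bl * P * C * ((u powr (-\<gamma>-1+\<delta>) + u powr (-\<gamma>-1-\<delta>)) * min 1 (u powr \<kappa>))"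
      using u by (simp add: powr_add powr_diff powr_minus field_simps)
    also have "(u powr (-\<gamma>-1+\<delta>) + u powr (-\<gamma>-1-\<delta>)) * min 1 (u powr \<kappa>) \<le>
       2 * min (u powr (-1+\<delta>)) (u powr (-1-\<delta>))"
    proof (cases "u \<ge> 1")
      case True
      have "u powr (-\<gamma>-1+\<delta>) \<le> u powr (-1-\<delta>)" "u powr (-\<gamma>-1-\<delta>) \<le> u powr (-1-\<delta>)"
        "u powr (-1-\<delta>) \<le> u powr (-1+\<delta>)" "1 \<le> u powr \<kappa>"
        using True \<delta> \<gamma> \<kappa> by (auto intro!: powr_mono ge_one_powr_ge_zero)
      then show ?thesis by simp
    next
      case False
      have "u powr \<kappa> \<le> 1" using False u \<gamma> \<kappa> powr_le1[of \<kappa> u] by simp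
      then have "(u powr (-\<gamma>-1+\<delta>) + u powr (-\<gamma>-1-\<delta>)) * min 1 (u powr \<kappa>) =
          u powr (\<kappa>-\<gamma>-1+\<delta>) + u powr (\<kappa>-\<gamma>-1-\<delta>)"
        using u by (simp add: ring_distribs algebra_simps flip: powr_add)
      moreover have "u powr (\<kappa>-\<gamma>-1+\<delta>) \<le> u powr (-1+\<delta>)" "u powr (\<kappa>-\<gamma>-1-\<delta>) \<le> u powr (-1+\<delta>)"
        "u powr (-1+\<delta>) \<le> u powr (-1-\<delta>)"
        using False u \<delta> \<gamma> \<kappa> by (auto intro!: powr_mono')
      ultimately show ?thesis by simp
    qed
    then have "Bl * P * C * ((u powr (-\<gamma>-1+\<delta>) + u powr (-\<gamma>-1-\<delta>)) * min 1 (u powr \<kappa>)) \<le>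
       Bl * P * C * (2 * min (u powr (-1+\<delta>)) (u powr (-1-\<delta>)))"
      using Bl P C by (intro mult_left_mono) auto
    finally show ?thesis by (simp add: B_def u_def)
  qed
  have summ: "summable (\<lambda>n. \<bar>s x (Suc n)\<bar>)" if x: "x \<ge> x0" for x
  proof (rule summable_comparison_test')
    have "summable (\<lambda>n. real n powr (-1-\<delta>))" using \<delta>(1) by (simp add: summable_real_powr_iff)
    then have "summable (\<lambda>n. real (Suc n) powr (-1-\<delta>))" by (subst summable_Suc_iff)
    then have "summable (\<lambda>n. B * (real (Suc n) powr (-1-\<delta>) / x powr (-1-\<delta>)))"
      by (intro summable_mult summable_divide)
    then show "summable (\<lambda>n. B * (real (Suc n) / x) powr (-1-\<delta>))"
      using x P(2) by (simp add: powr_divide)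
    fix n show "norm \<bar>s x (Suc n)\<bar> \<le> B * (real (Suc n) / x) powr (-1-\<delta>)"
      using s_bound[OF x, of "Suc n"] mult_left_mono[OF min.cobounded2 B] by (simp) (meson order_trans)
  qed
  have S_bound: "\<bar>S x t\<bar> \<le> B * (indicator {0<..} t * min (t powr (-1+\<delta>)) (t powr (-1-\<delta>)))"
    if x: "x \<ge> x0" for x t
  proof (cases "t > 0")
    case True
    define d where "d = nat \<lceil>x * t\<rceil>"
    have xt: "x > 0" "x * t > 0" using x P(2) True by auto
    have d: "d \<ge> 1" "x * t \<le> real d" using xt unfolding d_def by linarith+
    then have td: "t \<le> real d / x" using xt by (simp add: field_simps)
    have "\<bar>S x t\<bar> \<le> B * min ((real d / x) powr (-1+\<delta>)) ((real d / x) powr (-1-\<delta>))"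
      using True s_bound[OF x d(1)] by (simp add: S_def d_def)
    also have "\<dots> \<le> B * min (t powr (-1+\<delta>)) (t powr (-1-\<delta>))"
      using td True \<delta> by (intro mult_left_mono B min.mono powr_mono2') auto
    finally show ?thesis using True by simp
  qed (simp add: S_def)
  define G where "G t = indicator {0<..} t * (t powr (- \<gamma> - 1) * \<phi> t)" for t
  have S_lim: "AE t in lborel. ((\<lambda>x. S x t) \<longlongrightarrow> l0 * G t) at_top"
    using lim
  proof eventually_elim
    case (elim t)
    show ?case
    proof (cases "t > 0")
      case True
      note ratio = ceiling_ratio_tendsto[OF True]
      have inf: "filterlim (\<lambda>x. nat \<lceil>x * t\<rceil>) at_top at_top"
        using True by real_asymp
      have "((\<lambda>x. s x (nat \<lceil>x * t\<rceil>)) \<longlongrightarrow> t powr (- \<gamma> - 1) * l0 * 1 * \<phi> t) at_top"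
        unfolding s_def using True elim
        by (intro tendsto_mult tendsto_powr ratio tendsto_const filterlim_compose[OF l inf]
             slowly_varying_compose[OF L True ratio]) auto
      then show ?thesis using True by (simp add: S_def G_def mult_ac)
    next
      case False
      then show ?thesis by (simp add: S_def G_def)
    qed
  qed
  have [measurable]: "S x \<in> borel_measurable lborel" for x
  proof -
    have [measurable]: "s x \<in> measurable (count_space UNIV) borel" by simp
    show ?thesis unfolding S_def by measurable
  qed
  have [measurable]: "G \<in> borel_measurable lborel" unfolding G_def by measurable
  have int_bound: "integrable lborel (\<lambda>t. B * (indicator {0<..} t * min (t powr (-1+\<delta>)) (t powr (-1-\<delta>))))"
    by (intro integrable_mult_right integrable_min_powr \<delta>)
  have ev_bound: "\<forall>\<^sub>F x in at_top. AE t in lborel. norm (S x t) \<le> B * (indicator {0<..} t * min (t powr (-1+\<delta>)) (t powr (-1-\<delta>)))"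
    using eventually_ge_at_top[of x0] by eventually_elim (use S_bound in auto)
  have conv: "((\<lambda>x. integral\<^sup>L lborel (S x)) \<longlongrightarrow> (\<integral>t. l0 * G t \<partial>lborel)) at_top"
    by (rule integral_dominated_convergence_at_top[OF _ _ int_bound S_lim ev_bound]) measurable
  have sum_eq: "w (Suc n) * k x (Suc n) = x powr (- \<gamma>) * L x / x * s x (Suc n)" if "x \<ge> x0" for x n
  proof -
    have x: "x > 0" "L x > 0" using that P(2) P(3)[of x] by auto
    have "(real (Suc n) / x) powr (- \<gamma> - 1) = real (Suc n) powr (- \<gamma> - 1) / (x powr (- \<gamma>) / x)"
      using x by (simp add: powr_divide powr_diff)
    then show ?thesis using x by (simp add: w_def s_def field_simps)
  qed
  show "\<forall>\<^sub>F x in at_top. summable (\<lambda>n. \<bar>w (Suc n) * k x (Suc n)\<bar>)"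
    using eventually_ge_at_top[of x0]
  proof eventually_elim
    case (elim x)
    show ?case unfolding sum_eq[OF elim] abs_mult[of _ "s _ _"]
      using summ[OF elim] by (rule summable_mult)
  qed
  have int_eq: "\<forall>\<^sub>F x in at_top. integral\<^sup>L lborel (S x) = (\<Sum>n. w (Suc n) * k x (Suc n)) / (x powr (- \<gamma>) * L x)"
    using eventually_ge_at_top[of x0]
  proof eventually_elim
    case (elim x)
    then have x: "x > 0" "L x > 0" using P(2) P(3)[of x] by auto
    have "integral\<^sup>L lborel (S x) = (\<Sum>n. s x (Suc n)) / x"
      using sum_as_step_integral(2)[OF x(1), of "s x"] summ[OF elim] by (simp add: S_eq)
    moreover have "(\<Sum>n. w (Suc n) * k x (Suc n)) = x powr (- \<gamma>) * L x / x * (\<Sum>n. s x (Suc n))"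
      unfolding sum_eq[OF elim] using summable_rabs_cancel[OF summ[OF elim]] by (rule suminf_mult)
    ultimately show ?case using x by simp
  qed
  show "((\<lambda>x. (\<Sum>n. w (Suc n) * k x (Suc n)) / (x powr (- \<gamma>) * L x)) \<longlongrightarrow>
           l0 * (\<integral>t. indicator {0<..} t * (t powr (- \<gamma> - 1) * \<phi> t) \<partial>lborel)) at_top"
    using Lim_transform_eventually[OF conv int_eq] by (simp add: G_def)
  have "integrable lborel (\<lambda>t. l0 * G t)"
    by (rule integrable_dominated_convergence_at_top[OF _ _ int_bound S_lim ev_bound]) measurable
  then show "integrable lborel (\<lambda>t. indicator {0<..} t * (t powr (- \<gamma> - 1) * \<phi> t))"
    using l0 by (simp add: G_def)
qed

section \<open>Quotients of Gamma functions and moments\<close>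

text \<open>
  Log-convexity of \<open>\<Gamma>\<close> between \<open>z\<close> and \<open>z + 1\<close>, and between \<open>z + s\<close> and \<open>z + s + 1\<close>.
\<close>

lemma Gamma_shift_bounds:
  fixes z s :: real
  assumes z: "z > 0" and s: "0 \<le> s" "s \<le> 1"
  shows "Gamma (z + s) \<le> z powr s * Gamma z"
    and "z * Gamma z \<le> (z + s) powr (1 - s) * Gamma (z + s)"
proof -
  have pos: "Gamma z > 0" "Gamma (z + s) > 0" "Gamma (z + 1) = z * Gamma z"
    "Gamma (z + s + 1) = (z + s) * Gamma (z + s)"
    using z s by (auto intro: Gamma_real_pos simp: Gamma_plus1 nonpos_Ints_def)
  have "ln (Gamma ((1 - s) * z + s * (z + 1))) \<le> (1 - s) * ln (Gamma z) + s * ln (Gamma (z + 1))"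
    using convex_onD[OF log_convex_Gamma_real, of s z "z + 1"] z s by simp
  also have "(1 - s) * z + s * (z + 1) = z + s" by (simp add: algebra_simps)
  also have "(1 - s) * ln (Gamma z) + s * ln (Gamma (z + 1)) = ln (z powr s * Gamma z)"
    using z pos by (simp add: ln_mult ln_powr algebra_simps)
  finally show "Gamma (z + s) \<le> z powr s * Gamma z"
    using z pos by simp
  have "ln (Gamma ((1 - (1 - s)) * (z + s) + (1 - s) * (z + s + 1))) \<le>
      (1 - (1 - s)) * ln (Gamma (z + s)) + (1 - s) * ln (Gamma (z + s + 1))"
    using convex_onD[OF log_convex_Gamma_real, of "1 - s" "z + s" "z + s + 1"] z s by simp
  also have "(1 - (1 - s)) * (z + s) + (1 - s) * (z + s + 1) = z + 1" by (simp add: algebra_simps)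
  also have "(1 - (1 - s)) * ln (Gamma (z + s)) + (1 - s) * ln (Gamma (z + s + 1)) =
      ln ((z + s) powr (1 - s) * Gamma (z + s))"
  proof -
    have "ln (Gamma (z + s + 1)) = ln (z + s) + ln (Gamma (z + s))"
      using z s less_imp_neq[OF pos(2)] unfolding pos(4) by (subst ln_mult) auto
    moreover have "ln ((z + s) powr (1 - s) * Gamma (z + s)) = (1 - s) * ln (z + s) + ln (Gamma (z + s))"
      using z s pos(2) less_imp_neq[OF pos(2)] by (subst ln_mult) (auto simp: ln_powr)
    ultimately show ?thesis by (simp add: algebra_simps)
  qed
  finally show "z * Gamma z \<le> (z + s) powr (1 - s) * Gamma (z + s)"
    using z s pos by (simp add: ln_le_cancel_iff)
qed

text \<open>
  For \<open>a\<close> in the unit interval the two log-convexity bounds squeeze the quotient; the functional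
  equation extends the limit to all nonnegative \<open>a\<close>.
\<close>

lemma Gamma_ratio_tendsto:
  fixes a :: real
  assumes "a \<ge> 0"
  shows "((\<lambda>z. Gamma (z + a) / (z powr a * Gamma z)) \<longlongrightarrow> 1) at_top"
proof -
  have base: "((\<lambda>z. Gamma (z + s) / (z powr s * Gamma z)) \<longlongrightarrow> 1) at_top" if s: "0 \<le> s" "s \<le> 1" for s :: real
  proof (rule tendsto_sandwich)
    show "\<forall>\<^sub>F z in at_top. (z / (z + s)) powr (1 - s) \<le> Gamma (z + s) / (z powr s * Gamma z)"
      using eventually_gt_at_top[of 0]
    proof eventually_elim
      case (elim z)
      then have "Gamma z > 0" "Gamma (z + s) > 0" using s by (auto intro: Gamma_real_pos)
      moreover define p q r where "p = z powr s" "q = (z + s) powr (1 - s)" "r = z powr (1 - s)"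
      moreover have "p > 0" "q > 0" "r * p = z"
        using elim s by (auto simp: p_q_r_def simp flip: powr_add)
      moreover have "r * p * Gamma z \<le> q * Gamma (z + s)"
        using Gamma_shift_bounds(2)[OF elim s] \<open>r * p = z\<close> by (simp add: p_q_r_def)
      ultimately have "r / q \<le> Gamma (z + s) / (p * Gamma z)"
        by (simp add: field_simps)
      then show ?case using elim s by (simp add: powr_divide p_q_r_def)
    qed
    show "\<forall>\<^sub>F z in at_top. Gamma (z + s) / (z powr s * Gamma z) \<le> 1"
      using eventually_gt_at_top[of 0]
    proof eventually_elim
      case (elim z)
      then have "Gamma z > 0" by (auto intro: Gamma_real_pos)
      then show ?case
        using Gamma_shift_bounds(1)[OF elim s] elim by (simp add: field_simps)
    qed
    have "((\<lambda>z. z / (z + s)) \<longlongrightarrow> 1) at_top" by real_asymp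
    from tendsto_powr[OF this tendsto_const[of "1 - s"]]
    show "((\<lambda>z. (z / (z + s)) powr (1 - s)) \<longlongrightarrow> 1) at_top" by simp
  qed simp
  have "((\<lambda>z. Gamma (z + (s + real n)) / (z powr (s + real n) * Gamma z)) \<longlongrightarrow> 1) at_top"
    if s: "0 \<le> s" "s \<le> 1" for s :: real and n
  proof (induction n)
    case (Suc n)
    have "((\<lambda>z. (z + (s + real n)) / z) \<longlongrightarrow> 1) at_top" by real_asymp
    from tendsto_mult[OF this Suc]
    have "((\<lambda>z. (z + (s + real n)) / z * (Gamma (z + (s + real n)) / (z powr (s + real n) * Gamma z))) \<longlongrightarrow> 1) at_top"
      by simp
    moreover have "\<forall>\<^sub>F z in at_top. (z + (s + real n)) / z * (Gamma (z + (s + real n)) / (z powr (s + real n) * Gamma z)) =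
        Gamma (z + (s + real (Suc n))) / (z powr (s + real (Suc n)) * Gamma z)"
      using eventually_gt_at_top[of 0]
    proof eventually_elim
      case (elim z)
      then have "z + (s + real n) > 0" using s by simp
      then have "z + (s + real n) \<notin> \<int>\<^sub>\<le>\<^sub>0" by (auto simp: nonpos_Ints_def)
      from Gamma_plus1[OF this] have "Gamma (z + (s + real (Suc n))) = (z + (s + real n)) * Gamma (z + (s + real n))"
        by (simp add: add_ac)
      moreover have "z powr (s + real (Suc n)) = z powr (s + real n) * z"
        using elim powr_add[of z "s + real n" 1] by (simp add: add_ac)
      ultimately show ?case by simp
    qed
    ultimately show ?case by (rule Lim_transform_eventually)
  qed (use base s in simp)
  from this[of "a - real (nat \<lfloor>a\<rfloor>)" "nat \<lfloor>a\<rfloor>"] show ?thesis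
    using assms floor_correct[of a] by simp
qed

text \<open>
  For \<open>z > 0\<close> the power \<open>z powr \<gamma>\<close> is the integral of \<open>\<gamma> * t powr (- \<gamma> - 1)\<close> over
  \<open>{1 / z<..}\<close>, and Tonelli's theorem exchanges the integral with the expectation.  The variable is
  the reciprocal of the usual one because the limits of the weighted sums come in this form.
\<close>

lemma (in prob_space) moment_from_tail:
  fixes Z :: "'a \<Rightarrow> real"
  assumes Z [measurable]: "Z \<in> borel_measurable M" and \<gamma>: "\<gamma> > 0"
    and int: "integrable lborel (\<lambda>t. indicator {0<..} t * (t powr (- \<gamma> - 1) * \<P>(\<omega> in M. Z \<omega> > 1 / t)))"
  shows "integrable M (\<lambda>\<omega>. max (Z \<omega>) 0 powr \<gamma>)"
    and "(\<integral>\<omega>. max (Z \<omega>) 0 powr \<gamma> \<partial>M) =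
           \<gamma> * (\<integral>t. indicator {0<..} t * (t powr (- \<gamma> - 1) * \<P>(\<omega> in M. Z \<omega> > 1 / t)) \<partial>lborel)"
proof -
  define p where "p t = indicator {0<..} t * (t powr (- \<gamma> - 1) * \<P>(\<omega> in M. Z \<omega> > 1 / t))" for t
  define I where "I = (\<integral>t. p t \<partial>lborel)"
  define c where "c t = ennreal (\<gamma> * t powr (- \<gamma> - 1))" for t
  define T where "T z = {t. 0 < t \<and> 1 / t < z}" for z :: real
  have p_int: "integrable lborel p" using int by (simp add: p_def[abs_def])
  have p_nonneg: "0 \<le> p t" for t by (simp add: p_def)
  have I: "I \<ge> 0" unfolding I_def using p_nonneg by (intro Bochner_Integration.integral_nonneg) auto
  interpret P: pair_sigma_finite lborel M ..
  have inner: "(\<integral>\<^sup>+t. c t * indicator (T z) t \<partial>lborel) = ennreal (max z 0 powr \<gamma>)" for z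
  proof (cases "z > 0")
    case True
    have "(\<integral>\<^sup>+t. c t * indicator (T z) t \<partial>lborel) = (\<integral>\<^sup>+t. c t * indicator {1 / z..} t \<partial>lborel)"
    proof (rule nn_integral_cong_AE)
      show "AE t in lborel. c t * indicator (T z) t = c t * indicator {1 / z..} t"
        using AE_lborel_singleton[of "1 / z"]
      proof eventually_elim
        case (elim t)
        have "t \<in> T z \<longleftrightarrow> 1 / z \<le> t"
        proof
          assume "t \<in> T z" then show "1 / z \<le> t" using True by (auto simp: T_def field_simps)
        next
          assume *: "1 / z \<le> t"
          moreover have "1 / z > 0" using True by simp
          ultimately have "t > 0" "1 / z < t" using elim by linarith+
          then show "t \<in> T z" using True by (auto simp: T_def field_simps)
        qed
        then show ?case by (simp add: indicator_def)
      qed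
    qed
    also have "\<dots> = ennreal (0 - (- ((1 / z) powr (- \<gamma>))))"
      unfolding c_def
    proof (rule nn_integral_FTC_atLeast)
      fix t assume t: "1 / z \<le> t"
      moreover have "1 / z > 0" using True by simp
      ultimately have "t > 0" by linarith
      then show "((\<lambda>t. - (t powr (- \<gamma>))) has_real_derivative \<gamma> * t powr (- \<gamma> - 1)) (at t)"
        by (auto intro!: derivative_eq_intros)
      show "0 \<le> \<gamma> * t powr (- \<gamma> - 1)" using \<gamma> by simp
    next
      show "((\<lambda>t. - (t powr (- \<gamma>))) \<longlongrightarrow> 0) at_top" using \<gamma> by real_asymp
    qed simp
    also have "(1 / z) powr (- \<gamma>) = z powr \<gamma>" using True by (simp add: powr_divide powr_minus)
    finally show ?thesis using True by simp
  next
    case False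
    have "\<not> (1 / t < z)" if "t > 0" for t
      using that False less_imp_le[of 0 "1 / t"] by (auto simp: not_less intro: order_trans[of z 0])
    then have "T z = {}" by (auto simp: T_def)
    then show ?thesis using False by simp
  qed
  have "(\<integral>\<^sup>+\<omega>. ennreal (max (Z \<omega>) 0 powr \<gamma>) \<partial>M) =
     (\<integral>\<^sup>+\<omega>. (\<integral>\<^sup>+t. c t * indicator (T (Z \<omega>)) t \<partial>lborel) \<partial>M)"
    by (simp add: inner)
  also have "\<dots> = (\<integral>\<^sup>+t. (\<integral>\<^sup>+\<omega>. c t * indicator (T (Z \<omega>)) t \<partial>M) \<partial>lborel)"
    unfolding c_def T_def
    by (rule P.Fubini'[where f = "\<lambda>t \<omega>. ennreal (\<gamma> * t powr (- \<gamma> - 1)) * indicator {t. 0 < t \<and> 1 / t < Z \<omega>} t"]) measurable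
  also have "\<dots> = (\<integral>\<^sup>+t. ennreal \<gamma> * ennreal (p t) \<partial>lborel)"
  proof (rule nn_integral_cong)
    fix t :: real
    show "(\<integral>\<^sup>+\<omega>. c t * indicator (T (Z \<omega>)) t \<partial>M) = ennreal \<gamma> * ennreal (p t)"
    proof (cases "t > 0")
      case True
      have "(\<integral>\<^sup>+\<omega>. c t * indicator (T (Z \<omega>)) t \<partial>M) =
        (\<integral>\<^sup>+\<omega>. c t * indicator {\<omega>\<in>space M. Z \<omega> > 1 / t} \<omega> \<partial>M)"
        using True by (intro nn_integral_cong) (auto simp: T_def indicator_def)
      also have "\<dots> = c t * emeasure M {\<omega>\<in>space M. Z \<omega> > 1 / t}"
        by (rule nn_integral_cmult_indicator) measurable
      also have "\<dots> = ennreal \<gamma> * ennreal (p t)"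
        using True \<gamma> by (simp add: c_def p_def emeasure_eq_measure ennreal_mult mult.assoc)
      finally show ?thesis .
    qed (simp add: T_def p_def)
  qed
  also have "\<dots> = ennreal \<gamma> * (\<integral>\<^sup>+t. ennreal (p t) \<partial>lborel)"
    using borel_measurable_integrable[OF p_int] by (intro nn_integral_cmult) simp
  also have "\<dots> = ennreal \<gamma> * ennreal I"
    unfolding I_def using p_int p_nonneg by (subst nn_integral_eq_integral) auto
  also have "\<dots> = ennreal (\<gamma> * I)" using \<gamma> I by (simp add: ennreal_mult)
  finally have nn: "(\<integral>\<^sup>+\<omega>. ennreal (max (Z \<omega>) 0 powr \<gamma>) \<partial>M) = ennreal (\<gamma> * I)" .
  have meas: "(\<lambda>\<omega>. max (Z \<omega>) 0 powr \<gamma>) \<in> borel_measurable M" by measurable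
  show "integrable M (\<lambda>\<omega>. max (Z \<omega>) 0 powr \<gamma>)"
    by (rule integrableI_nn_integral_finite[OF meas _ nn]) (use \<gamma> I in auto)
  show "(\<integral>\<omega>. max (Z \<omega>) 0 powr \<gamma> \<partial>M) =
           \<gamma> * (\<integral>t. indicator {0<..} t * (t powr (- \<gamma> - 1) * \<P>(\<omega> in M. Z \<omega> > 1 / t)) \<partial>lborel)"
    unfolding p_def[symmetric] I_def[symmetric]
    using meas nn \<gamma> I by (intro integral_eq_nn_integral[THEN trans]) auto
qed

section \<open>Forward equations of pure birth processes\<close>

text \<open>
  Only increments to the right are controlled, but their error does not depend on the starting
  point.  An increment to the left of \<open>t\<close> is an increment to the right of an earlier point \<open>y\<close>, whose
  slope \<open>v y\<close> is close to \<open>v t\<close>; hence right expansions give a two-sided derivative.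
\<close>

lemma derivative_from_uniform_increments:
  fixes u v \<epsilon> :: "real \<Rightarrow> real"
  assumes inc: "\<And>s h. 0 \<le> s \<Longrightarrow> 0 < h \<Longrightarrow> \<bar>u (s + h) - u s - h * v s\<bar> \<le> \<epsilon> h"
    and \<epsilon>: "((\<lambda>h. \<epsilon> h / h) \<longlongrightarrow> 0) (at_right 0)"
    and V: "\<And>s. 0 \<le> s \<Longrightarrow> \<bar>v s\<bar> \<le> V"
  shows "continuous_on {0..} u"
    and "continuous_on {0..} v \<Longrightarrow> 0 \<le> t \<Longrightarrow> (u has_real_derivative v t) (at t within {0..})"
proof -
  have dist_lim: "filterlim (\<lambda>y. \<bar>y - t\<bar>) (at_right 0) (at t within {0..})" for t :: real
  proof -
    have "((\<lambda>y. \<bar>y - t\<bar>) \<longlongrightarrow> \<bar>t - t\<bar>) (at t within {0..})" by (intro tendsto_intros)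
    then show ?thesis
      by (auto simp: filterlim_at eventually_at_filter)
  qed
  have ratio: "((\<lambda>y. \<epsilon> \<bar>y - t\<bar> / \<bar>y - t\<bar>) \<longlongrightarrow> 0) (at t within {0..})" for t
    using filterlim_compose[OF \<epsilon> dist_lim] .
  have bound: "\<bar>(u y - u t) / (y - t) - v t\<bar> \<le> \<epsilon> \<bar>y - t\<bar> / \<bar>y - t\<bar> + \<bar>v y - v t\<bar>"
    if "0 \<le> t" "0 \<le> y" "y \<noteq> t" for y t
  proof -
    have "\<bar>u y - u t - (y - t) * v t\<bar> \<le> \<epsilon> \<bar>y - t\<bar> + \<bar>y - t\<bar> * \<bar>v y - v t\<bar>"
    proof (cases "t < y")
      case True
      then show ?thesis using inc[of t "y - t"] that by (auto intro: order_trans)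
    next
      case False
      then have "\<bar>u t - u y - (t - y) * v y\<bar> \<le> \<epsilon> \<bar>y - t\<bar>"
        using inc[of y "t - y"] that by simp
      moreover have "u y - u t - (y - t) * v t = - (u t - u y - (t - y) * v y) + (y - t) * (v y - v t)"
        by (simp add: algebra_simps)
      ultimately show ?thesis using abs_mult[of "y - t" "v y - v t"] by linarith
    qed
    then have "\<bar>u y - u t - (y - t) * v t\<bar> / \<bar>y - t\<bar> \<le> (\<epsilon> \<bar>y - t\<bar> + \<bar>y - t\<bar> * \<bar>v y - v t\<bar>) / \<bar>y - t\<bar>"
      by (rule divide_right_mono) simp
    moreover have "(u y - u t) / (y - t) - v t = (u y - u t - (y - t) * v t) / (y - t)"
      using that by (simp add: field_simps)
    ultimately show ?thesis using that by (simp add: add_divide_distrib abs_divide)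
  qed
  have in_S: "\<forall>\<^sub>F y in at t within {0..}. 0 \<le> y \<and> y \<noteq> t" for t :: real
    by (auto simp: eventually_at_filter)
  show cont: "continuous_on {0..} u"
    unfolding continuous_on_def
  proof
    fix t :: real assume "t \<in> {0..}"
    then have t: "0 \<le> t" by simp
    have "((\<lambda>y. u y - u t) \<longlongrightarrow> 0) (at t within {0..})"
    proof (rule Lim_null_comparison)
      show "\<forall>\<^sub>F y in at t within {0..}. norm (u y - u t) \<le> (\<epsilon> \<bar>y - t\<bar> / \<bar>y - t\<bar> + 3 * V) * \<bar>y - t\<bar>"
        using in_S[of t]
      proof eventually_elim
        case (elim y)
        have "\<bar>(u y - u t) / (y - t)\<bar> \<le> \<epsilon> \<bar>y - t\<bar> / \<bar>y - t\<bar> + 3 * V"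
          using bound[OF t, of y] V[OF t] V[of y] elim by linarith
        then have "\<bar>(u y - u t) / (y - t)\<bar> * \<bar>y - t\<bar> \<le> (\<epsilon> \<bar>y - t\<bar> / \<bar>y - t\<bar> + 3 * V) * \<bar>y - t\<bar>"
          by (rule mult_right_mono) simp
        then show ?case using elim by (simp add: abs_divide)
      qed
      have "((\<lambda>y. (\<epsilon> \<bar>y - t\<bar> / \<bar>y - t\<bar> + 3 * V) * \<bar>y - t\<bar>) \<longlongrightarrow> (0 + 3 * V) * \<bar>t - t\<bar>) (at t within {0..})"
        by (intro tendsto_intros ratio)
      then show "((\<lambda>y. (\<epsilon> \<bar>y - t\<bar> / \<bar>y - t\<bar> + 3 * V) * \<bar>y - t\<bar>) \<longlongrightarrow> 0) (at t within {0..})" by simp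
    qed
    then show "(u \<longlongrightarrow> u t) (at t within {0..})" by (simp add: LIM_zero_iff)
  qed
  show "(u has_real_derivative v t) (at t within {0..})" if v: "continuous_on {0..} v" and t: "0 \<le> t"
    unfolding has_field_derivative_iff
  proof (rule LIM_zero_cancel, rule Lim_null_comparison)
    show "\<forall>\<^sub>F y in at t within {0..}. norm ((u y - u t) / (y - t) - v t) \<le> \<epsilon> \<bar>y - t\<bar> / \<bar>y - t\<bar> + \<bar>v y - v t\<bar>"
      using in_S[of t] by eventually_elim (use bound[OF t] in auto)
    have "(v \<longlongrightarrow> v t) (at t within {0..})" using v t by (auto simp: continuous_on_def)
    then have "((\<lambda>y. \<epsilon> \<bar>y - t\<bar> / \<bar>y - t\<bar> + \<bar>v y - v t\<bar>) \<longlongrightarrow> 0 + \<bar>v t - v t\<bar>) (at t within {0..})"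
      by (intro tendsto_intros ratio)
    then show "((\<lambda>y. \<epsilon> \<bar>y - t\<bar> / \<bar>y - t\<bar> + \<bar>v y - v t\<bar>) \<longlongrightarrow> 0) (at t within {0..})" by simp
  qed
qed

text \<open>
  The value \<open>\<alpha> j\<close> is the rate at which a pure birth process leaves state \<open>j\<close>, and \<open>u j t\<close> is the
  probability that it is in state \<open>j\<close> at time \<open>t\<close> when started from \<open>0\<close>.
\<close>

definition forward_equations :: "(nat \<Rightarrow> real) \<Rightarrow> (nat \<Rightarrow> real \<Rightarrow> real) \<Rightarrow> bool" where
  "forward_equations \<alpha> u \<longleftrightarrow> (\<forall>j. u j 0 = (if j = 0 then 1 else 0) \<and>
     (\<forall>t\<ge>0. (u j has_real_derivative
        (if j = 0 then 0 else \<alpha> (j - 1) * u (j - 1) t) - \<alpha> j * u j t) (at t within {0..})))"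

text \<open>
  The Markov property at the times \<open>s\<close> and \<open>s + h\<close>, together with monotone paths, writes the law at
  time \<open>s + h\<close> as a finite sum over the earlier states.  Jumps of size two or more have probability
  \<open>o(h)\<close>, because staying put and moving by one already account for a mass \<open>1 - o(h)\<close>.  The transition
  function is arbitrary from states that are not charged at time \<open>s\<close>, so every estimate keeps the
  factor \<open>q i s\<close>.
\<close>

lemma (in prob_space) pure_birth_forward_equations:
  assumes pb: "pure_birth_process M f \<xi>"
  shows "forward_equations (\<lambda>j. f (Suc j)) (\<lambda>j t. \<P>(\<omega> in M. \<xi> t \<omega> = j))"
proof -
  define q where "q j t = \<P>(\<omega> in M. \<xi> t \<omega> = j)" for j t
  from pb obtain p where
    meas: "\<And>t. t \<ge> 0 \<Longrightarrow> \<xi> t \<in> measurable M (count_space UNIV)"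
    and start: "\<And>\<omega>. \<omega> \<in> space M \<Longrightarrow> \<xi> 0 \<omega> = 0"
    and mono: "\<And>\<omega>. \<omega> \<in> space M \<Longrightarrow> mono_on {0..} (\<lambda>t. \<xi> t \<omega>)"
    and markov: "\<And>(n :: nat) (t :: nat \<Rightarrow> real) (x :: nat \<Rightarrow> nat).
           0 \<le> t 0 \<Longrightarrow> (\<forall>i\<le>n. t i < t (Suc i)) \<Longrightarrow>
           \<P>(\<omega> in M. \<forall>i\<le>Suc n. \<xi> (t i) \<omega> = x i) =
             \<P>(\<omega> in M. \<forall>i\<le>n. \<xi> (t i) \<omega> = x i) * p (t (Suc n) - t n) (x n) (x (Suc n))"
    and rate1: "\<And>k. (\<lambda>h. p h k (Suc k) - f (Suc k) * h) \<in> o[at_right 0](\<lambda>h. h)"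
    and rate0: "\<And>k. (\<lambda>h. p h k k - (1 - f (Suc k) * h)) \<in> o[at_right 0](\<lambda>h. h)"
    unfolding pure_birth_process_def by blast
  have meas': "{\<omega> \<in> space M. \<xi> t \<omega> = i} \<in> events" if "t \<ge> 0" for t i
    using measurable_sets[OF meas[OF that], of "{i}"] by (simp add: vimage_def Int_def conj_commute)
  have all_le_1: "(\<forall>i\<le>Suc 0. P i) \<longleftrightarrow> P 0 \<and> P (Suc 0)" for P by (auto simp: le_Suc_eq)
  have joint: "\<P>(\<omega> in M. \<xi> s \<omega> = i \<and> \<xi> (s + h) \<omega> = j) = q i s * p h i j" if "0 \<le> s" "0 < h" for s h i j
    using markov[of "\<lambda>k. if k = 0 then s else s + h" 0 "\<lambda>k. if k = 0 then i else j"] that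
    by (simp add: q_def all_le_1)
  have q_bounds: "0 \<le> q j t" "q j t \<le> 1" for j t by (simp_all add: q_def)
  have joint_meas: "{\<omega> \<in> space M. \<xi> s \<omega> = i \<and> \<xi> (s + h) \<omega> = j} \<in> events" if "0 \<le> s" "0 < h" for s h i j
    using sets.Int[OF meas'[of s i] meas'[of "s + h" j]] that by (simp add: Int_def conj_ac cong: conj_cong)
  have decompose: "q j (s + h) = (\<Sum>i\<le>j. q i s * p h i j)" if sh: "0 \<le> s" "0 < h" for s h j
  proof -
    have "{\<omega> \<in> space M. \<xi> (s + h) \<omega> = j} = (\<Union>i\<in>{..j}. {\<omega> \<in> space M. \<xi> s \<omega> = i \<and> \<xi> (s + h) \<omega> = j})"
      using mono_onD[OF mono, of _ s "s + h"] sh by force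
    then have "q j (s + h) = prob (\<Union>i\<in>{..j}. {\<omega> \<in> space M. \<xi> s \<omega> = i \<and> \<xi> (s + h) \<omega> = j})"
      by (simp add: q_def)
    also have "\<dots> = (\<Sum>i\<le>j. \<P>(\<omega> in M. \<xi> s \<omega> = i \<and> \<xi> (s + h) \<omega> = j))"
      using joint_meas[OF sh] by (intro finite_measure_finite_Union) (auto simp: disjoint_family_on_def)
    finally show ?thesis using joint[OF sh] by simp
  qed
  define \<epsilon>0 where "\<epsilon>0 i h = \<bar>p h i i - (1 - f (Suc i) * h)\<bar> + \<bar>p h i (Suc i) - f (Suc i) * h\<bar>" for i h
  have \<epsilon>0_nonneg: "0 \<le> \<epsilon>0 i h" for i h by (simp add: \<epsilon>0_def)
  have jump: "0 \<le> q i s * p h i j \<and> q i s * p h i j \<le> q i s * \<epsilon>0 i h"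
    if sh: "0 \<le> s" "0 < h" and j: "j \<noteq> i" "j \<noteq> Suc i" for s h i j
  proof -
    have "q i s * p h i j + q i s * p h i i + q i s * p h i (Suc i) =
      prob (\<Union>k\<in>{j, i, Suc i}. {\<omega> \<in> space M. \<xi> s \<omega> = i \<and> \<xi> (s + h) \<omega> = k})"
      using joint_meas[OF sh] j
      by (subst finite_measure_finite_Union) (auto simp: disjoint_family_on_def joint[OF sh])
    also have "\<dots> \<le> q i s"
      unfolding q_def using meas'[OF sh(1)] by (intro finite_measure_mono) auto
    finally have "q i s * p h i j \<le> q i s * (1 - p h i i - p h i (Suc i))" by (simp add: algebra_simps)
    also have "\<dots> \<le> q i s * \<epsilon>0 i h"
      using q_bounds by (intro mult_left_mono) (auto simp: \<epsilon>0_def)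
    finally show ?thesis using joint[OF sh, of i j, symmetric] by (simp add: q_def)
  qed
  define v where "v j t = (if j = 0 then 0 else f (Suc (j - 1)) * q (j - 1) t) - f (Suc j) * q j t" for j t
  define \<epsilon> where "\<epsilon> j h = (\<Sum>i\<le>j. \<epsilon>0 i h)" for j h
  have increment: "\<bar>q j (s + h) - q j s - h * v j s\<bar> \<le> \<epsilon> j h" if sh: "0 \<le> s" "0 < h" for j s h
  proof -
    \<comment> \<open>the transitions from \<open>i\<close> to \<open>j\<close> that the forward equation accounts for\<close>
    define e where "e i = (if i = j then 1 - f (Suc j) * h else if Suc i = j then f (Suc i) * h else 0)" for i
    have summand: "\<bar>q i s * p h i j - q i s * e i\<bar> \<le> \<epsilon>0 i h" if "i \<le> j" for i
    proof -
      have "\<bar>q i s * p h i j - q i s * e i\<bar> \<le> q i s * \<epsilon>0 i h"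
      proof (cases "j = i \<or> j = Suc i")
        case True
        then have "\<bar>p h i j - e i\<bar> \<le> \<epsilon>0 i h" by (auto simp: e_def \<epsilon>0_def)
        then have "q i s * \<bar>p h i j - e i\<bar> \<le> q i s * \<epsilon>0 i h" using q_bounds by (intro mult_left_mono)
        moreover have "\<bar>q i s * p h i j - q i s * e i\<bar> = q i s * \<bar>p h i j - e i\<bar>"
          using q_bounds by (simp add: abs_mult flip: right_diff_distrib)
        ultimately show ?thesis by simp
      next
        case False
        then show ?thesis using jump[OF sh, of j i] by (auto simp: e_def)
      qed
      also have "\<dots> \<le> 1 * \<epsilon>0 i h" using q_bounds \<epsilon>0_nonneg by (intro mult_right_mono)
      finally show ?thesis by simp
    qed
    have "(\<Sum>i\<le>j. q i s * e i) = q j s + h * v j s"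
    proof (cases j)
      case 0
      then show ?thesis by (simp add: e_def v_def algebra_simps)
    next
      case (Suc m)
      have "(\<Sum>i\<le>j. q i s * e i) = (\<Sum>i\<in>{m, j}. q i s * e i)"
        using Suc by (intro sum.mono_neutral_right) (auto simp: e_def)
      then show ?thesis using Suc by (simp add: e_def v_def algebra_simps)
    qed
    then have "q j (s + h) - q j s - h * v j s = (\<Sum>i\<le>j. q i s * p h i j - q i s * e i)"
      using decompose[OF sh, of j] by (simp add: sum_subtractf)
    also have "\<bar>\<dots>\<bar> \<le> (\<Sum>i\<le>j. \<bar>q i s * p h i j - q i s * e i\<bar>)" by (rule sum_abs)
    also have "\<dots> \<le> \<epsilon> j h" unfolding \<epsilon>_def using summand by (intro sum_mono) auto
    finally show ?thesis .
  qed
  have \<epsilon>_lim: "((\<lambda>h. \<epsilon> j h / h) \<longlongrightarrow> 0) (at_right 0)" for j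
  proof -
    have "\<epsilon> j \<in> o[at_right 0](\<lambda>h. h)"
      unfolding \<epsilon>_def \<epsilon>0_def using rate0 rate1
      by (intro big_sum_in_smallo sum_in_smallo) simp_all
    then show ?thesis by (rule smalloD_tendsto)
  qed
  have v_bound: "\<bar>v j s\<bar> \<le> \<bar>f (Suc (j - 1))\<bar> + \<bar>f (Suc j)\<bar>" for j s
  proof -
    have "\<bar>f a * q b s\<bar> \<le> \<bar>f a\<bar>" for a b
      using mult_left_le[of "q b s" "\<bar>f a\<bar>"] q_bounds by (simp add: abs_mult)
    note * = this[of "Suc (j - 1)" "j - 1"] this[of "Suc j" j]
    show ?thesis
    proof (cases "j = 0")
      case True
      then have "v j s = - (f (Suc j) * q j s)" by (simp add: v_def)
      then show ?thesis using * by linarith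
    next
      case False
      then have "v j s = f (Suc (j - 1)) * q (j - 1) s - f (Suc j) * q j s" by (simp add: v_def)
      then show ?thesis using * by linarith
    qed
  qed
  have q_cont: "continuous_on {0..} (q j)" for j
    using derivative_from_uniform_increments(1)[OF increment \<epsilon>_lim v_bound] by simp
  have v_cont: "continuous_on {0..} (v j)" for j
    unfolding v_def by (cases "j = 0") (auto intro!: continuous_intros q_cont)
  have deriv: "(q j has_real_derivative v j t) (at t within {0..})" if "0 \<le> t" for j t
    using derivative_from_uniform_increments(2)[OF increment \<epsilon>_lim v_bound v_cont that] by simp
  have q0: "q j 0 = (if j = 0 then 1 else 0)" for j
  proof -
    have "{\<omega> \<in> space M. \<xi> 0 \<omega> = j} = (if j = 0 then space M else {})" using start by auto
    then show ?thesis by (simp add: q_def prob_space)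
  qed
  show ?thesis
    unfolding forward_equations_def q_def[symmetric] using q0 deriv[unfolded v_def] by simp
qed

lemma continuous_on_max_0:
  fixes w :: "real \<Rightarrow> real"
  assumes "continuous_on {0..} w"
  shows "continuous_on UNIV (\<lambda>t. w (max 0 t))"
proof -
  have "continuous_on UNIV (\<lambda>t::real. max 0 t)" by (intro continuous_intros)
  then show ?thesis by (rule continuous_on_compose2[OF assms]) auto
qed

lemma integrable_exponential_density_mult:
  fixes w :: "real \<Rightarrow> real"
  assumes lam: "lam > 0" and cont: "continuous_on {0..} w" and bound: "\<And>t. 0 \<le> t \<Longrightarrow> \<bar>w t\<bar> \<le> B"
  shows "integrable lborel (\<lambda>t. exponential_density lam t * w (max 0 t))"
proof -
  interpret E: prob_space "density lborel (exponential_density lam)"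
    by (rule prob_space_exponential_density[OF lam])
  have [measurable]: "(\<lambda>t. w (max 0 t)) \<in> borel_measurable borel"
    using continuous_on_max_0[OF cont] by (rule borel_measurable_continuous_onI)
  have "integrable (density lborel (exponential_density lam)) (\<lambda>t. w (max 0 t))"
    by (rule E.integrable_const_bound[where B = B]) (auto intro!: AE_I2 bound)
  then show ?thesis
    using lam by (subst (asm) integrable_density) (auto intro!: AE_I2 exponential_density_nonneg)
qed

text \<open>
  Integration by parts on the half-line.  The functions are only given for \<open>t \<ge> 0\<close>, and
  \<open>max 0 t\<close> extends them continuously to the whole line.
\<close>

lemma laplace_transform_derivative:
  fixes u v :: "real \<Rightarrow> real"
  assumes lam: "lam > 0"
    and deriv: "\<And>t. 0 \<le> t \<Longrightarrow> (u has_real_derivative v t) (at t within {0..})"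
    and v: "continuous_on {0..} v"
    and bounds: "\<And>t. 0 \<le> t \<Longrightarrow> \<bar>u t\<bar> \<le> B" "\<And>t. 0 \<le> t \<Longrightarrow> \<bar>v t\<bar> \<le> B"
  shows "(\<integral>t. exponential_density lam t * v (max 0 t) \<partial>lborel) =
    lam * (\<integral>t. exponential_density lam t * u (max 0 t) \<partial>lborel) - lam * u 0"
proof -
  have u: "continuous_on {0..} u"
    using deriv by (auto intro: DERIV_continuous_on)
  note ext = continuous_on_max_0
  have [measurable]: "(\<lambda>t. u (max 0 t)) \<in> borel_measurable borel" "(\<lambda>t. v (max 0 t)) \<in> borel_measurable borel"
    using ext[OF u] ext[OF v] by (auto intro: borel_measurable_continuous_onI)
  note int_u = integrable_exponential_density_mult[OF lam u bounds(1)]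
    and int_v = integrable_exponential_density_mult[OF lam v bounds(2)]
  define g where "g t = exp (- (lam * t)) * (v (max 0 t) - lam * u (max 0 t))" for t
  have g_int: "integrable lborel (\<lambda>t. indicator {0<..} t *\<^sub>R g t)"
    and g_eq: "(\<integral>t. indicator {0<..} t *\<^sub>R g t \<partial>lborel) =
      ((\<integral>t. exponential_density lam t * v (max 0 t) \<partial>lborel) -
       lam * (\<integral>t. exponential_density lam t * u (max 0 t) \<partial>lborel)) / lam"
  proof -
    define h where "h t = (exponential_density lam t * v (max 0 t) - lam * (exponential_density lam t * u (max 0 t))) / lam" for t
    have h_int: "integrable lborel h"
      unfolding h_def using int_u int_v by auto
    have ae: "AE t in lborel. h t = indicator {0<..} t *\<^sub>R g t"
      using AE_lborel_singleton[of 0]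
      by eventually_elim (use lam in \<open>auto simp: h_def g_def exponential_density_def field_simps indicator_def\<close>)
    have [measurable]: "g \<in> borel_measurable borel" unfolding g_def by measurable
    show "integrable lborel (\<lambda>t. indicator {0<..} t *\<^sub>R g t)"
      using h_int by (rule integrable_cong_AE_imp) (use ae in \<open>auto elim: eventually_mono\<close>)
    have "(\<integral>t. indicator {0<..} t *\<^sub>R g t \<partial>lborel) = integral\<^sup>L lborel h"
      using ae borel_measurable_integrable[OF h_int]
      by (intro integral_cong_AE) (auto elim: eventually_mono)
    also have "\<dots> = ((\<integral>t. exponential_density lam t * v (max 0 t) \<partial>lborel) -
       lam * (\<integral>t. exponential_density lam t * u (max 0 t) \<partial>lborel)) / lam"
      unfolding h_def using int_u int_v by simp
    finally show "(\<integral>t. indicator {0<..} t *\<^sub>R g t \<partial>lborel) =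
      ((\<integral>t. exponential_density lam t * v (max 0 t) \<partial>lborel) -
       lam * (\<integral>t. exponential_density lam t * u (max 0 t) \<partial>lborel)) / lam" .
  qed
  define F where "F t = exp (- (lam * t)) * u (max 0 t)" for t
  have "(LBINT t=0..\<infinity>. g t) = 0 - u 0"
  proof (rule interval_integral_FTC_integrable)
    fix x assume "0 < ereal x"
    then have x: "x > 0" by (simp add: zero_ereal_def)
    have "(u has_real_derivative v x) (at x)"
      using deriv[of x] x at_within_interior[of x "{0..}"] interiorI[of "{0<..}" x "{0..}"] by auto
    moreover have "\<forall>\<^sub>F t in nhds x. u (max 0 t) = u t"
      using eventually_nhds_in_open[of "{0<..}" x] x by (auto elim: eventually_mono)
    ultimately have "((\<lambda>t. u (max 0 t)) has_real_derivative v x) (at x)"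
      using DERIV_cong_ev[of x x "\<lambda>t. u (max 0 t)" u "v x" "v x"] by simp
    then have "(F has_real_derivative g x) (at x)"
      unfolding F_def g_def using x
      by (auto intro!: derivative_eq_intros simp: algebra_simps)
    then show "(F has_vector_derivative g x) (at x)"
      by (simp add: has_real_derivative_iff_has_vector_derivative)
    have "continuous_on UNIV g" unfolding g_def by (intro continuous_intros ext u v)
    then show "isCont g x" by (simp add: continuous_on_eq_continuous_at)
  next
    show "set_integrable lborel (einterval 0 \<infinity>) g"
      using g_int by (simp add: set_integrable_def zero_ereal_def)
    have F_cont: "continuous_on UNIV F" unfolding F_def by (intro continuous_intros ext u)
    then have "(F \<longlongrightarrow> F 0) (at_right 0)"
      by (auto simp: continuous_on_def intro: tendsto_within_subset)
    then show "((F \<circ> real_of_ereal) \<longlongrightarrow> u 0) (at_right 0)"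
      by (simp add: zero_ereal_def ereal_tendsto_simps F_def)
    have "(F \<longlongrightarrow> 0) at_top"
    proof (rule Lim_null_comparison)
      show "\<forall>\<^sub>F t in at_top. norm (F t) \<le> B * exp (- (lam * t))"
        by (intro always_eventually allI) (auto simp: F_def abs_mult bounds(1))
      show "((\<lambda>t. B * exp (- (lam * t))) \<longlongrightarrow> 0) at_top" using lam by real_asymp
    qed
    then show "((F \<circ> real_of_ereal) \<longlongrightarrow> 0) (at_left \<infinity>)" by (simp add: ereal_tendsto_simps)
  qed simp
  then have "(\<integral>t. indicator {0<..} t *\<^sub>R g t \<partial>lborel) = - u 0"
    by (simp add: interval_lebesgue_integral_0_infty set_lebesgue_integral_def)
  then show ?thesis using g_eq lam by (simp add: field_simps)
qed

lemma forward_equations_cong: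
  assumes "forward_equations \<alpha> u" and eq: "\<And>j t. 0 \<le> t \<Longrightarrow> w j t = u j t"
  shows "forward_equations \<alpha> w"
  unfolding forward_equations_def
proof (intro allI conjI impI)
  fix j and t :: real
  show "w j 0 = (if j = 0 then 1 else 0)"
    using assms by (simp add: forward_equations_def)
  assume t: "0 \<le> t"
  have wu: "w i t = u i t" for i using eq t by simp
  have "(u j has_real_derivative (if j = 0 then 0 else \<alpha> (j - 1) * w (j - 1) t) - \<alpha> j * w j t) (at t within {0..})"
    using assms(1) t unfolding forward_equations_def wu by blast
  from this zero_less_one show "(w j has_real_derivative (if j = 0 then 0 else \<alpha> (j - 1) * w (j - 1) t) - \<alpha> j * w j t) (at t within {0..})"
    by (rule has_field_derivative_transform_within) (use t eq in auto)
qed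

text \<open>
  The rate of leaving state \<open>(i, j - i)\<close> in the product of the two processes is
  \<open>c * i + a + c * (j - i) + b\<close>, which depends only on the sum \<open>j\<close> of the two components.  This is
  where affine rates are needed.
\<close>

lemma forward_equations_convolution:
  fixes a b c :: real
  assumes q: "forward_equations (\<lambda>j. c * real j + a) q"
    and u: "forward_equations (\<lambda>j. c * real j + b) u"
  shows "forward_equations (\<lambda>j. c * real j + (a + b)) (\<lambda>j t. \<Sum>i\<le>j. q i t * u (j - i) t)"
  unfolding forward_equations_def
proof (intro allI conjI impI)
  fix j and t :: real
  have "(\<Sum>i\<le>j. q i 0 * u (j - i) 0) = (\<Sum>i\<le>j. if i = 0 then (if j = 0 then 1 else 0) else 0)"
    using q u by (intro sum.cong) (auto simp: forward_equations_def)
  then show "(\<Sum>i\<le>j. q i 0 * u (j - i) 0) = (if j = 0 then 1 else 0)"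
    by simp
  assume t: "0 \<le> t"
  define q' where "q' i = (if i = 0 then 0 else (c * real (i - 1) + a) * q (i - 1) t) - (c * real i + a) * q i t" for i
  define u' where "u' i = (if i = 0 then 0 else (c * real (i - 1) + b) * u (i - 1) t) - (c * real i + b) * u i t" for i
  have dq: "(q i has_real_derivative q' i) (at t within {0..})"
    and du: "(u i has_real_derivative u' i) (at t within {0..})" for i
    using q u t unfolding forward_equations_def q'_def u'_def by blast+
  have "((\<lambda>t. \<Sum>i\<le>j. q i t * u (j - i) t) has_real_derivative (\<Sum>i\<le>j. q' i * u (j - i) t + u' (j - i) * q i t)) (at t within {0..})"
    by (intro DERIV_sum DERIV_mult dq du)
  moreover have "(\<Sum>i\<le>j. q' i * u (j - i) t + u' (j - i) * q i t) =
     (if j = 0 then 0 else (c * real (j - 1) + (a + b)) * (\<Sum>i\<le>j - 1. q i t * u (j - 1 - i) t)) -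
     (c * real j + (a + b)) * (\<Sum>i\<le>j. q i t * u (j - i) t)"
  proof -
    define births where "births i = (if i = 0 then 0 else (c * real (i - 1) + a) * q (i - 1) t * u (j - i) t)
      + (if j - i = 0 then 0 else (c * real (j - i - 1) + b) * u (j - i - 1) t * q i t)" for i
    have "(\<Sum>i\<le>j. q' i * u (j - i) t + u' (j - i) * q i t) =
        (\<Sum>i\<le>j. births i - (c * real j + (a + b)) * (q i t * u (j - i) t))"
      by (intro sum.cong refl) (auto simp: births_def q'_def u'_def algebra_simps of_nat_diff)
    moreover have "(\<Sum>i\<le>j. births i) =
       (if j = 0 then 0 else (c * real (j - 1) + (a + b)) * (\<Sum>i\<le>j - 1. q i t * u (j - 1 - i) t))"
    proof (cases j)
      case (Suc m)
      have 1: "(\<Sum>i\<le>Suc m. if i = 0 then 0 else (c * real (i - 1) + a) * q (i - 1) t * u (Suc m - i) t) =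
          (\<Sum>i\<le>m. (c * real i + a) * q i t * u (m - i) t)"
        by (subst sum.atMost_Suc_shift) simp
      have 2: "(\<Sum>i\<le>Suc m. if Suc m - i = 0 then 0 else (c * real (Suc m - i - 1) + b) * u (Suc m - i - 1) t * q i t) =
          (\<Sum>i\<le>m. (c * real (m - i) + b) * u (m - i) t * q i t)"
        by (subst sum.atMost_Suc) (auto intro!: sum.cong simp: Suc_diff_le)
      have "(\<Sum>i\<le>j. births i) = (\<Sum>i\<le>m. (c * real i + a) * q i t * u (m - i) t + (c * real (m - i) + b) * u (m - i) t * q i t)"
        unfolding births_def Suc sum.distrib 1 2 ..
      also have "\<dots> = (\<Sum>i\<le>m. (c * real m + (a + b)) * (q i t * u (m - i) t))"
        by (intro sum.cong) (auto simp: algebra_simps of_nat_diff)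
      finally show ?thesis using Suc by (simp add: sum_distrib_left)
    qed (simp add: births_def)
    ultimately show ?thesis by (simp add: sum_subtractf sum_distrib_left)
  qed
  ultimately show "((\<lambda>t. \<Sum>i\<le>j. q i t * u (j - i) t) has_real_derivative
     (if j = 0 then 0 else (c * real (j - 1) + (a + b)) * (\<Sum>i\<le>j - 1. q i t * u (j - 1 - i) t)) -
     (c * real j + (a + b)) * (\<Sum>i\<le>j. q i t * u (j - i) t)) (at t within {0..})"
    by simp
qed

text \<open>
  The function \<open>I\<close> is the law of the process at an independent exponential time with rate \<open>lam\<close>;
  the recurrence is the Laplace transform of the forward equation.
\<close>

lemma forward_equations_exponential_time:
  assumes fe: "forward_equations \<alpha> u" and lam: "lam > 0"
    and bounds: "\<And>j t. 0 \<le> t \<Longrightarrow> 0 \<le> u j t \<and> u j t \<le> 1"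
  defines "I \<equiv> \<lambda>j. \<integral>t. exponential_density lam t * u j (max 0 t) \<partial>lborel"
  shows "(lam + \<alpha> j) * I j = (if j = 0 then lam else \<alpha> (j - 1) * I (j - 1))"
proof -
  define v where "v t = (if j = 0 then 0 else \<alpha> (j - 1) * u (j - 1) t) - \<alpha> j * u j t" for t
  have deriv: "(u j has_real_derivative v t) (at t within {0..})" if "0 \<le> t" for t
    using fe that unfolding forward_equations_def v_def by blast
  have cont: "continuous_on {0..} (u i)" for i
    using fe by (auto simp: forward_equations_def intro!: DERIV_continuous_on)
  have v_cont: "continuous_on {0..} v"
    unfolding v_def by (cases "j = 0") (auto intro!: continuous_intros cont)
  have b: "\<bar>\<alpha> i * u k t\<bar> \<le> \<bar>\<alpha> i\<bar>" if "0 \<le> t" for i k t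
    using bounds[OF that, of k] mult_left_le[of "u k t" "\<bar>\<alpha> i\<bar>"] by (simp add: abs_mult)
  define B where "B = 1 + \<bar>\<alpha> (j - 1)\<bar> + \<bar>\<alpha> j\<bar>"
  have uB: "\<bar>u i t\<bar> \<le> B" if "0 \<le> t" for i t
    using bounds[OF that, of i] by (auto simp: B_def)
  have vB: "\<bar>v t\<bar> \<le> B" if "0 \<le> t" for t
  proof -
    note * = b[OF that, of "j - 1" "j - 1"] b[OF that, of j j]
    show ?thesis
    proof (cases "j = 0")
      case True
      then have "v t = - (\<alpha> j * u j t)" by (simp add: v_def)
      then show ?thesis using * unfolding B_def by linarith
    next
      case False
      then have "v t = \<alpha> (j - 1) * u (j - 1) t - \<alpha> j * u j t" by (simp add: v_def)
      then show ?thesis using * unfolding B_def by linarith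
    qed
  qed
  have L: "(\<integral>t. exponential_density lam t * v (max 0 t) \<partial>lborel) = lam * I j - lam * u j 0"
    unfolding I_def by (rule laplace_transform_derivative[OF lam deriv v_cont uB vB])
  note int = integrable_exponential_density_mult[OF lam cont uB]
  have "(\<integral>t. exponential_density lam t * v (max 0 t) \<partial>lborel) =
    (\<integral>t. (if j = 0 then 0 else \<alpha> (j - 1)) * (exponential_density lam t * u (j - 1) (max 0 t))
       - \<alpha> j * (exponential_density lam t * u j (max 0 t)) \<partial>lborel)"
    by (intro Bochner_Integration.integral_cong) (auto simp: v_def algebra_simps)
  also have "\<dots> = (if j = 0 then 0 else \<alpha> (j - 1)) * I (j - 1) - \<alpha> j * I j"
    unfolding I_def using int by simp
  finally have "(if j = 0 then 0 else \<alpha> (j - 1)) * I (j - 1) - \<alpha> j * I j = lam * I j - lam * u j 0"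
    using L by simp
  moreover have "u j 0 = (if j = 0 then 1 else 0)" using fe by (simp add: forward_equations_def)
  ultimately show ?thesis by (auto simp: algebra_simps)
qed

section \<open>Stopping at an independent exponential time\<close>

lemma (in prob_space) exponential_AE_nonneg:
  assumes "distributed M lborel \<tau> (exponential_density lam)"
  shows "AE \<omega> in M. 0 \<le> \<tau> \<omega>"
proof -
  have [measurable]: "\<tau> \<in> borel_measurable M"
    using distributed_measurable[OF assms] by simp
  have "AE t in density lborel (exponential_density lam). 0 \<le> t"
    by (auto simp: AE_density exponential_density_def)
  then show ?thesis
    unfolding distributed_distr_eq_density[OF assms, symmetric] by (subst (asm) AE_distr_iff) auto
qed

text \<open>
  Independence is only available for events at deterministic times.  The clock is therefore
  approximated from the right by clocks with countably many values, for which the claim is a sum over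
  these values; right-continuity of the events and continuity of their probabilities allow passing to
  the limit, and also give the measurability of the event at the random time.
\<close>

lemma (in prob_space) event_at_independent_time:
  fixes E :: "real \<Rightarrow> 'a set" and \<tau> :: "'a \<Rightarrow> real"
  assumes \<tau> [measurable]: "\<tau> \<in> borel_measurable M"
    and E: "\<And>t. 0 \<le> t \<Longrightarrow> E t \<in> G" and G: "G \<subseteq> events"
    and indep: "indep_set G (sets (vimage_algebra (space M) \<tau> borel))"
    and cadlag: "\<And>\<omega> t. \<omega> \<in> space M \<Longrightarrow> 0 \<le> t \<Longrightarrow> \<forall>\<^sub>F s in at_right t. \<omega> \<in> E s \<longleftrightarrow> \<omega> \<in> E t"
    and cont: "continuous_on {0..} (\<lambda>t. prob (E t))"
    and pos: "AE \<omega> in M. 0 \<le> \<tau> \<omega>"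
  shows "{\<omega> \<in> space M. 0 \<le> \<tau> \<omega> \<and> \<omega> \<in> E (\<tau> \<omega>)} \<in> events"
    and "prob {\<omega> \<in> space M. 0 \<le> \<tau> \<omega> \<and> \<omega> \<in> E (\<tau> \<omega>)} = (\<integral>\<omega>. prob (E (max 0 (\<tau> \<omega>))) \<partial>M)"
proof -
  have E_ev: "E t \<in> events" if "0 \<le> t" for t using E[OF that] G by auto
  \<comment> \<open>approximations of the clock from the right that take countably many values\<close>
  define r where "r n t = (real (nat \<lfloor>real (Suc n) * t\<rfloor>) + 1) / real (Suc n)" for n t
  have r_gt: "t < r n t" "r n t \<le> t + 1 / real (Suc n)" if "0 \<le> t" for n t
  proof -
    define N where "N = real (Suc n)"
    have N: "N > 0" by (simp add: N_def)
    then have "0 \<le> N * t" using that by simp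
    then have "N * t < real (nat \<lfloor>N * t\<rfloor>) + 1" "real (nat \<lfloor>N * t\<rfloor>) + 1 \<le> N * t + 1"
      by linarith+
    then show "t < r n t" "r n t \<le> t + 1 / real (Suc n)"
      unfolding r_def N_def[symmetric] using N by (simp_all add: field_simps)
  qed
  have r_lim: "(\<lambda>n. r n t) \<longlonglongrightarrow> t" if "0 \<le> t" for t
  proof (rule tendsto_sandwich)
    show "\<forall>\<^sub>F n in sequentially. t \<le> r n t" using r_gt[OF that] by (simp add: less_imp_le)
    show "\<forall>\<^sub>F n in sequentially. r n t \<le> t + 1 / real (Suc n)" using r_gt[OF that] by simp
    show "(\<lambda>n. t + 1 / real (Suc n)) \<longlonglongrightarrow> t" by real_asymp
  qed simp
  define cell where "cell n k = {\<omega> \<in> space M. 0 \<le> \<tau> \<omega> \<and> nat \<lfloor>real (Suc n) * \<tau> \<omega>\<rfloor> = k}" for n k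
  define pt where "pt n k = (real k + 1) / real (Suc n)" for n k :: nat
  have pt: "0 \<le> pt n k" for n k by (simp add: pt_def)
  have cell_r: "r n (\<tau> \<omega>) = pt n k" if "\<omega> \<in> cell n k" for n k \<omega>
    using that by (simp add: cell_def r_def pt_def)
  have cell_vim: "cell n k \<in> sets (vimage_algebra (space M) \<tau> borel)" for n k
  proof -
    have "{t. 0 \<le> t \<and> nat \<lfloor>real (Suc n) * t\<rfloor> = k} \<in> sets borel" by measurable
    from in_vimage_algebra[OF this, of \<tau> "space M"] show ?thesis
      by (simp add: cell_def vimage_def Int_def conj_commute)
  qed
  have cell_ev [measurable]: "cell n k \<in> events" for n k
    unfolding cell_def by measurable
  define A where "A n = {\<omega> \<in> space M. 0 \<le> \<tau> \<omega> \<and> \<omega> \<in> E (r n (\<tau> \<omega>))}" for n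
  define A' where "A' = {\<omega> \<in> space M. 0 \<le> \<tau> \<omega> \<and> \<omega> \<in> E (\<tau> \<omega>)}"
  have A_eq: "A n = (\<Union>k. cell n k \<inter> E (pt n k))" for n
    using cell_r by (auto simp: A_def cell_def r_def pt_def)
  have A_ev [measurable]: "A n \<in> events" for n
    unfolding A_eq using E_ev[OF pt] by auto
  have A_lim: "(\<lambda>n. indicator (A n) \<omega> :: real) \<longlonglongrightarrow> indicator A' \<omega>" if \<omega>: "\<omega> \<in> space M" for \<omega>
  proof (cases "0 \<le> \<tau> \<omega>")
    case True
    have "filterlim (\<lambda>n. r n (\<tau> \<omega>)) (at_right (\<tau> \<omega>)) sequentially"
      using r_lim[OF True] r_gt(1)[OF True]
      by (auto simp: filterlim_at eventually_at_filter intro!: always_eventually less_imp_neq[symmetric])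
    with cadlag[OF \<omega> True] have "\<forall>\<^sub>F n in sequentially. \<omega> \<in> E (r n (\<tau> \<omega>)) \<longleftrightarrow> \<omega> \<in> E (\<tau> \<omega>)"
      by (auto simp: filterlim_iff)
    then have "\<forall>\<^sub>F n in sequentially. indicator (A n) \<omega> = (indicator A' \<omega> :: real)"
      by eventually_elim (simp add: A_def A'_def indicator_def)
    then show ?thesis by (rule tendsto_eventually)
  qed (simp add: A_def A'_def)
  have ind_meas: "(\<lambda>\<omega>. indicator A' \<omega> :: real) \<in> borel_measurable M"
    by (rule borel_measurable_LIMSEQ_real[OF A_lim]) measurable
  have "{\<omega> \<in> space M. (indicator A' \<omega> :: real) = 1} \<in> events"
    using ind_meas by measurable
  also have "{\<omega> \<in> space M. (indicator A' \<omega> :: real) = 1} = A'" by (auto simp: A'_def indicator_def)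
  finally have A'_ev: "A' \<in> events" .
  then show "{\<omega> \<in> space M. 0 \<le> \<tau> \<omega> \<and> \<omega> \<in> E (\<tau> \<omega>)} \<in> events" by (simp add: A'_def)
  define u where "u t = prob (E (max 0 t))" for t
  have u_cont: "continuous_on UNIV u"
    unfolding u_def by (rule continuous_on_max_0[OF cont])
  then have [measurable]: "u \<in> borel_measurable borel" by (rule borel_measurable_continuous_onI)
  have u_bounds: "0 \<le> u t" "u t \<le> 1" for t by (auto simp: u_def)
  have [measurable]: "r n \<in> borel_measurable borel" for n unfolding r_def by measurable
  have prob_A: "prob (A n) = (\<integral>\<omega>. indicator {0..} (\<tau> \<omega>) * u (r n (\<tau> \<omega>)) \<partial>M)" for n
  proof -
    have "ennreal (prob (A n)) = emeasure M (\<Union>k. cell n k \<inter> E (pt n k))"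
      by (simp add: emeasure_eq_measure A_eq)
    also have "\<dots> = (\<Sum>k. emeasure M (cell n k \<inter> E (pt n k)))"
      using E_ev[OF pt] by (intro suminf_emeasure[symmetric]) (auto simp: disjoint_family_on_def cell_def)
    also have "\<dots> = (\<Sum>k. \<integral>\<^sup>+\<omega>. ennreal (u (pt n k)) * indicator (cell n k) \<omega> \<partial>M)"
    proof (rule suminf_cong)
      fix k
      have "prob (E (pt n k) \<inter> cell n k) = prob (E (pt n k)) * prob (cell n k)"
        using indep_setD[OF indep E[OF pt] cell_vim] .
      then show "emeasure M (cell n k \<inter> E (pt n k)) = (\<integral>\<^sup>+\<omega>. ennreal (u (pt n k)) * indicator (cell n k) \<omega> \<partial>M)"
        using pt[of n k] by (simp add: nn_integral_cmult_indicator u_def emeasure_eq_measure Int_commute ennreal_mult)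
    qed
    also have "\<dots> = (\<integral>\<^sup>+\<omega>. (\<Sum>k. ennreal (u (pt n k)) * indicator (cell n k) \<omega>) \<partial>M)"
      by (rule nn_integral_suminf[symmetric]) measurable
    also have "\<dots> = (\<integral>\<^sup>+\<omega>. ennreal (indicator {0..} (\<tau> \<omega>) * u (r n (\<tau> \<omega>))) \<partial>M)"
    proof (rule nn_integral_cong)
      fix \<omega> assume \<omega>: "\<omega> \<in> space M"
      define k0 where "k0 = nat \<lfloor>real (Suc n) * \<tau> \<omega>\<rfloor>"
      have "ennreal (u (pt n k)) * indicator (cell n k) \<omega> =
          (if k = k0 then ennreal (indicator {0..} (\<tau> \<omega>) * u (r n (\<tau> \<omega>))) else 0)" for k
        using \<omega> by (auto simp: cell_def k0_def r_def pt_def indicator_def)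
      then show "(\<Sum>k. ennreal (u (pt n k)) * indicator (cell n k) \<omega>) = ennreal (indicator {0..} (\<tau> \<omega>) * u (r n (\<tau> \<omega>)))"
        using sums_unique[OF sums_single[of k0 "\<lambda>_. ennreal (indicator {0..} (\<tau> \<omega>) * u (r n (\<tau> \<omega>)))"]]
        by simp
    qed
    finally have "(\<integral>\<^sup>+\<omega>. ennreal (indicator {0..} (\<tau> \<omega>) * u (r n (\<tau> \<omega>))) \<partial>M) = ennreal (prob (A n))" ..
    then show ?thesis
      using u_bounds by (subst integral_eq_nn_integral) (auto intro!: AE_I2)
  qed
  \<comment> \<open>the exact formula for the approximating clocks passes to the limit on both sides\<close>
  have "(\<lambda>n. \<integral>\<omega>. indicator (A n) \<omega> \<partial>M) \<longlonglongrightarrow> (\<integral>\<omega>. (indicator A' \<omega> :: real) \<partial>M)"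
    by (rule integral_dominated_convergence[where w = "\<lambda>_. 1"])
       (use ind_meas A_lim in \<open>auto intro!: AE_I2 simp: indicator_def[abs_def]\<close>)
  then have "(\<lambda>n. prob (A n)) \<longlonglongrightarrow> prob A'"
    using A'_ev by simp
  moreover have "(\<lambda>n. \<integral>\<omega>. indicator {0..} (\<tau> \<omega>) * u (r n (\<tau> \<omega>)) \<partial>M) \<longlonglongrightarrow> (\<integral>\<omega>. u (\<tau> \<omega>) \<partial>M)"
  proof (rule integral_dominated_convergence[where w = "\<lambda>_. 1"])
    show "AE \<omega> in M. (\<lambda>n. indicator {0..} (\<tau> \<omega>) * u (r n (\<tau> \<omega>))) \<longlonglongrightarrow> u (\<tau> \<omega>)"
      using pos
    proof eventually_elim
      case (elim \<omega>)
      have "isCont u (\<tau> \<omega>)" using u_cont by (simp add: continuous_on_eq_continuous_at)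
      from isCont_tendsto_compose[OF this r_lim[OF elim]] show ?case using elim by simp
    qed
    show "AE \<omega> in M. norm (indicator {0..} (\<tau> \<omega>) * u (r n (\<tau> \<omega>))) \<le> 1" for n
      using u_bounds by (auto intro!: AE_I2 simp: indicator_def)
  qed auto
  ultimately show "prob {\<omega> \<in> space M. 0 \<le> \<tau> \<omega> \<and> \<omega> \<in> E (\<tau> \<omega>)} = (\<integral>\<omega>. prob (E (max 0 (\<tau> \<omega>))) \<partial>M)"
    unfolding prob_A A'_def[symmetric] u_def by (rule LIMSEQ_unique)
qed

section \<open>The in-degree of the root as a mixture\<close>

context marked_ctbp
begin

text \<open>
  The first \<open>m\<close> of the processes that drive the reproduction of the root, superposed; the mark is
  deliberately not built in, so that it can be treated as an independent variable.
\<close>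

definition offspring :: "nat \<Rightarrow> real \<Rightarrow> 'a \<Rightarrow> nat" where
  "offspring m t \<omega> = (\<Sum>i<m. \<xi> 0 i t \<omega>)"

text \<open>
  A single family, indexed by the sources of randomness, of the marks and of the states of the
  reproduction processes at time \<open>t\<close>; it allows independence to be used in one go.
\<close>

primrec source_value :: "real \<Rightarrow> source \<Rightarrow> 'a \<Rightarrow> nat" where
  "source_value t (Mark k) = D k"
| "source_value t (Reproduction k i) = \<xi> k i t"

lemma source_value_event:
  assumes "0 \<le> t"
  shows "source_value t s -` A \<inter> space M \<in> source_events M D \<xi> s"
proof (cases s)
  case (Mark k)
  then show ?thesis using in_vimage_algebra[of A "count_space UNIV" "D k" "space M"] by simp
next
  case (Reproduction k i)
  have "{g \<in> space (Pi\<^sub>M {0..} (\<lambda>_. count_space UNIV)). g t \<in> A} \<in> sets (Pi\<^sub>M {0..} (\<lambda>_. count_space (UNIV :: nat set)))"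
    using assms measurable_sets[OF measurable_component_singleton[of t "{0..}" "\<lambda>_. count_space (UNIV :: nat set)"], of A]
    by (simp add: vimage_def Int_def conj_commute)
  from in_vimage_algebra[OF this, of "\<lambda>\<omega>. \<lambda>t\<in>{0..}. \<xi> k i t \<omega>" "space M"]
  show ?thesis using Reproduction assms
    by (simp add: vimage_def Int_def conj_commute space_PiM restrict_PiE cong: conj_cong)
qed

lemma source_events_subset: "source_events M D \<xi> s \<subseteq> events"
  using independence by (simp add: indep_sets_def)

lemma source_value_measurable: "0 \<le> t \<Longrightarrow> source_value t s \<in> measurable M (count_space UNIV)"
proof (rule measurableI)
  show "source_value t s -` A \<inter> space M \<in> events" if "0 \<le> t" for A
    using source_value_event[OF that] source_events_subset by blast
qed auto

lemma source_value_indep: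
  assumes t: "0 \<le> t"
  shows "indep_vars (\<lambda>_. borel) (\<lambda>s \<omega>. real (source_value t s \<omega>)) UNIV"
  unfolding indep_vars_def2
proof
  show "\<forall>s\<in>UNIV. (\<lambda>\<omega>. real (source_value t s \<omega>)) \<in> borel_measurable M"
    using source_value_measurable[OF t] by (auto intro: measurable_compose)
  show "indep_sets (\<lambda>s. {(\<lambda>\<omega>. real (source_value t s \<omega>)) -` A \<inter> space M |A. A \<in> sets borel}) UNIV"
  proof (rule indep_sets_mono_sets[OF independence])
    fix s
    show "{(\<lambda>\<omega>. real (source_value t s \<omega>)) -` A \<inter> space M |A. A \<in> sets borel} \<subseteq> source_events M D \<xi> s"
      using source_value_event[OF t, of s "real -` _"] by (auto simp: vimage_def)
  qed
qed

lemma offspring_indep: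
  assumes t: "0 \<le> t" and s: "s \<notin> Reproduction 0 ` {..<m}"
  shows "\<P>(\<omega> in M. source_value t s \<omega> = i \<and> offspring m t \<omega> = j) =
    \<P>(\<omega> in M. source_value t s \<omega> = i) * \<P>(\<omega> in M. offspring m t \<omega> = j)"
proof -
  define I where "I = Reproduction 0 ` {..<m}"
  have "indep_vars (\<lambda>_. borel) (\<lambda>s \<omega>. real (source_value t s \<omega>)) (insert s I)"
    using source_value_indep[OF t] by (rule indep_vars_subset) auto
  then have "indep_var borel (\<lambda>\<omega>. real (source_value t s \<omega>)) borel (\<lambda>\<omega>. \<Sum>s\<in>I. real (source_value t s \<omega>))"
    using s by (intro indep_vars_sum) (auto simp: I_def)
  also have "(\<lambda>\<omega>. \<Sum>s\<in>I. real (source_value t s \<omega>)) = (\<lambda>\<omega>. real (offspring m t \<omega>))"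
    by (simp add: I_def sum.reindex inj_on_def offspring_def)
  finally have "prob ((\<lambda>\<omega>. (real (source_value t s \<omega>), real (offspring m t \<omega>))) -` ({real i} \<times> {real j}) \<inter> space M) =
     prob ((\<lambda>\<omega>. real (source_value t s \<omega>)) -` {real i} \<inter> space M) * prob ((\<lambda>\<omega>. real (offspring m t \<omega>)) -` {real j} \<inter> space M)"
    by (rule indep_varD) auto
  then show ?thesis by (simp add: vimage_def Int_def conj_commute)
qed

lemma offspring_measurable: "0 \<le> t \<Longrightarrow> offspring m t \<in> measurable M (count_space UNIV)"
proof (induction m)
  case (Suc m)
  have [measurable]: "offspring m t \<in> measurable M (count_space UNIV)" "\<xi> 0 m t \<in> measurable M (count_space UNIV)"
    using Suc source_value_measurable[of t "Reproduction 0 m"] by auto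
  have "(\<lambda>\<omega>. offspring m t \<omega> + \<xi> 0 m t \<omega>) \<in> measurable M (count_space UNIV)" by measurable
  then show ?case by (simp add: offspring_def[abs_def])
qed (simp add: offspring_def[abs_def])

lemma offspring_forward_equations:
  assumes f: "\<And>k. 1 \<le> k \<Longrightarrow> f k = c * real k + b"
  shows "forward_equations (\<lambda>j. c * real j + real m * (c + b)) (\<lambda>j t. \<P>(\<omega> in M. offspring m t \<omega> = j))"
proof (induction m)
  case 0
  have P: "\<P>(\<omega> in M. offspring 0 t \<omega> = j) = (if j = 0 then 1 else 0)" for j t
    using prob_space by (auto simp: offspring_def)
  moreover have "((\<lambda>_. a) has_real_derivative
      (if j = 0 then 0 else (c * real (j - 1) + real 0 * (c + b)) * (if j - 1 = 0 then 1 else 0)) -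
      (c * real j + real 0 * (c + b)) * (if j = 0 then 1 else 0)) (at t within {0..})" for a t :: real and j :: nat
    by (cases j) auto
  ultimately show ?case
    unfolding forward_equations_def P by blast
next
  case (Suc m)
  have "(\<lambda>j. f (Suc j)) = (\<lambda>j. c * real j + (c + b))"
    by (auto simp: f algebra_simps)
  then have q: "forward_equations (\<lambda>j. c * real j + (c + b)) (\<lambda>j t. \<P>(\<omega> in M. \<xi> 0 m t \<omega> = j))"
    using pure_birth_forward_equations[OF reproduction[of 0 m]] by simp
  have "forward_equations (\<lambda>j. c * real j + ((c + b) + real m * (c + b)))
     (\<lambda>j t. \<P>(\<omega> in M. offspring (Suc m) t \<omega> = j))"
  proof (rule forward_equations_cong[OF forward_equations_convolution[OF q Suc]])
    fix j and t :: real assume t: "0 \<le> t"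
    have ev: "{\<omega> \<in> space M. \<xi> 0 m t \<omega> = i \<and> offspring m t \<omega> = k} \<in> events" for i k
    proof -
      have [measurable]: "offspring m t \<in> measurable M (count_space UNIV)" "\<xi> 0 m t \<in> measurable M (count_space UNIV)"
        using t offspring_measurable source_value_measurable[of t "Reproduction 0 m"] by auto
      show ?thesis by measurable
    qed
    have "{\<omega> \<in> space M. offspring (Suc m) t \<omega> = j} =
        (\<Union>i\<in>{..j}. {\<omega> \<in> space M. \<xi> 0 m t \<omega> = i \<and> offspring m t \<omega> = j - i})"
      by (auto simp: offspring_def)
    then have "\<P>(\<omega> in M. offspring (Suc m) t \<omega> = j) =
        (\<Sum>i\<le>j. \<P>(\<omega> in M. \<xi> 0 m t \<omega> = i \<and> offspring m t \<omega> = j - i))"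
      using ev by (subst finite_measure_finite_Union[symmetric]) (auto simp: disjoint_family_on_def)
    also have "\<dots> = (\<Sum>i\<le>j. \<P>(\<omega> in M. \<xi> 0 m t \<omega> = i) * \<P>(\<omega> in M. offspring m t \<omega> = j - i))"
      using offspring_indep[OF t, of "Reproduction 0 m" m] by (simp add: image_iff)
    finally show "\<P>(\<omega> in M. offspring (Suc m) t \<omega> = j) =
        (\<Sum>i\<le>j. \<P>(\<omega> in M. \<xi> 0 m t \<omega> = i) * \<P>(\<omega> in M. offspring m t \<omega> = j - i))" .
  qed
  then show ?case by (simp add: algebra_simps)
qed

lemma mark_prob: "\<P>(\<omega> in M. D 0 \<omega> = d) = pmf H d"
proof -
  have "measure (distr M (count_space UNIV) (D 0)) {d} = \<P>(\<omega> in M. D 0 \<omega> = d)"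
    using mark_measurable[of 0] by (subst measure_distr) (auto simp: vimage_def Int_def conj_commute)
  then show ?thesis by (simp add: mark_distr pmf.rep_eq)
qed

lemma process_events_sigma:
  "sets (sigma (space M) (\<Union>s. source_events M D \<xi> s)) = process_events M D \<xi>"
  "space (sigma (space M) (\<Union>s. source_events M D \<xi> s)) = space M"
  using source_events_subset sets.sets_into_space unfolding process_events_def
  by (auto simp: sets_measure_of_conv space_measure_of_conv) blast+

lemma offspring_process_event:
  assumes t: "0 \<le> t"
  shows "{\<omega> \<in> space M. D 0 \<omega> = d \<and> offspring m t \<omega> = j} \<in> process_events M D \<xi>"
proof -
  define P where "P = sigma (space M) (\<Union>s. source_events M D \<xi> s)"
  have sv: "source_value t s \<in> measurable P (count_space UNIV)" for s
  proof (rule measurableI)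
    fix A :: "nat set"
    have "source_value t s -` A \<inter> space M \<in> process_events M D \<xi>"
      unfolding process_events_def using source_value_event[OF t] by (intro sigma_sets.Basic) auto
    then show "source_value t s -` A \<inter> space P \<in> sets P"
      by (simp add: P_def process_events_sigma)
  qed simp
  have [measurable]: "D 0 \<in> measurable P (count_space UNIV)" using sv[of "Mark 0"] by simp
  have [measurable]: "offspring m t \<in> measurable P (count_space UNIV)"
  proof (induction m)
    case (Suc m)
    note [measurable] = this
    have [measurable]: "\<xi> 0 m t \<in> measurable P (count_space UNIV)" using sv[of "Reproduction 0 m"] by simp
    have "(\<lambda>\<omega>. offspring m t \<omega> + \<xi> 0 m t \<omega>) \<in> measurable P (count_space UNIV)" by measurable
    then show ?case by (simp add: offspring_def[abs_def])
  qed (simp add: offspring_def[abs_def])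
  have "{\<omega> \<in> space P. D 0 \<omega> = d \<and> offspring m t \<omega> = j} \<in> sets P" by measurable
  then show ?thesis by (simp add: P_def process_events_sigma)
qed

lemma process_events_subset: "process_events M D \<xi> \<subseteq> events"
  unfolding process_events_def using source_events_subset by (intro sets.sigma_sets_subset) auto

lemma offspring_right_continuous:
  assumes "\<omega> \<in> space M" "0 \<le> t"
  shows "\<forall>\<^sub>F s in at_right t. offspring m s \<omega> = offspring m t \<omega>"
proof -
  have "\<forall>\<^sub>F s in at_right t. \<forall>i\<in>{..<m}. \<xi> 0 i s \<omega> = \<xi> 0 i t \<omega>"
    using reproduction assms unfolding pure_birth_process_def
    by (intro eventually_ball_finite) auto
  then show ?thesis by eventually_elim (simp add: offspring_def)
qed

text \<open>
  The arcs that point to the root correspond to the children of the root that were born by time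
  \<open>\<tau>\<close>, and the genealogy counts these by the superposition of the processes of the root.
\<close>

lemma root_in_degree_offspring:
  assumes \<tau>: "AE \<omega> in M. 0 \<le> \<tau> \<omega>"
  shows "AE \<omega> in M. root_in_degree \<sigma> \<pi> \<tau> \<omega> = offspring (D 0 \<omega>) (\<tau> \<omega>) \<omega>"
  using genealogy \<tau>
proof eventually_elim
  case (elim \<omega>)
  have "in_arcs (skeleton \<sigma> \<pi> (\<tau> \<omega>) \<omega>) 0 = (\<lambda>j. (j, \<pi> j \<omega>)) ` {j. 0 < j \<and> \<pi> j \<omega> = 0 \<and> \<sigma> j \<omega> \<le> \<sigma> 0 \<omega> + \<tau> \<omega>}"
    using elim by (auto simp: in_arcs_def skeleton_def)
  then have "root_in_degree \<sigma> \<pi> \<tau> \<omega> = card {j. 0 < j \<and> \<pi> j \<omega> = 0 \<and> \<sigma> j \<omega> \<le> \<sigma> 0 \<omega> + \<tau> \<omega>}"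
    by (simp add: root_in_degree_def in_degree_def card_image inj_on_def)
  moreover have "card {j. 0 < j \<and> \<pi> j \<omega> = 0 \<and> \<sigma> j \<omega> \<le> \<sigma> 0 \<omega> + \<tau> \<omega>} = (\<Sum>i<D 0 \<omega>. \<xi> 0 i (\<tau> \<omega>) \<omega>)"
    using elim(1)[THEN conjunct2, THEN conjunct2, THEN conjunct2, THEN spec[of _ 0],
        THEN spec[of _ "\<tau> \<omega>"], THEN mp, OF elim(2), THEN conjunct2] .
  ultimately show ?case by (simp add: offspring_def)
qed

lemma root_in_degree_measurable:
  assumes [measurable]: "\<tau> \<in> borel_measurable M"
  shows "root_in_degree \<sigma> \<pi> \<tau> \<in> measurable M (count_space UNIV)"
proof -
  note [measurable] = birth_time_measurable parent_measurable
  have "in_arcs (skeleton \<sigma> \<pi> (\<tau> \<omega>) \<omega>) 0 = (\<lambda>j. (j, \<pi> j \<omega>)) ` {j. 0 < j \<and> \<pi> j \<omega> = 0 \<and> \<sigma> j \<omega> \<le> \<tau> \<omega>}" for \<omega>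
    by (auto simp: in_arcs_def skeleton_def)
  then have "root_in_degree \<sigma> \<pi> \<tau> = (\<lambda>\<omega>. card {j. 0 < j \<and> \<pi> j \<omega> = 0 \<and> \<sigma> j \<omega> \<le> \<tau> \<omega>})"
    by (simp add: root_in_degree_def[abs_def] in_degree_def card_image inj_on_def)
  then show ?thesis by simp
qed

text \<open>
  The law of the in-degree as a mixture over the mark \<open>d\<close>.  The components \<open>I d\<close> are described by the
  recurrence that the forward equations impose on the law of \<open>offspring d\<close> at the clock.
\<close>

theorem root_in_degree_mixture:
  assumes mark_pos: "0 \<notin> set_pmf H"
    and f: "\<And>k. 1 \<le> k \<Longrightarrow> f k = c * real k + b"
    and lam: "lam > 0"
    and clock: "distributed M lborel \<tau> (exponential_density lam)"
    and clock_indep: "indep_set (process_events M D \<xi>) (sets (vimage_algebra (space M) \<tau> borel))"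
  obtains I where
    "\<And>d x. (lam + (c * real x + real d * (c + b))) * I d x =
        (if x = 0 then lam else (c * real (x - 1) + real d * (c + b)) * I d (x - 1))"
    "\<And>x. ((\<lambda>d. pmf H d * I d x) has_sum \<P>(\<omega> in M. root_in_degree \<sigma> \<pi> \<tau> \<omega> = x)) {1..}"
proof
  define u where "u d j t = \<P>(\<omega> in M. offspring d t \<omega> = j)" for d j t
  define I where "I d j = (\<integral>t. exponential_density lam t * u d j (max 0 t) \<partial>lborel)" for d j
  have fe: "forward_equations (\<lambda>j. c * real j + real d * (c + b)) (u d)" for d
    using offspring_forward_equations[OF f] by (simp add: u_def[abs_def])
  show "(lam + (c * real x + real d * (c + b))) * I d x =
        (if x = 0 then lam else (c * real (x - 1) + real d * (c + b)) * I d (x - 1))" for d x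
    unfolding I_def
    by (rule forward_equations_exponential_time[OF fe lam]) (simp add: u_def)
  have \<tau> [measurable]: "\<tau> \<in> borel_measurable M"
    using distributed_measurable[OF clock] by simp
  have pos: "AE \<omega> in M. 0 \<le> \<tau> \<omega>" by (rule exponential_AE_nonneg[OF clock])
  have cont: "continuous_on {0..} (u d j)" for d j
    using fe[of d] by (auto simp: forward_equations_def intro!: DERIV_continuous_on)
  have u_meas: "(\<lambda>t. u d j (max 0 t)) \<in> borel_measurable borel" for d j
    using continuous_on_max_0[OF cont] by (rule borel_measurable_continuous_onI)
  \<comment> \<open>the mark decides how many processes are superposed, so the events are split along its values\<close>
  define E where "E d x t = {\<omega> \<in> space M. D 0 \<omega> = d \<and> offspring d t \<omega> = x}" for d x t
  define A where "A d x = {\<omega> \<in> space M. 0 \<le> \<tau> \<omega> \<and> \<omega> \<in> E d x (\<tau> \<omega>)}" for d x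
  have prob_E: "prob (E d x t) = pmf H d * u d x t" if "0 \<le> t" for d x t
    using offspring_indep[OF that, of "Mark 0" d d x] mark_prob[of d] by (auto simp: E_def u_def)
  have E_cont: "continuous_on {0..} (\<lambda>t. prob (E d x t))" for d x
    using continuous_on_mult_left[OF cont, of "pmf H d" d x]
    by (rule continuous_on_eq) (simp add: prob_E)
  have cadlag: "\<forall>\<^sub>F s in at_right t. \<omega> \<in> E d x s \<longleftrightarrow> \<omega> \<in> E d x t" if "\<omega> \<in> space M" "0 \<le> t" for \<omega> t d x
    using offspring_right_continuous[OF that, of d] by eventually_elim (simp add: E_def)
  note A = event_at_independent_time[OF \<tau> _ process_events_subset clock_indep cadlag E_cont pos]
  have A_ev: "A d x \<in> events" and A_prob: "prob (A d x) = pmf H d * I d x" for d x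
  proof -
    have Ep: "E d x t \<in> process_events M D \<xi>" if "0 \<le> t" for t
      unfolding E_def by (rule offspring_process_event[OF that])
    show "A d x \<in> events" unfolding A_def by (rule A(1)[OF Ep])
    have "prob (A d x) = (\<integral>\<omega>. prob (E d x (max 0 (\<tau> \<omega>))) \<partial>M)"
      unfolding A_def by (rule A(2)[OF Ep])
    also have "\<dots> = (\<integral>\<omega>. pmf H d * u d x (max 0 (\<tau> \<omega>)) \<partial>M)" by (simp add: prob_E)
    also have "\<dots> = pmf H d * (\<integral>\<omega>. u d x (max 0 (\<tau> \<omega>)) \<partial>M)" by simp
    also have "(\<integral>\<omega>. u d x (max 0 (\<tau> \<omega>)) \<partial>M) = I d x"
      unfolding I_def using u_meas lam
      by (intro distributed_integral[OF clock, symmetric]) (auto simp: exponential_density_nonneg)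
    finally show "prob (A d x) = pmf H d * I d x" .
  qed
  show "((\<lambda>d. pmf H d * I d x) has_sum \<P>(\<omega> in M. root_in_degree \<sigma> \<pi> \<tau> \<omega> = x)) {1..}" for x
  proof -
    have "(\<lambda>d. prob (A d x)) sums prob (\<Union>d. A d x)"
      using A_ev by (intro finite_measure_UNION) (auto simp: disjoint_family_on_def A_def E_def)
    moreover have "prob (\<Union>d. A d x) = \<P>(\<omega> in M. root_in_degree \<sigma> \<pi> \<tau> \<omega> = x)"
    proof (rule finite_measure_eq_AE)
      show "AE \<omega> in M. \<omega> \<in> (\<Union>d. A d x) \<longleftrightarrow> \<omega> \<in> {\<omega> \<in> space M. root_in_degree \<sigma> \<pi> \<tau> \<omega> = x}"
        using root_in_degree_offspring[OF pos] pos AE_space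
        by eventually_elim (auto simp: A_def E_def)
      show "{\<omega> \<in> space M. root_in_degree \<sigma> \<pi> \<tau> \<omega> = x} \<in> events"
        using root_in_degree_measurable[OF \<tau>] by measurable
    qed (use A_ev in auto)
    ultimately have "(\<lambda>d. pmf H d * I d x) sums \<P>(\<omega> in M. root_in_degree \<sigma> \<pi> \<tau> \<omega> = x)"
      by (simp add: A_prob)
    moreover have "0 \<le> pmf H d * I d x" for d using A_prob[of d x, symmetric] by simp
    ultimately have "((\<lambda>d. pmf H d * I d x) has_sum \<P>(\<omega> in M. root_in_degree \<sigma> \<pi> \<tau> \<omega> = x)) UNIV"
      by (intro sums_nonneg_imp_has_sum)
    moreover have "pmf H 0 = 0" using mark_pos by (simp add: pmf_eq_0_set_pmf)
    ultimately show ?thesis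
      by (subst has_sum_cong_neutral[where T = UNIV and g = "\<lambda>d. pmf H d * I d x"]) (auto simp: not_less_eq_eq)
  qed
qed

end

section \<open>The Malthusian rate and the mixture components\<close>

text \<open>
  Let \<open>a n\<close> be the \<open>n\<close>-th product in the series.  The quantities \<open>T n = f (n + 1) * a n\<close> satisfy
  \<open>T n - T (n + 1) = (lam - c) * a (n + 1)\<close>, so that they converge to \<open>2 * c + b - lam\<close> when the series
  sums to \<open>1\<close>.  A positive limit would make \<open>a n\<close> at least of the order \<open>1 / n\<close>, contradicting
  summability.
\<close>

lemma malthusian_rate_affine:
  fixes c b lam :: real
  assumes mal: "malthusian_rate f lam"
    and f: "\<And>k. 1 \<le> k \<Longrightarrow> f k = c * real k + b" and c: "0 \<le> c" and pos: "0 < c + b"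
  shows "lam = 2 * c + b"
proof -
  have lam: "lam > 0" and rho: "rho_hat f lam = 1"
    using mal by (auto simp: malthusian_rate_def)
  define a where "a n = (\<Prod>i=1..n. f i / (lam + f i))" for n
  have f_pos: "f (Suc n) > 0" for n
  proof -
    have "f (Suc n) = (c + b) + c * real n" by (simp add: f algebra_simps)
    moreover have "0 \<le> c * real n" using c by simp
    ultimately show ?thesis using pos by linarith
  qed
  have a_pos: "a n > 0" for n
    unfolding a_def
  proof (intro prod_pos)
    fix i assume "i \<in> {1..n}"
    then show "f i / (lam + f i) > 0" using f_pos[of "i - 1"] lam by (simp add: add_pos_pos)
  qed
  have a_Suc: "(lam + f (Suc n)) * a (Suc n) = f (Suc n) * a n" for n
    using f_pos[of n] lam by (simp add: a_def)
  have sums: "(\<lambda>n. a (Suc n)) sums 1"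
  proof -
    have "(\<Sum>n. ennreal (a (Suc n))) = ennreal 1" using rho by (simp add: rho_hat_def a_def)
    moreover have summ: "summable (\<lambda>n. a (Suc n))"
      by (rule summable_suminf_not_top) (use a_pos calculation in \<open>auto simp: less_imp_le\<close>)
    ultimately have "ennreal (\<Sum>n. a (Suc n)) = ennreal 1"
      using a_pos by (subst suminf_ennreal2[symmetric]) (auto simp: less_imp_le)
    then have "(\<Sum>n. a (Suc n)) = 1" using a_pos by (subst (asm) ennreal_inj) (auto intro!: suminf_nonneg summ simp: less_imp_le)
    then show ?thesis using summ by (simp add: sums_iff)
  qed
  define T where "T n = f (Suc n) * a n" for n
  have tele: "(lam - c) * (\<Sum>n<N. a (Suc n)) = T 0 - T N" for N
  proof (induction N)
    case (Suc N)
    have "T N - T (Suc N) = (lam + f (Suc N)) * a (Suc N) - f (Suc (Suc N)) * a (Suc N)"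
      using a_Suc[of N] by (simp add: T_def)
    also have "\<dots> = (lam - c) * a (Suc N)" by (simp add: f algebra_simps)
    finally show ?case using Suc by (simp add: algebra_simps)
  qed simp
  define l where "l = 2 * c + b - lam"
  have T_lim: "T \<longlonglongrightarrow> l"
  proof -
    have "(\<lambda>N. T 0 - (lam - c) * (\<Sum>n<N. a (Suc n))) \<longlonglongrightarrow> T 0 - (lam - c) * 1"
      using sums unfolding sums_def by (intro tendsto_intros)
    moreover have "T 0 - (lam - c) * 1 = l" by (simp add: T_def a_def f l_def)
    ultimately show ?thesis by (simp add: tele)
  qed
  have "l \<ge> 0"
    using a_pos f_pos by (intro LIMSEQ_le_const[OF T_lim]) (auto simp: T_def less_imp_le)
  moreover have "\<not> l > 0"
  proof
    assume l: "l > 0"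
    define B where "B = c + (c + b)"
    have B: "B > 0" using c pos by (simp add: B_def)
    have "\<forall>\<^sub>F n in sequentially. T n > l / 2"
      using T_lim l by (intro order_tendstoD) auto
    then have "\<forall>\<^sub>F n in sequentially. norm (l / (2 * B) * (1 / real (Suc n))) \<le> a n"
    proof eventually_elim
      case (elim n)
      have "f (Suc n) \<le> B * real (Suc n)"
        using c pos mult_nonneg_nonneg[of "c + b" "real n"] by (simp add: f B_def algebra_simps)
      then have "T n \<le> B * real (Suc n) * a n"
        unfolding T_def using a_pos[of n] by (intro mult_right_mono) auto
      then have "l / 2 < B * real (Suc n) * a n" using elim by linarith
      then show ?case using l B by (simp add: field_simps del: of_nat_Suc)
    qed
    moreover have "summable a" using sums by (subst summable_Suc_iff[symmetric]) (auto simp: sums_iff)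
    ultimately have "summable (\<lambda>n. l / (2 * B) * (1 / real (Suc n)))"
      by (rule summable_comparison_test_ev)
    then have "summable (\<lambda>n. 1 / real (Suc n))" using l B by (subst (asm) summable_cmult_iff) auto
    then have "summable (\<lambda>n. real n powr (-1))"
      by (subst summable_Suc_iff[symmetric]) (simp add: powr_minus field_simps)
    then show False using summable_real_powr_iff[of "-1"] by simp
  qed
  ultimately show ?thesis by (simp add: l_def)
qed

text \<open>
  Both factors of the recurrence are absorbed by the functional equation of \<open>\<Gamma>\<close>.
\<close>

lemma gamma_recurrence_solution:
  fixes I :: "nat \<Rightarrow> real"
  assumes rec: "\<And>x. (lam + (real x + s)) * I x = (if x = 0 then lam else (real (x - 1) + s) * I (x - 1))"
    and lam: "lam > 0" and s: "s > 0"
  shows "I x = lam * (Gamma (lam + s) * Gamma (real x + s)) / (Gamma s * Gamma (real x + s + lam + 1))"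
proof (induction x)
  case 0
  have "Gamma (s + lam + 1) = (s + lam) * Gamma (s + lam)"
    using Gamma_plus1[of "s + lam"] s lam by (auto simp: nonpos_Ints_def)
  moreover have "Gamma s > 0" "Gamma (lam + s) > 0" using s lam by (auto intro: Gamma_real_pos)
  moreover have "I 0 = lam / (s + lam)" using rec[of 0] lam s by (simp add: field_simps)
  moreover have "I 0 = lam * (G2 * G1) / (G1 * ((s + lam) * G2))" if "G1 > 0" "G2 > 0" for G1 G2
    using that \<open>I 0 = lam / (s + lam)\<close> by simp
  ultimately show ?case by (simp add: add.commute[of lam s])
next
  case (Suc x)
  define y where "y = real x + s"
  have y: "y > 0" using s by (simp add: y_def add_nonneg_pos)
  have 1: "Gamma (y + 1) = y * Gamma y" using Gamma_plus1[of y] y by (auto simp: nonpos_Ints_def)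
  have 2: "Gamma (y + lam + 1 + 1) = (y + lam + 1) * Gamma (y + lam + 1)"
    using Gamma_plus1[of "y + lam + 1"] y lam by (auto simp: nonpos_Ints_def)
  have pos: "Gamma s > 0" "Gamma (y + lam + 1) > 0" using s y lam by (auto intro: Gamma_real_pos)
  have "(y + lam + 1) * I (Suc x) = y * I x" using rec[of "Suc x"] by (simp add: y_def algebra_simps)
  then have "I (Suc x) = y * I x / (y + lam + 1)" using y lam by (simp add: field_simps)
  also have "\<dots> = lam * (Gamma (lam + s) * Gamma (y + 1)) / (Gamma s * Gamma (y + lam + 1 + 1))"
    unfolding 1 2 Suc y_def[symmetric] by (simp add: mult_ac)
  finally show ?case by (simp add: y_def add_ac)
qed

lemma geometric_recurrence_solution:
  fixes I :: "nat \<Rightarrow> real"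
  assumes rec: "\<And>x. (\<beta> + real d * \<beta>) * I x = (if x = 0 then \<beta> else (real d * \<beta>) * I (x - 1))"
    and \<beta>: "\<beta> > 0" and d: "d \<ge> 1"
  shows "I x = 1 / (real d + 1) * (1 + 1 / real d) powi (- int x)"
proof (induction x)
  case 0
  have "\<beta> * ((real d + 1) * I 0) = \<beta> * 1" using rec[of 0] by (simp add: algebra_simps)
  then have "(real d + 1) * I 0 = 1" using \<beta> by simp
  then show ?case by (simp add: field_simps)
next
  case (Suc x)
  have "\<beta> * ((real d + 1) * I (Suc x)) = \<beta> * (real d * I x)" using rec[of "Suc x"] by (simp add: algebra_simps)
  then have "(real d + 1) * I (Suc x) = real d * I x" using \<beta> by simp
  then have "I (Suc x) = I x / (1 + 1 / real d)" using d by (simp add: field_simps)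
  moreover have "(1 + 1 / real d) powi (- int (Suc x)) = (1 + 1 / real d) powi (- int x) / (1 + 1 / real d)"
    unfolding power_int_minus power_int_of_nat power_Suc by (simp add: field_simps)
  ultimately show ?case using Suc by simp
qed

section \<open>Tails of the limiting product\<close>

text \<open>
  The tail function of \<open>X\<close> on the whole line: it equals \<open>1\<close> to the left of the support.
\<close>

definition pareto_tail :: "real \<Rightarrow> real \<Rightarrow> real" where
  "pareto_tail \<beta> y = (1 + \<beta> + max y (- \<beta>)) powr (-3 - \<beta>)"

lemma pareto_tail_bounds:
  assumes "\<beta> > -1"
  shows "0 < pareto_tail \<beta> y" "pareto_tail \<beta> y \<le> 1" "0 < y \<Longrightarrow> pareto_tail \<beta> y \<le> y powr (-3 - \<beta>)"
    "y \<ge> - \<beta> \<Longrightarrow> pareto_tail \<beta> y = (1 + \<beta> + y) powr (-3 - \<beta>)"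
proof -
  have 1: "1 + \<beta> + max y (- \<beta>) \<ge> 1" by simp
  then show "0 < pareto_tail \<beta> y" unfolding pareto_tail_def by simp
  show "pareto_tail \<beta> y \<le> 1"
    using powr_mono2'[of "-3 - \<beta>" 1 "1 + \<beta> + max y (- \<beta>)"] 1 assms by (simp add: pareto_tail_def)
  show "pareto_tail \<beta> y \<le> y powr (-3 - \<beta>)" if "0 < y"
    unfolding pareto_tail_def using that assms by (intro powr_mono2') (auto simp: max_def)
  show "y \<ge> - \<beta> \<Longrightarrow> pareto_tail \<beta> y = (1 + \<beta> + y) powr (-3 - \<beta>)"
    by (simp add: pareto_tail_def max_def)
qed

lemma pareto_tail_cont: "\<beta> > -1 \<Longrightarrow> isCont (pareto_tail \<beta>) y"
  unfolding pareto_tail_def[abs_def] by (intro continuous_intros) (auto simp: max_def)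

lemma pareto_tail_measurable [measurable]: "pareto_tail \<beta> \<in> borel_measurable borel"
  unfolding pareto_tail_def[abs_def] by measurable

lemma pa_l_pos: "\<beta> > -1 \<Longrightarrow> d \<ge> 1 \<Longrightarrow> pa_l \<beta> d > 0"
proof -
  assume "\<beta> > -1" "d \<ge> 1"
  then have "real d * (\<beta> + 1) > 0" by simp
  moreover from this have "2 + \<beta> + real d * (\<beta> + 1) > 0" using \<open>\<beta> > -1\<close> by linarith
  ultimately show ?thesis
    unfolding pa_l_def using \<open>\<beta> > -1\<close> \<open>d \<ge> 1\<close>
    by (intro divide_pos_pos mult_pos_pos Gamma_real_pos) auto
qed

lemma pa_l_inf_pos: "\<beta> > -1 \<Longrightarrow> pa_l_inf \<beta> > 0"
  by (simp add: pa_l_inf_def)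

text \<open>
  The Gamma quotient with shift \<open>2 + \<beta>\<close>, at \<open>z = d * (\<beta> + 1)\<close>.
\<close>

lemma pa_l_tendsto:
  assumes "\<beta> > -1"
  shows "pa_l \<beta> \<longlonglongrightarrow> pa_l_inf \<beta>"
proof -
  have "filterlim (\<lambda>d. real d * (\<beta> + 1)) at_top sequentially"
    using assms by (intro filterlim_at_top_mult_tendsto_pos[OF tendsto_const _ filterlim_real_sequentially]) simp
  from filterlim_compose[OF Gamma_ratio_tendsto[of "2 + \<beta>"] this] assms
  have "(\<lambda>d. Gamma (real d * (\<beta> + 1) + (2 + \<beta>)) / ((real d * (\<beta> + 1)) powr (2 + \<beta>) * Gamma (real d * (\<beta> + 1)))) \<longlonglongrightarrow> 1"
    by simp
  from tendsto_mult[OF tendsto_const this, of "pa_l_inf \<beta>"]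
  have "(\<lambda>d. pa_l_inf \<beta> * (Gamma (real d * (\<beta> + 1) + (2 + \<beta>)) / ((real d * (\<beta> + 1)) powr (2 + \<beta>) * Gamma (real d * (\<beta> + 1))))) \<longlonglongrightarrow> pa_l_inf \<beta>"
    by simp
  moreover have "\<forall>\<^sub>F d in sequentially. pa_l_inf \<beta> * (Gamma (real d * (\<beta> + 1) + (2 + \<beta>)) / ((real d * (\<beta> + 1)) powr (2 + \<beta>) * Gamma (real d * (\<beta> + 1)))) = pa_l \<beta> d"
    using eventually_gt_at_top[of 0]
  proof eventually_elim
    case (elim d)
    then show ?case using assms
      by (simp add: pa_l_def pa_l_inf_def powr_mult add_ac mult_ac)
  qed
  ultimately show ?thesis by (rule Lim_transform_eventually)
qed

text \<open>
  The unnormalised law of \<open>Y\<close>.  Nonnegativity of \<open>L\<close> at the integers and summability are properties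
  that a mark distribution of the form \<open>d powr (- \<gamma>) * L d\<close> provides.
\<close>

locale regularly_varying_weights =
  fixes L :: "real \<Rightarrow> real" and \<beta> \<gamma> :: real and w :: "nat \<Rightarrow> real"
  assumes L: "slowly_varying L" and \<beta>: "\<beta> > -1" and \<gamma>: "\<gamma> > 0"
    and L_nonneg: "\<And>d. 1 \<le> d \<Longrightarrow> 0 \<le> L (real d)"
    and w_summable: "summable (\<lambda>n. pa_weight \<beta> \<gamma> L (Suc n))"
    and w_pos_sum: "\<exists>n. pa_weight \<beta> \<gamma> L (Suc n) > 0"
  defines "w \<equiv> pa_weight \<beta> \<gamma> L"
begin

text \<open>
  It will turn out that \<open>V x\<close> is \<open>K P(X Y > x)\<close>, and \<open>g\<close> is the scale at which marks
  comparable to \<open>x\<close> contribute.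
\<close>

abbreviation "V x \<equiv> (\<Sum>n. w (Suc n) * pareto_tail \<beta> (x / real (Suc n)))"
abbreviation "g x \<equiv> x powr (- \<gamma>) * L x"
abbreviation "wsum k x \<equiv> (\<Sum>n. w (Suc n) * k x (Suc n))"

lemma w_nonneg: "0 \<le> w (Suc n)"
  unfolding w_def pa_weight_def using L_nonneg[of "Suc n"] pa_l_pos[OF \<beta>, of "Suc n"] by simp

lemma g_pos: "\<forall>\<^sub>F x in at_top. 0 < g x"
  using slowly_varyingD(2)[OF L] eventually_gt_at_top[of 0] by eventually_elim simp

lemma bounded_summable:
  assumes "\<And>n. \<bar>b n\<bar> \<le> C"
  shows "summable (\<lambda>n. w (Suc n) * b n)"
proof (rule summable_comparison_test')
  show "summable (\<lambda>n. C * w (Suc n))" using w_summable by (intro summable_mult) (simp add: w_def)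
  show "norm (w (Suc n) * b n) \<le> C * w (Suc n)" for n
    using mult_right_mono[OF assms[of n] w_nonneg[of n]] w_nonneg[of n] by (simp add: abs_mult mult.commute)
qed

lemma V_summable: "summable (\<lambda>n. w (Suc n) * pareto_tail \<beta> (x / real (Suc n)))"
  using pareto_tail_bounds[OF \<beta>] by (intro bounded_summable[where C = 1]) (simp add: less_imp_le)

lemma V_pos: "V x > 0"
proof -
  from w_pos_sum obtain n where "w (Suc n) > 0" by (auto simp: w_def)
  then show ?thesis using w_nonneg pareto_tail_bounds(1)[OF \<beta>]
    by (intro suminf_pos2[OF V_summable, of _ n]) (auto simp: less_imp_le)
qed

lemma weighted_sum_tendsto:
  assumes \<kappa>: "\<gamma> < \<kappa>"
    and bound: "\<And>x d. x > 0 \<Longrightarrow> d \<ge> 1 \<Longrightarrow> \<bar>k x d\<bar> \<le> C"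
    and decay: "\<And>x d. x > 0 \<Longrightarrow> d \<ge> 1 \<Longrightarrow> \<bar>k x d\<bar> \<le> C * (real d / x) powr \<kappa>"
    and lim: "AE t in lborel. t > 0 \<longrightarrow> ((\<lambda>x. k x (nat \<lceil>x * t\<rceil>)) \<longlongrightarrow> \<phi> t) at_top"
    and \<phi>: "\<phi> \<in> borel_measurable borel"
  shows "integrable lborel (\<lambda>t. indicator {0<..} t * (t powr (- \<gamma> - 1) * \<phi> t))"
    and "((\<lambda>x. wsum k x / g x) \<longlongrightarrow>
           pa_l_inf \<beta> * (\<integral>t. indicator {0<..} t * (t powr (- \<gamma> - 1) * \<phi> t) \<partial>lborel)) at_top"
  using regularly_varying_weighted_sum[OF L pa_l_tendsto[OF \<beta>] _ \<gamma> \<kappa> bound decay lim \<phi>] pa_l_inf_pos[OF \<beta>]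
  by (auto simp: w_def pa_weight_def)

text \<open>
  Here the marks comparable to \<open>x\<close> dominate the sum: the Pareto tail decays like
  \<open>(d / x) powr (3 + \<beta>)\<close>, which is fast enough for the Riemann sum to converge.
\<close>

lemma V_light_mark:
  assumes "\<gamma> < 3 + \<beta>"
  shows "integrable lborel (\<lambda>t. indicator {0<..} t * (t powr (- \<gamma> - 1) * pareto_tail \<beta> (1 / t)))"
    and "((\<lambda>x. V x / g x) \<longlongrightarrow>
           pa_l_inf \<beta> * (\<integral>t. indicator {0<..} t * (t powr (- \<gamma> - 1) * pareto_tail \<beta> (1 / t)) \<partial>lborel)) at_top"
proof -
  have bound: "\<bar>pareto_tail \<beta> (x / real d)\<bar> \<le> 1" for x d
    using pareto_tail_bounds[OF \<beta>] by (simp add: less_imp_le)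
  have decay: "\<bar>pareto_tail \<beta> (x / real d)\<bar> \<le> 1 * (real d / x) powr (3 + \<beta>)" if "x > 0" "d \<ge> 1" for x d
  proof -
    have "(x / real d) powr (-3 - \<beta>) = (real d / x) powr (3 + \<beta>)"
      using that powr_minus_divide[of "x / real d" "3 + \<beta>"] by (simp add: powr_divide)
    then show ?thesis using pareto_tail_bounds(1,3)[OF \<beta>, of "x / real d"] that by (simp add: less_imp_le)
  qed
  have lim: "AE t in lborel. t > 0 \<longrightarrow> ((\<lambda>x. pareto_tail \<beta> (x / real (nat \<lceil>x * t\<rceil>))) \<longlongrightarrow> pareto_tail \<beta> (1 / t)) at_top"
    by (auto intro!: AE_I2 isCont_tendsto_compose[OF pareto_tail_cont[OF \<beta>]] inverse_ceiling_ratio_tendsto)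
  have meas: "(\<lambda>t. pareto_tail \<beta> (1 / t)) \<in> borel_measurable borel" by measurable
  note * = weighted_sum_tendsto[where k = "\<lambda>x d. pareto_tail \<beta> (x / real d)", OF assms bound decay lim meas]
  show "integrable lborel (\<lambda>t. indicator {0<..} t * (t powr (- \<gamma> - 1) * pareto_tail \<beta> (1 / t)))"
    and "((\<lambda>x. V x / g x) \<longlongrightarrow>
           pa_l_inf \<beta> * (\<integral>t. indicator {0<..} t * (t powr (- \<gamma> - 1) * pareto_tail \<beta> (1 / t)) \<partial>lborel)) at_top"
    using * by auto
qed

text \<open>
  Keeping only the marks between \<open>\<epsilon> * x\<close> and \<open>x\<close> bounds \<open>V x / g x\<close> from below by a constant times
  the integral of \<open>1 / t\<close> over \<open>{\<epsilon>..1}\<close>, which is as large as desired.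
\<close>

lemma V_dominates:
  assumes "3 + \<beta> \<le> \<gamma>"
  shows "filterlim (\<lambda>x. V x / g x) at_top at_top"
  unfolding filterlim_at_top_gt[where c = 0]
proof (intro allI impI)
  fix Z :: real assume Z: "0 < Z"
  define q where "q = (2 + \<beta>) powr (-3 - \<beta>)"
  have q: "q > 0" using \<beta> by (simp add: q_def)
  \<comment> \<open>chosen such that the limit of the truncated sum, times \<open>q\<close>, is \<open>Z + 1\<close>\<close>
  define \<epsilon> where "\<epsilon> = exp (- ((Z + 1) / (q * pa_l_inf \<beta>)))"
  have \<epsilon>: "0 < \<epsilon>" "\<epsilon> < 1" using Z q pa_l_inf_pos[OF \<beta>] by (auto simp: \<epsilon>_def)
  define k where "k x d = (if \<epsilon> \<le> real d / x \<and> real d / x \<le> 1 then (real d / x) powr \<gamma> else 0)" for x d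
  define \<phi> where "\<phi> t = (if \<epsilon> \<le> t \<and> t \<le> 1 then t powr \<gamma> else 0)" for t
  have k01: "0 \<le> k x d" "k x d \<le> 1" for x d
    using \<gamma> powr_le1[of \<gamma> "real d / x"] \<epsilon> by (auto simp: k_def)
  have bound: "\<bar>k x d\<bar> \<le> 1 / \<epsilon>" for x d
  proof -
    have "1 \<le> 1 / \<epsilon>" using \<epsilon> by simp
    then show ?thesis using k01[of x d] by linarith
  qed
  have decay: "\<bar>k x d\<bar> \<le> 1 / \<epsilon> * (real d / x) powr (\<gamma> + 1)" for x d
  proof (cases "\<epsilon> \<le> real d / x \<and> real d / x \<le> 1")
    case True
    then have "(real d / x) powr \<gamma> * \<epsilon> \<le> (real d / x) powr \<gamma> * (real d / x)"
      using \<epsilon> by (intro mult_left_mono) auto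
    also have "\<dots> = (real d / x) powr (\<gamma> + 1)"
    proof -
      have "u powr \<gamma> * u = u powr (\<gamma> + 1)" if "u > 0" for u :: real
        using that by (simp add: powr_add)
      moreover have "real d / x > 0" using True \<epsilon> by linarith
      ultimately show ?thesis .
    qed
    finally show ?thesis using True \<epsilon> by (simp add: k_def field_simps)
  next
    case False
    then have "k x d = 0" by (auto simp: k_def)
    then show ?thesis using \<epsilon> by simp
  qed
  have lim: "AE t in lborel. t > 0 \<longrightarrow> ((\<lambda>x. k x (nat \<lceil>x * t\<rceil>)) \<longlongrightarrow> \<phi> t) at_top"
    using AE_lborel_singleton[of \<epsilon>] AE_lborel_singleton[of 1]
  proof eventually_elim
    case (elim t)
    show ?case
    proof
      assume t: "t > 0"
      note r = ceiling_ratio_tendsto[OF t]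
      consider "t < \<epsilon>" | "\<epsilon> < t" "t < 1" | "1 < t" using elim by linarith
      then show "((\<lambda>x. k x (nat \<lceil>x * t\<rceil>)) \<longlongrightarrow> \<phi> t) at_top"
      proof cases
        case 1
        have "\<forall>\<^sub>F x in at_top. k x (nat \<lceil>x * t\<rceil>) = \<phi> t"
          using order_tendstoD(2)[OF r 1] by eventually_elim (use 1 in \<open>auto simp: k_def \<phi>_def\<close>)
        then show ?thesis by (rule tendsto_eventually)
      next
        case 2
        have "((\<lambda>x. (real (nat \<lceil>x * t\<rceil>) / x) powr \<gamma>) \<longlongrightarrow> \<phi> t) at_top"
          using 2 t by (auto simp: \<phi>_def intro!: tendsto_powr r)
        moreover have "\<forall>\<^sub>F x in at_top. (real (nat \<lceil>x * t\<rceil>) / x) powr \<gamma> = k x (nat \<lceil>x * t\<rceil>)"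
          using order_tendstoD(1)[OF r 2(1)] order_tendstoD(2)[OF r 2(2)]
          by eventually_elim (auto simp: k_def)
        ultimately show ?thesis by (rule Lim_transform_eventually)
      next
        case 3
        have "\<forall>\<^sub>F x in at_top. k x (nat \<lceil>x * t\<rceil>) = \<phi> t"
          using order_tendstoD(1)[OF r 3] by eventually_elim (use 3 in \<open>auto simp: k_def \<phi>_def\<close>)
        then show ?thesis by (rule tendsto_eventually)
      qed
    qed
  qed
  have meas: "\<phi> \<in> borel_measurable borel" unfolding \<phi>_def by measurable
  have "((\<lambda>x. wsum k x / g x) \<longlongrightarrow>
           pa_l_inf \<beta> * (\<integral>t. indicator {0<..} t * (t powr (- \<gamma> - 1) * \<phi> t) \<partial>lborel)) at_top"
    by (rule weighted_sum_tendsto(2)[OF _ bound decay lim meas]) simp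
  also have "(\<integral>t. indicator {0<..} t * (t powr (- \<gamma> - 1) * \<phi> t) \<partial>lborel) = (\<integral>t. 1 / t * indicator {\<epsilon>..1} t \<partial>lborel)"
    using \<epsilon> by (intro Bochner_Integration.integral_cong refl)
      (auto simp: \<phi>_def indicator_def powr_diff powr_minus field_simps)
  also have "\<dots> = ln 1 - ln \<epsilon>"
  proof (rule integral_FTC_Icc_real)
    fix t assume "\<epsilon> \<le> t" "t \<le> 1"
    then show "DERIV ln t :> 1 / t" "isCont (\<lambda>t. 1 / t) t" using \<epsilon> by (auto intro!: derivative_eq_intros continuous_intros)
  qed (use \<epsilon> in simp)
  also have "pa_l_inf \<beta> * (ln 1 - ln \<epsilon>) = (Z + 1) / q"
    using pa_l_inf_pos[OF \<beta>] by (simp add: \<epsilon>_def)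
  finally have "((\<lambda>x. q * (wsum k x / g x)) \<longlongrightarrow> q * ((Z + 1) / q)) at_top"
    by (rule tendsto_mult[OF tendsto_const])
  then have "\<forall>\<^sub>F x in at_top. q * (wsum k x / g x) > Z"
    using q by (intro order_tendstoD) auto
  then show "\<forall>\<^sub>F x in at_top. Z \<le> V x / g x"
    using g_pos eventually_gt_at_top[of 0]
  proof eventually_elim
    case (elim x)
    have kV: "q * k x d \<le> pareto_tail \<beta> (x / real d)" if "d \<ge> 1" for d
    proof (cases "\<epsilon> \<le> real d / x \<and> real d / x \<le> 1")
      case True
      define y where "y = x / real d"
      have y: "y \<ge> 1" using True that elim by (simp add: y_def)
      have "q * k x d = q * y powr (- \<gamma>)"
        using True that elim by (simp add: k_def y_def powr_divide powr_minus)
      also have "\<dots> \<le> q * y powr (-3 - \<beta>)"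
        using q y assms by (intro mult_left_mono powr_mono) auto
      also have "\<dots> = ((2 + \<beta>) * y) powr (-3 - \<beta>)"
        using y \<beta> by (simp add: q_def powr_mult)
      also have "\<dots> \<le> (1 + \<beta> + y) powr (-3 - \<beta>)"
      proof (rule powr_mono2')
        have "(1 + \<beta>) * 1 \<le> (1 + \<beta>) * y" using y \<beta> by (intro mult_left_mono) auto
        then show "1 + \<beta> + y \<le> (2 + \<beta>) * y" by (simp add: algebra_simps)
      qed (use y \<beta> in auto)
      finally show ?thesis using y \<beta> pareto_tail_bounds(4)[OF \<beta>, of y] by (simp add: y_def)
    next
      case False
      then show ?thesis using pareto_tail_bounds(1)[OF \<beta>] by (auto simp: k_def less_imp_le)
    qed
    have "q * wsum k x = (\<Sum>n. q * (w (Suc n) * k x (Suc n)))"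
      using k01 by (intro suminf_mult[symmetric] bounded_summable[where C = 1]) auto
    also have "\<dots> \<le> V x"
    proof (rule suminf_le)
      show "summable (\<lambda>n. q * (w (Suc n) * k x (Suc n)))"
        using k01 by (intro summable_mult bounded_summable[where C = 1]) auto
      show "q * (w (Suc n) * k x (Suc n)) \<le> w (Suc n) * pareto_tail \<beta> (x / real (Suc n))" for n
        using mult_left_mono[OF kV[of "Suc n"] w_nonneg[of n]] by (simp add: mult_ac)
    qed (rule V_summable)
    finally have "q * wsum k x / g x \<le> V x / g x"
      using elim by (intro divide_right_mono) auto
    then show ?case using elim by simp
  qed
qed

lemma V_negligible:
  assumes "3 + \<beta> \<le> \<gamma>" and S: "((\<lambda>x. S x / g x) \<longlongrightarrow> s) at_top"
  shows "((\<lambda>x. S x / V x) \<longlongrightarrow> 0) at_top"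
proof -
  have "((\<lambda>x. (S x / g x) / (V x / g x)) \<longlongrightarrow> 0) at_top"
    by (rule tendsto_divide_0[OF S filterlim_at_top_imp_at_infinity[OF V_dominates[OF assms(1)]]])
  moreover have "\<forall>\<^sub>F x in at_top. (S x / g x) / (V x / g x) = S x / V x"
    using g_pos
  proof eventually_elim
    case (elim x)
    have "(a / c) / (b / c) = a / b" if "0 < c" for a b c :: real using that by simp
    from this[OF elim] show ?case .
  qed
  ultimately show ?thesis by (rule Lim_transform_eventually)
qed

text \<open>
  The difference \<open>c powr \<gamma> * V (c * x) - V x\<close> is a weighted sum whose kernel decays one power faster
  than the tail itself, by the mean value theorem.  It is therefore of order \<open>g x\<close>, which is
  negligible with respect to \<open>V x\<close>.
\<close>

lemma V_critical:
  assumes crit: "\<gamma> = 3 + \<beta>" and c: "c > 0"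
  shows "((\<lambda>x. V (c * x) / V x) \<longlongrightarrow> c powr (- \<gamma>)) at_top"
proof -
  define k where "k x d = c powr \<gamma> * pareto_tail \<beta> (c * x / real d) - pareto_tail \<beta> (x / real d)" for x d
  define \<phi> where "\<phi> t = c powr \<gamma> * pareto_tail \<beta> (c * (1 / t)) - pareto_tail \<beta> (1 / t)" for t
  \<comment> \<open>if \<open>y \<ge> Y\<close>, then \<open>y\<close> and \<open>c * y\<close> lie in the range where the tail is a power\<close>
  define Y where "Y = max 1 (1 / c)"
  have Y: "Y \<ge> 1" "c * Y \<ge> 1" using c by (auto simp: Y_def max_def field_simps)
  define B where "B = c powr \<gamma> + 1"
  have B: "\<bar>k x d\<bar> \<le> B" for x d
  proof -
    have "c powr \<gamma> * pareto_tail \<beta> (c * x / real d) \<le> c powr \<gamma> * 1"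
      "0 \<le> c powr \<gamma> * pareto_tail \<beta> (c * x / real d)"
      using pareto_tail_bounds(1,2)[OF \<beta>, of "c * x / real d"]
      by (simp_all only: mult_left_mono powr_ge_zero mult_nonneg_nonneg less_imp_le)
    then show ?thesis using pareto_tail_bounds(1,2)[OF \<beta>, of "x / real d"] by (auto simp: k_def B_def)
  qed
  have B0: "B \<ge> 1" by (simp add: B_def)
  define C where "C = B * Y powr (\<gamma> + 1) + \<gamma> * \<bar>(1 + \<beta>) / c - (1 + \<beta>)\<bar>"
  have CB: "B \<le> C"
  proof -
    have "B * 1 \<le> B * Y powr (\<gamma> + 1)" using B0 Y \<gamma> by (intro mult_left_mono ge_one_powr_ge_zero) auto
    then show ?thesis using \<gamma> by (simp add: C_def add_increasing2)
  qed
  have bound: "\<bar>k x d\<bar> \<le> C" for x d using B[of x d] CB by linarith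
  have decay: "\<bar>k x d\<bar> \<le> C * (real d / x) powr (\<gamma> + 1)" if "x > 0" "d \<ge> 1" for x d
  proof -
    define y where "y = x / real d"
    have y: "y > 0" using that by (simp add: y_def)
    have dx: "(real d / x) powr (\<gamma> + 1) = y powr (- \<gamma> - 1)"
      using that by (simp add: y_def powr_divide powr_diff powr_minus powr_add field_simps)
    show ?thesis
    proof (cases "y \<ge> Y")
      case True
      have "c * Y \<le> c * y" using True c by (intro mult_left_mono) auto
      then have cy: "y \<ge> 1" "c * y \<ge> 1" using True Y by linarith+
      define a where "a = (1 + \<beta>) / c"
      have a: "a > 0" using \<beta> c by (simp add: a_def)
      have "c powr \<gamma> * pareto_tail \<beta> (c * y) = c powr \<gamma> * (c * (a + y)) powr (- \<gamma>)"
      proof -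
        have "c * (a + y) = 1 + \<beta> + c * y" using c by (simp add: a_def field_simps)
        moreover have "- \<gamma> = -3 - \<beta>" using crit by simp
        ultimately show ?thesis
          using pareto_tail_bounds(4)[OF \<beta>, of "c * y"] cy \<beta> by simp
      qed
      also have "\<dots> = (a + y) powr (- \<gamma>)"
        using c a y by (simp add: powr_mult powr_minus)
      finally have k_eq: "k x d = (a + y) powr (- \<gamma>) - (1 + \<beta> + y) powr (- \<gamma>)"
        using pareto_tail_bounds(4)[OF \<beta>, of y] cy \<beta> crit by (simp add: k_def y_def)
      have mvt: "\<bar>(p + y) powr (- \<gamma>) - (q + y) powr (- \<gamma>)\<bar> \<le> \<gamma> * \<bar>p - q\<bar> * y powr (- \<gamma> - 1)"
        if pq: "0 < p" "p < q" for p q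
      proof -
        have "\<exists>z>p + y. z < q + y \<and> (q + y) powr (- \<gamma>) - (p + y) powr (- \<gamma>) = (q + y - (p + y)) * (- \<gamma> * z powr (- \<gamma> - 1))"
          using pq y by (intro MVT2) (auto intro!: derivative_eq_intros)
        then obtain z where z: "z > p + y"
          "(q + y) powr (- \<gamma>) - (p + y) powr (- \<gamma>) = (q - p) * (- \<gamma> * z powr (- \<gamma> - 1))"
          by auto
        have "\<bar>(p + y) powr (- \<gamma>) - (q + y) powr (- \<gamma>)\<bar> = \<gamma> * \<bar>p - q\<bar> * z powr (- \<gamma> - 1)"
          using z(2) pq \<gamma> by (simp add: abs_minus_commute[of "(p + y) powr (- \<gamma>)"] abs_mult)
        also have "\<dots> \<le> \<gamma> * \<bar>p - q\<bar> * y powr (- \<gamma> - 1)"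
          using z(1) pq y \<gamma> by (intro mult_left_mono powr_mono2') auto
        finally show ?thesis .
      qed
      have "\<bar>k x d\<bar> \<le> \<gamma> * \<bar>a - (1 + \<beta>)\<bar> * y powr (- \<gamma> - 1)"
        using mvt[of a "1 + \<beta>"] mvt[of "1 + \<beta>" a] a \<beta> unfolding k_eq
        by (cases a "1 + \<beta>" rule: linorder_cases) (auto simp: abs_minus_commute)
      also have "\<dots> \<le> C * y powr (- \<gamma> - 1)"
        using B0 by (intro mult_right_mono) (auto simp: C_def a_def)
      finally show ?thesis unfolding dx .
    next
      case False
      have "\<bar>k x d\<bar> \<le> B * 1" using B by simp
      also have "1 \<le> (Y / y) powr (\<gamma> + 1)" using False y \<gamma> by (intro ge_one_powr_ge_zero) auto
      also have "(Y / y) powr (\<gamma> + 1) = Y powr (\<gamma> + 1) * y powr (- \<gamma> - 1)"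
        using y Y by (simp add: powr_divide powr_diff powr_minus powr_add field_simps)
      finally have "\<bar>k x d\<bar> \<le> B * Y powr (\<gamma> + 1) * y powr (- \<gamma> - 1)"
        using B0 by (simp add: mult.assoc)
      also have "\<dots> \<le> C * y powr (- \<gamma> - 1)"
        using \<gamma> by (intro mult_right_mono) (auto simp: C_def)
      finally show ?thesis unfolding dx .
    qed
  qed
  have lim: "AE t in lborel. t > 0 \<longrightarrow> ((\<lambda>x. k x (nat \<lceil>x * t\<rceil>)) \<longlongrightarrow> \<phi> t) at_top"
  proof (intro AE_I2 impI)
    fix t :: real assume t: "t > 0"
    note r = inverse_ceiling_ratio_tendsto[OF t]
    show "((\<lambda>x. k x (nat \<lceil>x * t\<rceil>)) \<longlongrightarrow> \<phi> t) at_top"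
      unfolding k_def \<phi>_def times_divide_eq_right[symmetric]
      by (intro tendsto_diff tendsto_mult tendsto_const r
            isCont_tendsto_compose[OF pareto_tail_cont[OF \<beta>]])
  qed
  have meas: "\<phi> \<in> borel_measurable borel" unfolding \<phi>_def by measurable
  have "((\<lambda>x. wsum k x / g x) \<longlongrightarrow>
           pa_l_inf \<beta> * (\<integral>t. indicator {0<..} t * (t powr (- \<gamma> - 1) * \<phi> t) \<partial>lborel)) at_top"
    by (rule weighted_sum_tendsto(2)[OF _ bound decay lim meas]) simp
  from V_negligible[OF _ this]
  have "((\<lambda>x. wsum k x / V x) \<longlongrightarrow> 0) at_top" using crit by simp
  moreover have "wsum k x = c powr \<gamma> * V (c * x) - V x" for x
  proof -
    have "wsum k x =
      (\<Sum>n. c powr \<gamma> * (w (Suc n) * pareto_tail \<beta> (c * x / real (Suc n))) - w (Suc n) * pareto_tail \<beta> (x / real (Suc n)))"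
      by (simp add: k_def algebra_simps)
    also have "\<dots> = c powr \<gamma> * V (c * x) - V x"
      unfolding suminf_diff[OF summable_mult[OF V_summable] V_summable, symmetric]
        suminf_mult[OF V_summable] ..
    finally show ?thesis .
  qed
  ultimately have "((\<lambda>x. (c powr \<gamma> * V (c * x) - V x) / V x) \<longlongrightarrow> 0) at_top" by simp
  then have "((\<lambda>x. ((c powr \<gamma> * V (c * x) - V x) / V x + 1) * c powr (- \<gamma>)) \<longlongrightarrow> (0 + 1) * c powr (- \<gamma>)) at_top"
    by (intro tendsto_intros)
  moreover have "((c powr \<gamma> * V (c * x) - V x) / V x + 1) * c powr (- \<gamma>) = V (c * x) / V x" for x
    using V_pos[of x] c by (simp add: field_simps powr_minus)
  ultimately show ?thesis by simp
qed

text \<open>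
  The sum \<open>V\<close> with the power in place of the tail of \<open>X\<close>, also to the left of the support of \<open>X\<close>.  It
  lies between the in-degree law and \<open>K P(X Y > x)\<close>.
\<close>

definition U :: "real \<Rightarrow> real" where
  "U x = (\<Sum>n. w (Suc n) * (1 + \<beta> + x / real (Suc n)) powr (-3 - \<beta>))"

lemma U_kernel_bound: "x \<ge> 0 \<Longrightarrow> \<bar>(1 + \<beta> + x / real d) powr (-3 - \<beta>)\<bar> \<le> (1 + \<beta>) powr (-3 - \<beta>)"
  using \<beta> by (auto intro!: powr_mono2')

lemma U_summable: "x \<ge> 0 \<Longrightarrow> summable (\<lambda>n. w (Suc n) * (1 + \<beta> + x / real (Suc n)) powr (-3 - \<beta>))"
  by (rule bounded_summable) (rule U_kernel_bound)

lemma U_pos: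
  assumes "x \<ge> 0"
  shows "U x > 0"
proof -
  from w_pos_sum obtain n where n: "w (Suc n) > 0" by (auto simp: w_def)
  have "0 < 1 + \<beta> + x / real (Suc n)"
    using \<beta> assms add_pos_nonneg[of "1 + \<beta>" "x / real (Suc n)"] by simp
  then show ?thesis
    unfolding U_def using w_nonneg n by (intro suminf_pos2[OF U_summable[OF assms], of n]) auto
qed

text \<open>
  The two kernels differ only if \<open>\<beta> < 0\<close> and \<open>d > x / (- \<beta>)\<close>.  The marks in that range contribute at
  the order \<open>g x\<close>, which is negligible if \<open>\<gamma> \<ge> 3 + \<beta>\<close>.
\<close>

lemma U_asymp_V:
  assumes "0 \<le> \<beta> \<or> 3 + \<beta> \<le> \<gamma>"
  shows "((\<lambda>x. U x / V x) \<longlongrightarrow> 1) at_top"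
proof (cases "0 \<le> \<beta>")
  case True
  have "\<forall>\<^sub>F x in at_top. U x / V x = 1"
    using eventually_gt_at_top[of 0]
  proof eventually_elim
    case (elim x)
    have "pareto_tail \<beta> (x / real (Suc n)) = (1 + \<beta> + x / real (Suc n)) powr (-3 - \<beta>)" for n
      using elim True by (intro pareto_tail_bounds(4)[OF \<beta>]) (simp add: order_trans[of "- \<beta>" 0])
    then have "U x = V x" by (simp add: U_def)
    then show ?case using V_pos[of x] by simp
  qed
  then show ?thesis by (rule tendsto_eventually)
next
  case False
  then have \<gamma>': "3 + \<beta> \<le> \<gamma>" using assms by simp
  define k where "k x d = (1 + \<beta> + x / real d) powr (-3 - \<beta>) - pareto_tail \<beta> (x / real d)" for x d
  define \<phi> where "\<phi> t = (1 + \<beta> + 1 / t) powr (-3 - \<beta>) - pareto_tail \<beta> (1 / t)" for t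
  define C where "C = (1 + \<beta>) powr (-3 - \<beta>) + 1"
  have bound: "\<bar>k x d\<bar> \<le> C" if "x > 0" for x d
    using U_kernel_bound[OF less_imp_le[OF that], of d] pareto_tail_bounds(1,2)[OF \<beta>, of "x / real d"]
    unfolding k_def C_def by linarith
  have decay: "\<bar>k x d\<bar> \<le> C * (real d / x) powr (\<gamma> + 1)" if "x > 0" "d \<ge> 1" for x d
  proof (cases "x / real d \<ge> 1")
    case True
    then have "k x d = 0" using pareto_tail_bounds(4)[OF \<beta>, of "x / real d"] \<beta> by (simp add: k_def)
    then show ?thesis by (simp add: C_def)
  next
    case False
    then have "1 \<le> (real d / x) powr (\<gamma> + 1)" using that \<gamma> by (intro ge_one_powr_ge_zero) auto
    then have "C * 1 \<le> C * (real d / x) powr (\<gamma> + 1)" by (intro mult_left_mono) (auto simp: C_def)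
    then show ?thesis using bound[OF that(1), of d] by linarith
  qed
  have lim: "AE t in lborel. t > 0 \<longrightarrow> ((\<lambda>x. k x (nat \<lceil>x * t\<rceil>)) \<longlongrightarrow> \<phi> t) at_top"
  proof (intro AE_I2 impI)
    fix t :: real assume t: "t > 0"
    note r = inverse_ceiling_ratio_tendsto[OF t]
    have "1 + \<beta> + 1 / t \<noteq> 0" using \<beta> t divide_pos_pos[of 1 t] by linarith
    then show "((\<lambda>x. k x (nat \<lceil>x * t\<rceil>)) \<longlongrightarrow> \<phi> t) at_top"
      unfolding k_def \<phi>_def
      by (intro tendsto_diff tendsto_powr tendsto_add tendsto_const r
            isCont_tendsto_compose[OF pareto_tail_cont[OF \<beta>]])
  qed
  have meas: "\<phi> \<in> borel_measurable borel" unfolding \<phi>_def by measurable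
  have "((\<lambda>x. wsum k x / g x) \<longlongrightarrow>
           pa_l_inf \<beta> * (\<integral>t. indicator {0<..} t * (t powr (- \<gamma> - 1) * \<phi> t) \<partial>lborel)) at_top"
    by (rule weighted_sum_tendsto(2)[OF _ bound decay lim meas]) simp_all
  from V_negligible[OF \<gamma>' this]
  have "((\<lambda>x. wsum k x / V x + 1) \<longlongrightarrow> 0 + 1) at_top" by (intro tendsto_intros)
  moreover have "\<forall>\<^sub>F x in at_top. wsum k x / V x + 1 = U x / V x"
    using eventually_gt_at_top[of 0]
  proof eventually_elim
    case (elim x)
    have "wsum k x = U x - V x"
      unfolding U_def using elim
      by (subst suminf_diff[OF U_summable V_summable]) (auto simp: k_def algebra_simps)
    then show ?case using V_pos[of x] by (simp add: field_simps)
  qed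
  ultimately show ?thesis by (simp add: tendsto_cong)
qed

text \<open>
  By Potter's bound the summand is at most a constant times \<open>d powr (- 1 - \<delta>)\<close>, where \<open>\<delta>\<close> is half of
  the gap \<open>\<gamma> - (3 + \<beta>)\<close>.
\<close>

lemma moment_summable:
  assumes "3 + \<beta> < \<gamma>"
  shows "summable (\<lambda>n. w (Suc n) * real (Suc n) powr (3 + \<beta>))"
proof -
  define \<delta> where "\<delta> = (\<gamma> - (3 + \<beta>)) / 2"
  have \<delta>: "\<delta> > 0" using assms by (simp add: \<delta>_def)
  from potter_bound_nat[OF L \<delta>] obtain P x0 where P: "P > 0" "x0 \<ge> 1" "L x0 > 0"
    "\<And>n. n \<ge> 1 \<Longrightarrow> \<bar>L (real n)\<bar> \<le> P * L x0 * ((real n / x0) powr \<delta> + (real n / x0) powr (- \<delta>))"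
    by (meson order_refl)
  obtain Bl where Bl: "Bl > 0" "\<And>n. \<bar>pa_l \<beta> n\<bar> \<le> Bl"
    using convergent_imp_Bseq[of "pa_l \<beta>"] pa_l_tendsto[OF \<beta>] unfolding convergent_def Bseq_def by auto
  define C where "C = Bl * (P * L x0 * (1 + x0 powr \<delta>))"
  show ?thesis
  proof (rule summable_comparison_test')
    have "summable (\<lambda>n. real n powr (-1 - \<delta>))" using \<delta> by (simp add: summable_real_powr_iff)
    then have "summable (\<lambda>n. real (Suc n) powr (-1 - \<delta>))" by (subst summable_Suc_iff)
    then show "summable (\<lambda>n. C * real (Suc n) powr (-1 - \<delta>))" by (rule summable_mult)
    fix n
    define d where "d = Suc n"
    have d: "d \<ge> 1" "real d \<ge> 1" by (auto simp: d_def)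
    have "(real d / x0) powr \<delta> \<le> real d powr \<delta>"
      using d P(2) \<delta> by (intro powr_mono2) (auto simp: field_simps mult_le_cancel_left1)
    moreover have "(real d / x0) powr (- \<delta>) \<le> x0 powr \<delta> * real d powr \<delta>"
    proof -
      have "(real d / x0) powr (- \<delta>) = x0 powr \<delta> * real d powr (- \<delta>)"
        using P(2) d by (simp add: powr_divide powr_minus field_simps)
      also have "\<dots> \<le> x0 powr \<delta> * real d powr \<delta>" using d \<delta> by (intro mult_left_mono powr_mono) auto
      finally show ?thesis .
    qed
    ultimately have "\<bar>L (real d)\<bar> \<le> P * L x0 * ((1 + x0 powr \<delta>) * real d powr \<delta>)"
      using P(1,3) P(4)[OF d(1)] by (intro order.trans[OF P(4)[OF d(1)]] mult_left_mono) (auto simp: algebra_simps)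
    then have "\<bar>pa_l \<beta> d\<bar> * \<bar>L (real d)\<bar> \<le> Bl * (P * L x0 * ((1 + x0 powr \<delta>) * real d powr \<delta>))"
      using Bl by (intro mult_mono) auto
    then have "real d powr (- \<gamma> - 1 + (3 + \<beta>)) * (\<bar>pa_l \<beta> d\<bar> * \<bar>L (real d)\<bar>) \<le>
       real d powr (- \<gamma> - 1 + (3 + \<beta>)) * (Bl * (P * L x0 * ((1 + x0 powr \<delta>) * real d powr \<delta>)))"
      by (rule mult_left_mono) simp
    also have "\<dots> = C * real d powr (-1 - \<delta>)"
    proof -
      have "real d powr (- \<gamma> - 1 + (3 + \<beta>)) * real d powr \<delta> = real d powr (-1 - \<delta>)"
        unfolding powr_add[symmetric] by (simp add: \<delta>_def field_simps)
      then show ?thesis by (simp add: C_def mult_ac)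
    qed
    also have "real d powr (- \<gamma> - 1 + (3 + \<beta>)) * (\<bar>pa_l \<beta> d\<bar> * \<bar>L (real d)\<bar>) = norm (w d * real d powr (3 + \<beta>))"
      unfolding w_def pa_weight_def powr_add by (simp add: abs_mult mult_ac)
    finally show "norm (w (Suc n) * real (Suc n) powr (3 + \<beta>)) \<le> C * real (Suc n) powr (-1 - \<delta>)"
      by (simp add: d_def)
  qed
qed

text \<open>
  Here bounded marks dominate: after multiplication by \<open>x powr (3 + \<beta>)\<close> each summand converges and is
  bounded by its limit.
\<close>

lemma V_heavy_mark:
  assumes "3 + \<beta> < \<gamma>"
  shows "((\<lambda>x. V x / x powr (-3 - \<beta>)) \<longlongrightarrow> (\<Sum>n. w (Suc n) * real (Suc n) powr (3 + \<beta>))) at_top"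
proof -
  define a where "a n x = x powr (3 + \<beta>) * (w (Suc n) * pareto_tail \<beta> (x / real (Suc n)))" for n x
  have bound: "\<forall>\<^sub>F x in at_top. \<forall>n. norm (a n x) \<le> w (Suc n) * real (Suc n) powr (3 + \<beta>)"
    using eventually_gt_at_top[of 0]
  proof eventually_elim
    case (elim x)
    show ?case
    proof
      fix n
      define d where "d = real (Suc n)"
      have d: "d > 0" by (simp add: d_def)
      have "x powr (3 + \<beta>) * pareto_tail \<beta> (x / d) \<le> x powr (3 + \<beta>) * (x / d) powr (-3 - \<beta>)"
        using elim d pareto_tail_bounds(3)[OF \<beta>, of "x / d"] by (intro mult_left_mono) auto
      also have "\<dots> = d powr (3 + \<beta>)"
        using elim d powr_minus_divide[of "x / d" "3 + \<beta>"] by (simp add: powr_divide)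
      finally have "w (Suc n) * (x powr (3 + \<beta>) * pareto_tail \<beta> (x / d)) \<le> w (Suc n) * d powr (3 + \<beta>)"
        using w_nonneg by (intro mult_left_mono)
      then show "norm (a n x) \<le> w (Suc n) * real (Suc n) powr (3 + \<beta>)"
        using w_nonneg[of n] pareto_tail_bounds(1)[OF \<beta>, of "x / d"]
        by (simp add: a_def abs_mult mult_ac d_def)
    qed
  qed
  have lim: "((\<lambda>x. a n x) \<longlongrightarrow> w (Suc n) * real (Suc n) powr (3 + \<beta>)) at_top" for n
  proof -
    define d where "d = real (Suc n)"
    have d: "d > 0" by (simp add: d_def)
    have "((\<lambda>x. x / (1 + \<beta> + x / d)) \<longlongrightarrow> d) at_top" using d \<beta> by real_asymp
    then have "((\<lambda>x. w (Suc n) * (x / (1 + \<beta> + x / d)) powr (3 + \<beta>)) \<longlongrightarrow> w (Suc n) * d powr (3 + \<beta>)) at_top"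
      using d by (intro tendsto_intros) auto
    moreover have "\<forall>\<^sub>F x in at_top. w (Suc n) * (x / (1 + \<beta> + x / d)) powr (3 + \<beta>) = a n x"
      using eventually_gt_at_top[of 0] eventually_ge_at_top[of d]
    proof eventually_elim
      case (elim x)
      have xd: "x / d \<ge> 1" using elim d by simp
      then have pos: "1 + \<beta> + x / d > 0" using \<beta> by linarith
      have "pareto_tail \<beta> (x / d) = 1 / (1 + \<beta> + x / d) powr (3 + \<beta>)"
        using pareto_tail_bounds(4)[OF \<beta>, of "x / d"] xd \<beta> powr_minus_divide[of "1 + \<beta> + x / d" "3 + \<beta>"]
        by simp
      then show ?case
        unfolding a_def d_def[symmetric] using elim pos by (simp add: powr_divide powr_minus_divide)
    qed
    ultimately show ?thesis by (simp add: d_def tendsto_cong)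
  qed
  have "((\<lambda>x. \<Sum>n. a n x) \<longlongrightarrow> (\<Sum>n. w (Suc n) * real (Suc n) powr (3 + \<beta>))) at_top"
  proof -
    have "\<forall>\<^sub>F (n, x) in at_top \<times>\<^sub>F at_top. norm (a n x) \<le> w (Suc n) * real (Suc n) powr (3 + \<beta>)"
      using eventually_prod2[THEN iffD2, OF _ bound, of "at_top :: nat filter"]
      by (auto elim: eventually_mono)
    from tannerys_theorem[OF lim this moment_summable[OF assms]] show ?thesis by simp
  qed
  moreover have "\<forall>\<^sub>F x in at_top. (\<Sum>n. a n x) = V x / x powr (-3 - \<beta>)"
    using eventually_gt_at_top[of 0]
  proof eventually_elim
    case (elim x)
    have "(\<Sum>n. a n x) = x powr (3 + \<beta>) * V x"
      unfolding a_def by (rule suminf_mult[OF V_summable])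
    then show ?case using elim powr_minus_divide[of x "3 + \<beta>"] by simp
  qed
  ultimately show ?thesis by (rule Lim_transform_eventually)
qed

end

lemma bij_betw_Suc_from_1: "bij_betw Suc UNIV {1..}"
  by (rule bij_betwI[where g = "\<lambda>n. n - 1"]) auto

lemma has_sum_from_1_imp_sums:
  fixes f :: "nat \<Rightarrow> real"
  assumes "(f has_sum s) {1..}"
  shows "(\<lambda>n. f (Suc n)) sums s"
  using has_sum_reindex_bij_betw[OF bij_betw_Suc_from_1, of f s] assms
  by (auto intro: has_sum_imp_sums)

lemma sums_imp_has_sum_from_1:
  fixes f :: "nat \<Rightarrow> real"
  assumes "(\<lambda>n. f (Suc n)) sums s" "\<And>n. 0 \<le> f (Suc n)"
  shows "(f has_sum s) {1..}"
  using has_sum_reindex_bij_betw[OF bij_betw_Suc_from_1, of f s] sums_nonneg_imp_has_sum[OF assms]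
  by simp

lemma pmf_L_nonneg:
  fixes H :: "nat pmf"
  assumes d: "1 \<le> d" and H: "\<And>d. 1 \<le> d \<Longrightarrow> pmf H d = real d powr (- \<gamma>) * L (real d)"
  shows "0 \<le> L (real d)"
proof -
  have "0 \<le> real d powr (- \<gamma>) * L (real d)" using pmf_nonneg[of H d] H[OF d] by simp
  then show ?thesis using d by (simp add: zero_le_mult_iff)
qed

lemma pa_weight_pmf:
  fixes H :: "nat pmf"
  assumes d: "1 \<le> d" and H: "\<And>d. 1 \<le> d \<Longrightarrow> pmf H d = real d powr (- \<gamma>) * L (real d)"
  shows "pa_weight \<beta> \<gamma> L d = pmf H d * pa_l \<beta> d / real d"
  using d H[OF d] by (simp add: pa_weight_def powr_diff)

text \<open>
  The weight of \<open>d\<close> is \<open>pmf H d * l(d) / d\<close>, with \<open>l\<close> bounded.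
\<close>

lemma pmf_weights:
  fixes H :: "nat pmf"
  assumes \<beta>: "\<beta> > -1" and \<gamma>: "\<gamma> > 0" and L: "slowly_varying L" and H0: "0 \<notin> set_pmf H"
    and H: "\<And>d. 1 \<le> d \<Longrightarrow> pmf H d = real d powr (- \<gamma>) * L (real d)"
  shows "regularly_varying_weights L \<beta> \<gamma>"
proof
  obtain B where B: "B > 0" "\<And>n. \<bar>pa_l \<beta> n\<bar> \<le> B"
    using convergent_imp_Bseq[of "pa_l \<beta>"] pa_l_tendsto[OF \<beta>] unfolding convergent_def Bseq_def by auto
  have "summable (\<lambda>n. norm (pmf H n))"
    using integrable_pmf[of UNIV H] by (simp add: integrable_count_space_nat_iff)
  then have "summable (pmf H)" by (rule summable_norm_cancel)
  then have "summable (\<lambda>n. pmf H (Suc n))" by (subst summable_Suc_iff)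
  then have "summable (\<lambda>n. B * pmf H (Suc n))" by (rule summable_mult)
  then show "summable (\<lambda>n. pa_weight \<beta> \<gamma> L (Suc n))"
  proof (rule summable_comparison_test')
    fix n
    have "pmf H (Suc n) * \<bar>pa_l \<beta> (Suc n)\<bar> / real (Suc n) \<le> pmf H (Suc n) * B / 1"
      using B by (intro frac_le mult_left_mono) auto
    then show "norm (pa_weight \<beta> \<gamma> L (Suc n)) \<le> B * pmf H (Suc n)"
      by (simp add: pa_weight_pmf[where H = H, OF _ H] abs_mult mult.commute del: of_nat_Suc)
  qed
  obtain d where d: "d \<in> set_pmf H" using set_pmf_not_empty[of H] by blast
  with H0 obtain n where n: "d = Suc n" by (cases d) auto
  have "pa_weight \<beta> \<gamma> L (Suc n) > 0"
    unfolding pa_weight_pmf[where H = H, OF _ H, of "Suc n", simplified]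
    using d n pa_l_pos[OF \<beta>, of "Suc n"] pmf_positive[OF d] by (intro divide_pos_pos mult_pos_pos) auto
  then show "\<exists>n. pa_weight \<beta> \<gamma> L (Suc n) > 0" ..
qed (use assms pmf_L_nonneg[where H = H, OF _ H] in auto)

text \<open>
  Letting \<open>x\<close> decrease to \<open>- \<beta>\<close> in the tail formula shows that \<open>X > - \<beta>\<close> almost surely, which
  settles the tail to the left of the support.
\<close>

lemma pareto_tail_prob:
  assumes "pa_limit_pair N \<beta> \<gamma> L X Y" and \<beta>: "\<beta> > -1"
  shows "\<P>(\<omega> in N. X \<omega> > y) = pareto_tail \<beta> y"
proof -
  from assms interpret N: prob_space N by (simp add: pa_limit_pair_def)
  have [measurable]: "X \<in> borel_measurable N"
    and tail: "\<And>x. x > - \<beta> \<Longrightarrow> \<P>(\<omega> in N. X \<omega> > x) = (1 + \<beta> + x) powr (-3 - \<beta>)"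
    using assms by (auto simp: pa_limit_pair_def)
  show ?thesis
  proof (cases "y > - \<beta>")
    case True
    then show ?thesis using tail pareto_tail_bounds(4)[OF \<beta>, of y] by simp
  next
    case False
    have "1 \<le> \<P>(\<omega> in N. X \<omega> > y)"
    proof (rule LIMSEQ_le_const2)
      show "(\<lambda>n. (1 + 1 / real (Suc n)) powr (-3 - \<beta>)) \<longlonglongrightarrow> 1"
      proof -
        have "(\<lambda>n. 1 + 1 / real (Suc n)) \<longlonglongrightarrow> 1" by real_asymp
        from tendsto_powr[OF this tendsto_const[of "-3 - \<beta>"]] show ?thesis by simp
      qed
      have "(1 + 1 / real (Suc n)) powr (-3 - \<beta>) \<le> \<P>(\<omega> in N. X \<omega> > y)" for n
      proof -
        have "(1 + 1 / real (Suc n)) powr (-3 - \<beta>) = \<P>(\<omega> in N. X \<omega> > - \<beta> + 1 / real (Suc n))"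
          using tail[of "- \<beta> + 1 / real (Suc n)"] by simp
        also have "\<dots> \<le> \<P>(\<omega> in N. X \<omega> > y)"
        proof (rule N.finite_measure_mono)
          have "y < z" if "- \<beta> + 1 / real (Suc n) < z" for z
          proof -
            have "0 < 1 / real (Suc n)" by simp
            then show ?thesis using that False by linarith
          qed
          then show "{\<omega> \<in> space N. - \<beta> + 1 / real (Suc n) < X \<omega>} \<subseteq> {\<omega> \<in> space N. y < X \<omega>}" by blast
        qed measurable
        finally show ?thesis .
      qed
      then show "\<exists>n0. \<forall>n\<ge>n0. (1 + 1 / real (Suc n)) powr (-3 - \<beta>) \<le> \<P>(\<omega> in N. X \<omega> > y)" by blast
    qed
    then have "\<P>(\<omega> in N. X \<omega> > y) = 1" using N.prob_le_1 by (intro antisym)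
    then show ?thesis using False by (simp add: pareto_tail_def max_def)
  qed
qed

context regularly_varying_weights
begin

abbreviation "K \<equiv> pa_K \<beta> \<gamma> L"

lemma weights_has_sum: "(pa_weight \<beta> \<gamma> L has_sum (\<Sum>n. w (Suc n))) {1..}"
  using w_nonneg w_summable by (intro sums_imp_has_sum_from_1) (auto simp: w_def)

lemma K_eq: "K = (\<Sum>n. w (Suc n))"
  unfolding pa_K_def by (rule infsumI[OF weights_has_sum])

lemma K_pos: "0 < K"
proof -
  from w_pos_sum obtain n where "w (Suc n) > 0" by (auto simp: w_def)
  then show ?thesis unfolding K_eq using w_nonneg w_summable
    by (intro suminf_pos2[of _ n]) (auto simp: w_def)
qed

text \<open>
  The weights divided by \<open>K\<close> sum to one over the positive integers, which leaves no mass for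
  \<open>Y = 0\<close>.
\<close>

lemma limit_pair_mark:
  assumes pair: "pa_limit_pair N \<beta> \<gamma> L X Y"
  shows "\<P>(\<omega> in N. Y \<omega> = Suc n) = w (Suc n) / K" and "\<P>(\<omega> in N. Y \<omega> = 0) = 0"
proof -
  from pair interpret N: prob_space N by (simp add: pa_limit_pair_def)
  have [measurable]: "Y \<in> measurable N (count_space UNIV)" using pair by (simp add: pa_limit_pair_def)
  show Y: "\<P>(\<omega> in N. Y \<omega> = Suc n) = w (Suc n) / K" for n
    using pair by (simp add: pa_limit_pair_def w_def)
  define B where "B n = {\<omega> \<in> space N. Y \<omega> = n}" for n
  have "range B \<subseteq> N.events" by (auto simp: B_def)
  then have "(\<lambda>n. N.prob (B n)) sums N.prob (\<Union>n. B n)"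
    by (rule N.finite_measure_UNION) (auto simp: B_def disjoint_family_on_def)
  moreover have "(\<Union>n. B n) = space N" by (auto simp: B_def)
  ultimately have "(\<lambda>n. \<P>(\<omega> in N. Y \<omega> = n)) sums 1" using N.prob_space by (simp add: B_def)
  then have "(\<lambda>n. \<P>(\<omega> in N. Y \<omega> = Suc n)) sums (1 - \<P>(\<omega> in N. Y \<omega> = 0))"
    by (subst sums_Suc_iff) simp
  moreover have "(\<lambda>n. \<P>(\<omega> in N. Y \<omega> = Suc n)) sums 1"
  proof -
    have "(\<lambda>n. w (Suc n) / K) sums (K / K)"
      using w_summable unfolding K_eq by (intro sums_divide summable_sums) (simp add: w_def)
    then show ?thesis using K_pos by (simp add: Y)
  qed
  ultimately have "1 - \<P>(\<omega> in N. Y \<omega> = 0) = 1" by (rule sums_unique2)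
  then show "\<P>(\<omega> in N. Y \<omega> = 0) = 0" by simp
qed

lemma product_tail:
  assumes pair: "pa_limit_pair N \<beta> \<gamma> L X Y"
  shows "K * \<P>(\<omega> in N. X \<omega> * real (Y \<omega>) > x) = V x"
proof -
  from pair interpret N: prob_space N by (simp add: pa_limit_pair_def)
  have [measurable]: "X \<in> borel_measurable N" "Y \<in> measurable N (count_space UNIV)"
    and indep: "N.indep_var borel X borel (\<lambda>\<omega>. real (Y \<omega>))"
    using pair by (auto simp: pa_limit_pair_def)
  define A where "A n = {\<omega> \<in> space N. Y \<omega> = Suc n \<and> X \<omega> > x / real (Suc n)}" for n
  have A_prob: "N.prob (A n) = w (Suc n) * pareto_tail \<beta> (x / real (Suc n)) / K" for n
  proof -
    have "N.prob ((\<lambda>\<omega>. (X \<omega>, real (Y \<omega>))) -` ({x / real (Suc n)<..} \<times> {real (Suc n)}) \<inter> space N) =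
       N.prob (X -` {x / real (Suc n)<..} \<inter> space N) * N.prob ((\<lambda>\<omega>. real (Y \<omega>)) -` {real (Suc n)} \<inter> space N)"
      by (rule N.indep_varD[OF indep]) auto
    also have "(\<lambda>\<omega>. (X \<omega>, real (Y \<omega>))) -` ({x / real (Suc n)<..} \<times> {real (Suc n)}) \<inter> space N = A n"
      by (auto simp: A_def)
    also have "X -` {x / real (Suc n)<..} \<inter> space N = {\<omega> \<in> space N. X \<omega> > x / real (Suc n)}" by auto
    also have "(\<lambda>\<omega>. real (Y \<omega>)) -` {real (Suc n)} \<inter> space N = {\<omega> \<in> space N. Y \<omega> = Suc n}" by auto
    finally show ?thesis
      using pareto_tail_prob[OF pair \<beta>] limit_pair_mark(1)[OF pair] by (simp del: of_nat_Suc)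
  qed
  have "(\<lambda>n. N.prob (A n)) sums N.prob (\<Union>n. A n)"
    by (intro N.finite_measure_UNION) (auto simp: A_def disjoint_family_on_def simp del: of_nat_Suc)
  moreover have "N.prob (\<Union>n. A n) = \<P>(\<omega> in N. X \<omega> * real (Y \<omega>) > x)"
  proof (rule N.finite_measure_eq_AE)
    have "AE \<omega> in N. Y \<omega> \<noteq> 0"
      using limit_pair_mark(2)[OF pair] by (subst AE_iff_measurable[OF _ refl]) (auto simp: N.emeasure_eq_measure)
    then show "AE \<omega> in N. \<omega> \<in> (\<Union>n. A n) \<longleftrightarrow> \<omega> \<in> {\<omega> \<in> space N. X \<omega> * real (Y \<omega>) > x}"
      using AE_space
    proof eventually_elim
      case (elim \<omega>)
      then obtain n where n: "Y \<omega> = Suc n" by (cases "Y \<omega>") auto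
      show ?case using elim n by (auto simp: A_def divide_less_eq simp del: of_nat_Suc)
    qed
  qed (auto simp: A_def simp del: of_nat_Suc)
  ultimately have "(\<lambda>n. w (Suc n) * pareto_tail \<beta> (x / real (Suc n)) / K) sums \<P>(\<omega> in N. X \<omega> * real (Y \<omega>) > x)"
    by (simp only: A_prob)
  from sums_mult[OF this, of K] K_pos
  have "(\<lambda>n. w (Suc n) * pareto_tail \<beta> (x / real (Suc n))) sums (K * \<P>(\<omega> in N. X \<omega> * real (Y \<omega>) > x))"
    by (simp del: of_nat_Suc)
  then show ?thesis by (rule sums_unique)
qed

lemma mark_moment:
  assumes pair: "pa_limit_pair N \<beta> \<gamma> L X Y" and heavy: "3 + \<beta> < \<gamma>"
  shows "integrable N (\<lambda>\<omega>. real (Y \<omega>) powr (3 + \<beta>))"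
    and "K * (\<integral>\<omega>. real (Y \<omega>) powr (3 + \<beta>) \<partial>N) = (\<Sum>n. w (Suc n) * real (Suc n) powr (3 + \<beta>))"
proof -
  from pair interpret N: prob_space N by (simp add: pa_limit_pair_def)
  have [measurable]: "Y \<in> measurable N (count_space UNIV)" using pair by (simp add: pa_limit_pair_def)
  define e where "e n = real (Suc n) powr (3 + \<beta>)" for n
  define A where "A n = {\<omega> \<in> space N. Y \<omega> = Suc n}" for n
  define m where "m = (\<Sum>n. w (Suc n) * e n) / K"
  have [measurable]: "A n \<in> sets N" for n unfolding A_def by measurable
  have summ: "summable (\<lambda>n. w (Suc n) * e n)" unfolding e_def by (rule moment_summable[OF heavy])
  have e: "0 \<le> e n" for n by (simp add: e_def)
  have m: "m \<ge> 0"
    unfolding m_def using K_pos w_nonneg e by (intro divide_nonneg_pos suminf_nonneg summ) auto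
  have "(\<integral>\<^sup>+\<omega>. ennreal (real (Y \<omega>) powr (3 + \<beta>)) \<partial>N) = (\<integral>\<^sup>+\<omega>. (\<Sum>n. ennreal (e n) * indicator (A n) \<omega>) \<partial>N)"
  proof (rule nn_integral_cong)
    fix \<omega> assume \<omega>: "\<omega> \<in> space N"
    show "ennreal (real (Y \<omega>) powr (3 + \<beta>)) = (\<Sum>n. ennreal (e n) * indicator (A n) \<omega>)"
    proof (cases "Y \<omega>")
      case (Suc k)
      have "ennreal (e n) * indicator (A n) \<omega> = (if n = k then ennreal (e k) else 0)" for n
        using Suc \<omega> by (auto simp: A_def)
      then show ?thesis
        using sums_unique[OF sums_single[of k "\<lambda>_. ennreal (e k)"]] Suc by (simp add: e_def)
    qed (simp add: A_def)
  qed
  also have "\<dots> = (\<Sum>n. \<integral>\<^sup>+\<omega>. ennreal (e n) * indicator (A n) \<omega> \<partial>N)"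
    by (rule nn_integral_suminf) measurable
  also have "\<dots> = (\<Sum>n. ennreal (w (Suc n) * e n / K))"
  proof (rule suminf_cong)
    fix n
    have "(\<integral>\<^sup>+\<omega>. ennreal (e n) * indicator (A n) \<omega> \<partial>N) = ennreal (e n) * emeasure N (A n)"
      by (rule nn_integral_cmult_indicator) measurable
    also have "\<dots> = ennreal (w (Suc n) * e n / K)"
      unfolding N.emeasure_eq_measure A_def limit_pair_mark(1)[OF pair] using w_nonneg[of n] K_pos e
      by (subst ennreal_mult[symmetric]) (auto simp: mult.commute)
    finally show "(\<integral>\<^sup>+\<omega>. ennreal (e n) * indicator (A n) \<omega> \<partial>N) = ennreal (w (Suc n) * e n / K)" .
  qed
  also have "\<dots> = ennreal (\<Sum>n. w (Suc n) * e n / K)"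
    using w_nonneg K_pos summ e by (intro suminf_ennreal2 summable_divide) auto
  also have "(\<Sum>n. w (Suc n) * e n / K) = m"
    unfolding m_def by (rule suminf_divide[OF summ])
  finally have nn: "(\<integral>\<^sup>+\<omega>. ennreal (real (Y \<omega>) powr (3 + \<beta>)) \<partial>N) = ennreal m" .
  have meas: "(\<lambda>\<omega>. real (Y \<omega>) powr (3 + \<beta>)) \<in> borel_measurable N" by measurable
  show "integrable N (\<lambda>\<omega>. real (Y \<omega>) powr (3 + \<beta>))"
    by (rule integrableI_nn_integral_finite[OF meas _ nn]) (use m in auto)
  have "(\<integral>\<omega>. real (Y \<omega>) powr (3 + \<beta>) \<partial>N) = m"
    using meas nn m by (intro integral_eq_nn_integral[THEN trans]) auto
  then show "K * (\<integral>\<omega>. real (Y \<omega>) powr (3 + \<beta>) \<partial>N) = (\<Sum>n. w (Suc n) * real (Suc n) powr (3 + \<beta>))"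
    using K_pos by (simp add: m_def e_def)
qed

text \<open>
  Away from the critical exponent \<open>V\<close> is asymptotic to a positive multiple of a power times a slowly
  varying function, \<open>L\<close> or the constant \<open>1\<close>.
\<close>

lemma V_regularly_varying_ratio:
  assumes c: "c > 0"
  shows "((\<lambda>x. V (c * x) / V x) \<longlongrightarrow> c powr (- min (3 + \<beta>) \<gamma>)) at_top"
proof -
  have transfer: "((\<lambda>x. V (c * x) / V x) \<longlongrightarrow> c powr (- \<rho>)) at_top"
    if lim: "((\<lambda>x. V x / (x powr (- \<rho>) * l x)) \<longlongrightarrow> v) at_top" and v: "v \<noteq> 0"
      and l: "((\<lambda>x. l (c * x) / l x) \<longlongrightarrow> 1) at_top" and l_pos: "\<forall>\<^sub>F x in at_top. l x > 0" for \<rho> v l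
  proof -
    have inf: "filterlim (\<lambda>x. c * x) at_top at_top"
      using c by (intro filterlim_tendsto_pos_mult_at_top[OF tendsto_const] filterlim_ident) auto
    have "((\<lambda>x. (V (c * x) / ((c * x) powr (- \<rho>) * l (c * x))) / (V x / (x powr (- \<rho>) * l x)) * (c powr (- \<rho>) * (l (c * x) / l x)))
        \<longlongrightarrow> v / v * (c powr (- \<rho>) * 1)) at_top"
      by (intro tendsto_mult tendsto_divide filterlim_compose[OF lim inf] lim tendsto_const l v)
    moreover have "\<forall>\<^sub>F x in at_top. (V (c * x) / ((c * x) powr (- \<rho>) * l (c * x))) / (V x / (x powr (- \<rho>) * l x)) * (c powr (- \<rho>) * (l (c * x) / l x))
        = V (c * x) / V x"
      using l_pos eventually_gt_at_top[of 0] inf[unfolded filterlim_iff, rule_format, OF l_pos]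
    proof eventually_elim
      case (elim x)
      then show ?case using c V_pos[of x] by (simp add: powr_mult)
    qed
    ultimately show ?thesis using v by (simp add: tendsto_cong)
  qed
  consider "\<gamma> < 3 + \<beta>" | "3 + \<beta> < \<gamma>" | "\<gamma> = 3 + \<beta>" by linarith
  then show ?thesis
  proof cases
    case 1
    have "(\<integral>t. indicator {0<..} t * (t powr (- \<gamma> - 1) * pareto_tail \<beta> (1 / t)) \<partial>lborel) > 0"
      using pareto_tail_bounds(1)[OF \<beta>] by (intro positive_lborel_integral V_light_mark(1) 1) auto
    then show ?thesis
      using transfer[OF V_light_mark(2)[OF 1] _ slowly_varyingD(3)[OF L c] slowly_varyingD(2)[OF L]] 1 pa_l_inf_pos[OF \<beta>]
      by simp
  next
    case 2
    from w_pos_sum obtain n where n: "w (Suc n) > 0" by (auto simp: w_def)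
    have "(\<Sum>n. w (Suc n) * real (Suc n) powr (3 + \<beta>)) > 0"
      using w_nonneg n by (intro suminf_pos2[OF moment_summable[OF 2], of n]) auto
    then show ?thesis using transfer[of "3 + \<beta>" "\<lambda>_. 1"] V_heavy_mark[OF 2] 2 by (simp add: less_imp_neq)
  next
    case 3
    then show ?thesis using V_critical[OF 3 c] by simp
  qed
qed

lemma product_regularly_varying:
  assumes pair: "pa_limit_pair N \<beta> \<gamma> L X Y"
  shows "regularly_varying (- min (3 + \<beta>) \<gamma>) (\<lambda>x. \<P>(\<omega> in N. X \<omega> * real (Y \<omega>) > x))"
proof -
  from pair interpret N: prob_space N by (simp add: pa_limit_pair_def)
  have [measurable]: "X \<in> borel_measurable N" "Y \<in> measurable N (count_space UNIV)"
    using pair by (auto simp: pa_limit_pair_def)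
  have P: "\<P>(\<omega> in N. X \<omega> * real (Y \<omega>) > x) = V x / K" for x
    using product_tail[OF pair, of x] K_pos by (simp add: field_simps)
  have "mono (\<lambda>x. - \<P>(\<omega> in N. X \<omega> * real (Y \<omega>) > x))"
    by (intro monoI le_imp_neg_le N.finite_measure_mono) auto
  then have "(\<lambda>x. - (- \<P>(\<omega> in N. X \<omega> * real (Y \<omega>) > x))) \<in> borel_measurable borel"
    by (intro borel_measurable_uminus borel_measurable_mono)
  then have "(\<lambda>x. \<P>(\<omega> in N. X \<omega> * real (Y \<omega>) > x)) \<in> borel_measurable borel" by simp
  moreover have "V (c * x) / K / (V x / K) = V (c * x) / V x" for c x using K_pos by simp
  ultimately show ?thesis
    unfolding regularly_varying_def P using V_regularly_varying_ratio V_pos K_pos by simp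
qed

lemma product_tail_heavy_mark:
  assumes pair: "pa_limit_pair N \<beta> \<gamma> L X Y" and heavy: "3 + \<beta> < \<gamma>"
  shows "(\<lambda>x. K * \<P>(\<omega> in N. X \<omega> * real (Y \<omega>) > x)) \<sim>[at_top]
     (\<lambda>x. K * (\<integral>\<omega>. real (Y \<omega>) powr (3 + \<beta>) \<partial>N) * x powr (-3 - \<beta>))"
proof (rule asymp_equivI')
  define m where "m = (\<Sum>n. w (Suc n) * real (Suc n) powr (3 + \<beta>))"
  from w_pos_sum obtain n where n: "w (Suc n) > 0" by (auto simp: w_def)
  have m: "m > 0"
    unfolding m_def using w_nonneg n by (intro suminf_pos2[OF moment_summable[OF heavy], of n]) auto
  have "((\<lambda>x. V x / x powr (-3 - \<beta>) / m) \<longlongrightarrow> m / m) at_top"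
    using V_heavy_mark[OF heavy] m unfolding m_def[symmetric] by (intro tendsto_divide tendsto_const) auto
  then show "((\<lambda>x. K * \<P>(\<omega> in N. X \<omega> * real (Y \<omega>) > x) / (K * (\<integral>\<omega>. real (Y \<omega>) powr (3 + \<beta>) \<partial>N) * x powr (-3 - \<beta>))) \<longlongrightarrow> 1) at_top"
    using m unfolding product_tail[OF pair] mark_moment(2)[OF pair heavy] m_def[symmetric]
    by (simp add: mult.commute)
qed

lemma product_tail_light_mark:
  assumes pair: "pa_limit_pair N \<beta> \<gamma> L X Y" and light: "\<gamma> < 3 + \<beta>"
  shows "integrable N (\<lambda>\<omega>. max (X \<omega>) 0 powr \<gamma>)"
    and "(\<lambda>x. K * \<P>(\<omega> in N. X \<omega> * real (Y \<omega>) > x)) \<sim>[at_top]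
     (\<lambda>x. (\<integral>\<omega>. max (X \<omega>) 0 powr \<gamma> \<partial>N) / \<gamma> * pa_l_inf \<beta> * L x * x powr (- \<gamma>))"
proof -
  from pair interpret N: prob_space N by (simp add: pa_limit_pair_def)
  have X: "X \<in> borel_measurable N" using pair by (simp add: pa_limit_pair_def)
  have tail: "\<P>(\<omega> in N. X \<omega> > y) = pareto_tail \<beta> y" for y by (rule pareto_tail_prob[OF pair \<beta>])
  note moment = N.moment_from_tail[OF X \<gamma>, unfolded tail, OF V_light_mark(1)[OF light]]
  show "integrable N (\<lambda>\<omega>. max (X \<omega>) 0 powr \<gamma>)" by (rule moment(1))
  define J where "J = (\<integral>t. indicator {0<..} t * (t powr (- \<gamma> - 1) * pareto_tail \<beta> (1 / t)) \<partial>lborel)"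
  have J: "J > 0"
    unfolding J_def using pareto_tail_bounds(1)[OF \<beta>] by (intro positive_lborel_integral V_light_mark(1) light) auto
  have mean: "(\<integral>\<omega>. max (X \<omega>) 0 powr \<gamma> \<partial>N) / \<gamma> = J" using moment(2) \<gamma> by (simp add: J_def)
  have "((\<lambda>x. V x / g x / (pa_l_inf \<beta> * J)) \<longlongrightarrow> (pa_l_inf \<beta> * J) / (pa_l_inf \<beta> * J)) at_top"
    using V_light_mark(2)[OF light] J pa_l_inf_pos[OF \<beta>] unfolding J_def[symmetric]
    by (intro tendsto_divide tendsto_const) auto
  then show "(\<lambda>x. K * \<P>(\<omega> in N. X \<omega> * real (Y \<omega>) > x)) \<sim>[at_top]
     (\<lambda>x. (\<integral>\<omega>. max (X \<omega>) 0 powr \<gamma> \<partial>N) / \<gamma> * pa_l_inf \<beta> * L x * x powr (- \<gamma>))"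
    using J pa_l_inf_pos[OF \<beta>] unfolding product_tail[OF pair] mean
    by (intro asymp_equivI') (simp add: mult_ac)
qed

text \<open>
  The quotient of the summands is \<open>R (x + d * (\<beta> + 1))\<close>, where \<open>R z \<longlonglongrightarrow> 1\<close>; it is close to \<open>1\<close> for all
  \<open>d\<close> at once when \<open>x\<close> is large.
\<close>

lemma gamma_mixture_asymp_U:
  fixes H :: "nat pmf" and Q :: "nat \<Rightarrow> real"
  assumes H: "\<And>d. 1 \<le> d \<Longrightarrow> pmf H d = real d powr (- \<gamma>) * L (real d)"
    and Q: "\<And>x. ((\<lambda>d. pmf H d * (2 + \<beta>) *
              (Gamma (2 + \<beta> + real d * (\<beta> + 1)) * Gamma (real x + real d * (\<beta> + 1))) /
              (Gamma (real d * (\<beta> + 1)) * Gamma (real x + real d * (\<beta> + 1) + 3 + \<beta>)))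
            has_sum Q x) {1..}"
  shows "(\<lambda>x. Q x / U (real x)) \<longlonglongrightarrow> 1"
proof -
  define R where "R z = Gamma z * z powr (3 + \<beta>) / Gamma (z + 3 + \<beta>)" for z
  have R: "(R \<longlongrightarrow> 1) at_top"
    using tendsto_inverse[OF Gamma_ratio_tendsto[of "3 + \<beta>"]] \<beta> by (simp add: R_def[abs_def] add.assoc mult.commute)
  have summand: "pmf H d * (2 + \<beta>) *
              (Gamma (2 + \<beta> + real d * (\<beta> + 1)) * Gamma (real x + real d * (\<beta> + 1))) /
              (Gamma (real d * (\<beta> + 1)) * Gamma (real x + real d * (\<beta> + 1) + 3 + \<beta>)) =
      w d * (1 + \<beta> + real x / real d) powr (-3 - \<beta>) * R (real x + real d * (\<beta> + 1))" if d: "d \<ge> 1" for d x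
  proof -
    define z where "z = real x + real d * (\<beta> + 1)"
    have z: "z > 0" using d \<beta> by (auto simp: z_def intro!: add_nonneg_pos)
    have "1 + \<beta> + real x / real d = z / real d" using d by (simp add: z_def field_simps)
    then have "(1 + \<beta> + real x / real d) powr (-3 - \<beta>) = real d powr (3 + \<beta>) / z powr (3 + \<beta>)"
      using z d powr_minus_divide[of "z / real d" "3 + \<beta>"] by (simp add: powr_divide)
    moreover have "real d powr (3 + \<beta>) = real d powr (2 + \<beta>) * real d"
      using d powr_add[of "real d" "2 + \<beta>" 1] by (simp add: add_ac)
    moreover have "w d = pmf H d * pa_l \<beta> d / real d"
      unfolding w_def by (rule pa_weight_pmf[OF d H])
    ultimately show ?thesis
      using d z unfolding z_def[symmetric] R_def pa_l_def by simp
  qed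
  show ?thesis
  proof (rule LIMSEQ_I)
    fix e :: real assume e: "e > 0"
    have "\<forall>\<^sub>F z in at_top. \<bar>R z - 1\<bar> < e / 2"
      using tendstoD[OF R, of "e / 2"] e by (simp add: dist_real_def)
    then obtain z0 where z0: "\<And>z. z \<ge> z0 \<Longrightarrow> \<bar>R z - 1\<bar> < e / 2"
      by (auto simp: eventually_at_top_linorder)
    have "norm (Q x / U (real x) - 1) < e" if x: "x \<ge> nat \<lceil>z0\<rceil>" for x
    proof -
      define a where "a n = w (Suc n) * (1 + \<beta> + real x / real (Suc n)) powr (-3 - \<beta>)" for n
      define r where "r n = R (real x + real (Suc n) * (\<beta> + 1))" for n
      have a: "a sums U (real x)"
        unfolding a_def U_def using U_summable[of "real x"] by (intro summable_sums) simp
      have a_nonneg: "0 \<le> a n" for n using w_nonneg[of n] by (simp add: a_def)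
      have Q_sums: "(\<lambda>n. a n * r n) sums Q x"
        using has_sum_from_1_imp_sums[OF Q[of x]] by (simp add: summand a_def r_def del: of_nat_Suc)
      have r: "\<bar>r n - 1\<bar> \<le> e / 2" for n
      proof -
        have "0 \<le> real (Suc n) * (\<beta> + 1)" using \<beta> by simp
        then have "z0 \<le> real x + real (Suc n) * (\<beta> + 1)" using x by linarith
        from z0[OF this] show ?thesis by (simp add: r_def)
      qed
      have diff: "(\<lambda>n. a n * r n - a n) sums (Q x - U (real x))" by (rule sums_diff[OF Q_sums a])
      have upper: "(\<lambda>n. e / 2 * a n) sums (e / 2 * U (real x))" by (rule sums_mult[OF a])
      have "\<bar>a n * r n - a n\<bar> \<le> e / 2 * a n" for n
      proof -
        have "a n * r n - a n = a n * (r n - 1)" by (simp add: algebra_simps)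
        then have "\<bar>a n * r n - a n\<bar> = a n * \<bar>r n - 1\<bar>"
          using a_nonneg[of n] by (simp add: abs_mult)
        also have "\<dots> \<le> a n * (e / 2)" using r a_nonneg by (intro mult_left_mono)
        finally show ?thesis by (simp add: mult.commute)
      qed
      then have *: "a n * r n - a n \<le> e / 2 * a n \<and> - (e / 2 * a n) \<le> a n * r n - a n" for n
        using abs_le_iff[of "a n * r n - a n" "e / 2 * a n"] by (simp only: minus_le_iff)
      then have "Q x - U (real x) \<le> e / 2 * U (real x)" "- (e / 2 * U (real x)) \<le> Q x - U (real x)"
        using sums_le[OF _ diff upper] sums_le[OF _ sums_minus[OF upper] diff] * by blast+
      then have "\<bar>Q x - U (real x)\<bar> \<le> e / 2 * U (real x)" by linarith
      moreover have U: "U (real x) > 0" by (rule U_pos) simp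
      ultimately have "\<bar>Q x - U (real x)\<bar> / U (real x) \<le> e / 2" by (simp add: field_simps)
      moreover have "Q x / U (real x) - 1 = (Q x - U (real x)) / U (real x)" using U by (simp add: field_simps)
      ultimately have "norm (Q x / U (real x) - 1) \<le> e / 2" using U by (simp add: abs_divide)
      then show ?thesis using e by linarith
    qed
    then show "\<exists>n0. \<forall>x\<ge>n0. norm (Q x / U (real x) - 1) < e" by blast
  qed
qed

end

section \<open>Asymptotics for uniform attachment\<close>

text \<open>
  From \<open>y \<le> exp y\<close> at \<open>y = s / (2 * \<kappa>)\<close>.
\<close>

lemma exp_le_powr:
  fixes s \<kappa> :: real
  assumes "s > 0" "\<kappa> > 0"
  shows "exp (- s / 2) \<le> (2 * \<kappa>) powr \<kappa> * s powr (- \<kappa>)"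
proof -
  have "s / (2 * \<kappa>) \<le> exp (s / (2 * \<kappa>))"
    using exp_ge_add_one_self[of "s / (2 * \<kappa>)"] by linarith
  then have "(s / (2 * \<kappa>)) powr \<kappa> \<le> exp (s / (2 * \<kappa>)) powr \<kappa>"
    using assms by (intro powr_mono2) auto
  also have "\<dots> = exp (s / 2)" using assms by (simp add: powr_def)
  finally have "s powr \<kappa> / (2 * \<kappa>) powr \<kappa> \<le> exp (s / 2)" using assms by (simp add: powr_divide)
  then show ?thesis using assms by (simp add: exp_minus powr_minus field_simps)
qed

text \<open>
  The kernel \<open>(1 + 1 / d) powr (- x)\<close> tends to \<open>exp (- (1 / t))\<close> along \<open>d = \<lceil>x * t\<rceil>\<close>, and this is the
  probability that an exponential variable exceeds \<open>1 / t\<close>.  As the kernel decays faster than any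
  power of \<open>d / x\<close>, no upper restriction on \<open>\<gamma>\<close> arises.
\<close>

lemma geometric_mixture_asymp:
  fixes H :: "nat pmf" and Q :: "nat \<Rightarrow> real"
  assumes L: "slowly_varying L" and \<gamma>: "\<gamma> > 0"
    and H: "\<And>d. 1 \<le> d \<Longrightarrow> pmf H d = real d powr (- \<gamma>) * L (real d)"
    and Q: "\<And>x. ((\<lambda>d. pmf H d * (1 / (real d + 1)) * (1 + 1 / real d) powi (- int x)) has_sum Q x) {1..}"
    and N: "prob_space N" and W: "distributed N lborel W (exponential_density 1)"
  shows "integrable N (\<lambda>\<omega>. W \<omega> powr \<gamma>)"
    and "Q \<sim>[at_top] (\<lambda>x. (\<integral>\<omega>. W \<omega> powr \<gamma> \<partial>N) / \<gamma> * real x powr (- \<gamma>) * L (real x))"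
proof -
  interpret N: prob_space N by (rule N)
  define k where "k x d = (1 + 1 / real d) powr (- x)" for x d
  define l where "l d = real d / (real d + 1)" for d
  define \<kappa> where "\<kappa> = \<gamma> + 1"
  define C where "C = max 1 ((2 * \<kappa>) powr \<kappa>)"
  have \<kappa>: "\<kappa> > 0" "\<gamma> < \<kappa>" using \<gamma> by (auto simp: \<kappa>_def)
  have k_exp: "k x d = exp (- (x * ln (1 + 1 / real d)))" if "d \<ge> 1" for x d
  proof -
    have "1 + 1 / real d > 0" using that by (simp add: add_pos_nonneg)
    then show ?thesis by (simp add: k_def powr_def)
  qed
  have k0: "0 \<le> k x d" for x d by (simp add: k_def)
  have k_decay: "k x d \<le> exp (- (x / real d) / 2)" if "x > 0" "d \<ge> 1" for x d
  proof -
    have pos: "1 + 1 / real d > 0" using that by (simp add: add_pos_nonneg)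
    have "ln (1 / (1 + 1 / real d)) \<le> 1 / (1 + 1 / real d) - 1"
      using pos by (intro ln_le_minus_one) simp
    also have "1 / (1 + 1 / real d) - 1 = - 1 / (real d + 1)" using that by (simp add: field_simps)
    also have "\<dots> \<le> - 1 / (2 * real d)" using that by (simp add: field_simps)
    finally have "1 / (2 * real d) \<le> ln (1 + 1 / real d)" using pos by (simp add: ln_div)
    then have "x * (1 / (2 * real d)) \<le> x * ln (1 + 1 / real d)" using that by (intro mult_left_mono) auto
    then show ?thesis unfolding k_exp[OF that(2)] by simp
  qed
  have bound: "\<bar>k x d\<bar> \<le> C" if "x > 0" "d \<ge> 1" for x d
  proof -
    have "exp (- (x / real d) / 2) \<le> 1" using that by simp
    moreover have "1 \<le> C" by (simp add: C_def)
    ultimately show ?thesis using k_decay[OF that] k0[of x d] by linarith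
  qed
  have decay: "\<bar>k x d\<bar> \<le> C * (real d / x) powr \<kappa>" if "x > 0" "d \<ge> 1" for x d
  proof -
    have "k x d \<le> (2 * \<kappa>) powr \<kappa> * (x / real d) powr (- \<kappa>)"
      using k_decay[OF that] exp_le_powr[of "x / real d" \<kappa>] that \<kappa> by simp
    also have "(x / real d) powr (- \<kappa>) = (real d / x) powr \<kappa>"
      using that by (simp add: powr_divide powr_minus)
    also have "(2 * \<kappa>) powr \<kappa> * (real d / x) powr \<kappa> \<le> C * (real d / x) powr \<kappa>"
      by (intro mult_right_mono) (auto simp: C_def)
    finally show ?thesis using k0[of x d] by simp
  qed
  have lim: "AE t in lborel. t > 0 \<longrightarrow> ((\<lambda>x. k x (nat \<lceil>x * t\<rceil>)) \<longlongrightarrow> exp (- (1 / t))) at_top"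
  proof (intro AE_I2 impI)
    fix t :: real assume t: "t > 0"
    have inf: "filterlim (\<lambda>x. real (nat \<lceil>x * t\<rceil>)) at_top at_top" using t by real_asymp
    have "((\<lambda>y::real. y * ln (1 + 1 / y)) \<longlongrightarrow> 1) at_top" by real_asymp
    from tendsto_mult[OF inverse_ceiling_ratio_tendsto[OF t] filterlim_compose[OF this inf]]
    have "((\<lambda>x. exp (- (x / real (nat \<lceil>x * t\<rceil>) * (real (nat \<lceil>x * t\<rceil>) * ln (1 + 1 / real (nat \<lceil>x * t\<rceil>)))))) \<longlongrightarrow> exp (- (1 / t))) at_top"
      by (intro tendsto_exp tendsto_minus) simp
    moreover have "\<forall>\<^sub>F x in at_top. exp (- (x / real (nat \<lceil>x * t\<rceil>) * (real (nat \<lceil>x * t\<rceil>) * ln (1 + 1 / real (nat \<lceil>x * t\<rceil>))))) = k x (nat \<lceil>x * t\<rceil>)"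
      using inf[unfolded filterlim_at_top, rule_format, of 1]
      by eventually_elim (simp add: k_exp)
    ultimately show "((\<lambda>x. k x (nat \<lceil>x * t\<rceil>)) \<longlongrightarrow> exp (- (1 / t))) at_top"
      by (rule Lim_transform_eventually)
  qed
  \<comment> \<open>the factor \<open>1 / (d + 1)\<close> is \<open>1 / d\<close> up to \<open>l d\<close>\<close>
  have l: "l \<longlonglongrightarrow> 1" unfolding l_def by real_asymp
  have meas: "(\<lambda>t::real. exp (- (1 / t))) \<in> borel_measurable borel" by measurable
  note sum = regularly_varying_weighted_sum[OF L l _ \<gamma> \<kappa>(2) bound decay lim meas]
  define J where "J = (\<integral>t. indicator {0<..} t * (t powr (- \<gamma> - 1) * exp (- (1 / t))) \<partial>lborel)"
  have J_int: "integrable lborel (\<lambda>t. indicator {0<..} t * (t powr (- \<gamma> - 1) * exp (- (1 / t))))"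
    using sum(1) by simp
  have J: "J > 0" unfolding J_def by (intro positive_lborel_integral J_int) auto
  have W_meas: "W \<in> borel_measurable N" using distributed_measurable[OF W] by simp
  have tail: "indicator {0<..} t * (t powr (- \<gamma> - 1) * \<P>(\<omega> in N. W \<omega> > 1 / t)) =
      indicator {0<..} t * (t powr (- \<gamma> - 1) * exp (- (1 / t)))" for t
    using N.exponential_distributedD_gt[OF W, of "1 / t"] by (cases "t > 0") simp_all
  note moment = N.moment_from_tail[OF W_meas \<gamma>, unfolded tail, OF J_int]
  have AE_eq: "AE \<omega> in N. max (W \<omega>) 0 powr \<gamma> = W \<omega> powr \<gamma>"
    using N.exponential_AE_nonneg[OF W] by eventually_elim simp
  have meas1: "(\<lambda>\<omega>. W \<omega> powr \<gamma>) \<in> borel_measurable N" "(\<lambda>\<omega>. max (W \<omega>) 0 powr \<gamma>) \<in> borel_measurable N"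
    using W_meas by measurable
  show "integrable N (\<lambda>\<omega>. W \<omega> powr \<gamma>)"
    using integrable_cong_AE_imp[OF moment(1) meas1(1)] AE_eq by (auto elim: eventually_mono)
  have mean: "(\<integral>\<omega>. W \<omega> powr \<gamma> \<partial>N) / \<gamma> = J"
  proof -
    have "(\<integral>\<omega>. W \<omega> powr \<gamma> \<partial>N) = \<gamma> * J"
      using integral_cong_AE[OF meas1(2,1) AE_eq] moment(2) by (simp add: J_def)
    then show ?thesis using \<gamma> by simp
  qed
  have summand: "pmf H (Suc n) * (1 / (real (Suc n) + 1)) * (1 + 1 / real (Suc n)) powi (- int x) =
     real (Suc n) powr (- \<gamma> - 1) * l (Suc n) * L (real (Suc n)) * k (real x) (Suc n)" for n x
  proof -
    define d where "d = Suc n"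
    have d: "d \<ge> 1" by (simp add: d_def)
    have "1 + 1 / real d > 0" using d by (simp add: add_pos_nonneg)
    then have "(1 + 1 / real d) powi (- int x) = k (real x) d"
      by (simp add: k_def powr_minus powr_realpow power_int_minus)
    then show ?thesis unfolding d_def[symmetric] H[OF d] using d by (simp add: l_def powr_diff)
  qed
  have Q_eq: "Q x = (\<Sum>n. real (Suc n) powr (- \<gamma> - 1) * l (Suc n) * L (real (Suc n)) * k (real x) (Suc n))" for x
    using sums_unique[OF has_sum_from_1_imp_sums[OF Q[of x]]] unfolding summand .
  have "(\<lambda>x. Q x / (real x powr (- \<gamma>) * L (real x))) \<longlonglongrightarrow> 1 * J"
    unfolding Q_eq J_def by (rule filterlim_compose[OF sum(3) filterlim_real_sequentially]) simp
  then have "(\<lambda>x. Q x / (real x powr (- \<gamma>) * L (real x)) / J) \<longlonglongrightarrow> J / J"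
    using J by (intro tendsto_divide tendsto_const) auto
  then show "Q \<sim>[at_top] (\<lambda>x. (\<integral>\<omega>. W \<omega> powr \<gamma> \<partial>N) / \<gamma> * real x powr (- \<gamma>) * L (real x))"
    unfolding mean using J by (intro asymp_equivI') (simp add: mult_ac)
qed

section \<open>The degree distribution of the root\<close>

theorem proposition1:
  fixes M :: "'a measure" and f :: "nat \<Rightarrow> real" and H :: "nat pmf"
    and D :: "nat \<Rightarrow> 'a \<Rightarrow> nat" and \<xi> :: "nat \<Rightarrow> nat \<Rightarrow> real \<Rightarrow> 'a \<Rightarrow> nat"
    and \<sigma> :: "nat \<Rightarrow> 'a \<Rightarrow> real" and \<pi> :: "nat \<Rightarrow> 'a \<Rightarrow> nat"
    and \<tau> :: "'a \<Rightarrow> real" and lam :: real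
  assumes mark_pos: "0 \<notin> set_pmf H"
    and standing: "standing_assumption f H"
    and ctbp: "marked_ctbp M f H D \<xi> \<sigma> \<pi>"
    and malthus: "malthusian_rate f lam"
    and clock: "distributed M lborel \<tau> (exponential_density lam)"
    and clock_indep: "prob_space.indep_set M (process_events M D \<xi>)
                        (sets (vimage_algebra (space M) \<tau> borel))"
  shows
    "(\<forall>\<beta>>-1. (\<forall>k\<ge>1. f k = real k + \<beta>) \<longrightarrow>
       (\<forall>x::nat.
          ((\<lambda>d. pmf H d * (2 + \<beta>) *
              (Gamma (2 + \<beta> + real d * (\<beta> + 1)) * Gamma (real x + real d * (\<beta> + 1))) /
              (Gamma (real d * (\<beta> + 1)) * Gamma (real x + real d * (\<beta> + 1) + 3 + \<beta>)))
            has_sum \<P>(\<omega> in M. root_in_degree \<sigma> \<pi> \<tau> \<omega> = x)) {1..}) \<and>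
       pa_l \<beta> \<longlonglongrightarrow> pa_l_inf \<beta> \<and>
       (\<forall>\<gamma>\<ge>2. \<forall>L. slowly_varying L \<and> (\<forall>d\<ge>1. pmf H d = real d powr (- \<gamma>) * L (real d)) \<longrightarrow>
          pa_weight \<beta> \<gamma> L summable_on {1..} \<and> 0 < pa_K \<beta> \<gamma> L \<and>
          (\<forall>(N :: 'b measure) X Y. pa_limit_pair N \<beta> \<gamma> L X Y \<longrightarrow>
             (0 \<le> \<beta> \<or> 3 + \<beta> \<le> \<gamma> \<longrightarrow>
                (\<lambda>x::nat. \<P>(\<omega> in M. root_in_degree \<sigma> \<pi> \<tau> \<omega> = x)) \<sim>[at_top]
                (\<lambda>x::nat. pa_K \<beta> \<gamma> L * \<P>(\<omega> in N. X \<omega> * real (Y \<omega>) > real x))) \<and>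
             regularly_varying (- min (3 + \<beta>) \<gamma>)
               (\<lambda>x::real. \<P>(\<omega> in N. X \<omega> * real (Y \<omega>) > x)) \<and>
             (\<gamma> > 3 + \<beta> \<longrightarrow>
                integrable N (\<lambda>\<omega>. real (Y \<omega>) powr (3 + \<beta>)) \<and>
                (\<lambda>x::real. pa_K \<beta> \<gamma> L * \<P>(\<omega> in N. X \<omega> * real (Y \<omega>) > x)) \<sim>[at_top]
                (\<lambda>x::real. pa_K \<beta> \<gamma> L * (\<integral>\<omega>. real (Y \<omega>) powr (3 + \<beta>) \<partial>N) * x powr (-3 - \<beta>))) \<and>
             (\<gamma> < 3 + \<beta> \<longrightarrow>
                integrable N (\<lambda>\<omega>. max (X \<omega>) 0 powr \<gamma>) \<and>
                (\<lambda>x::real. pa_K \<beta> \<gamma> L * \<P>(\<omega> in N. X \<omega> * real (Y \<omega>) > x)) \<sim>[at_top]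
                (\<lambda>x::real. (\<integral>\<omega>. max (X \<omega>) 0 powr \<gamma> \<partial>N) / \<gamma> * pa_l_inf \<beta> * L x * x powr (- \<gamma>)))))) \<and>
     (\<forall>\<beta>>0. (\<forall>k\<ge>1. f k = \<beta>) \<longrightarrow>
       (\<forall>x::nat.
          ((\<lambda>d. pmf H d * (1 / (real d + 1)) * (1 + 1 / real d) powi (- int x))
            has_sum \<P>(\<omega> in M. root_in_degree \<sigma> \<pi> \<tau> \<omega> = x)) {1..}) \<and>
       (\<forall>\<gamma>\<ge>2. \<forall>L. slowly_varying L \<and> (\<forall>d\<ge>1. pmf H d = real d powr (- \<gamma>) * L (real d)) \<longrightarrow>
          (\<forall>(N :: 'c measure) W. prob_space N \<and> distributed N lborel W (exponential_density 1) \<longrightarrow>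
             integrable N (\<lambda>\<omega>. W \<omega> powr \<gamma>) \<and>
             (\<lambda>x::nat. \<P>(\<omega> in M. root_in_degree \<sigma> \<pi> \<tau> \<omega> = x)) \<sim>[at_top]
             (\<lambda>x::nat. (\<integral>\<omega>. W \<omega> powr \<gamma> \<partial>N) / \<gamma> * real x powr (- \<gamma>) * L (real x)))))"
proof -
  interpret T: marked_ctbp M f H D \<xi> \<sigma> \<pi> by (rule ctbp)
  define Q where "Q x = \<P>(\<omega> in M. root_in_degree \<sigma> \<pi> \<tau> \<omega> = x)" for x :: nat
  have lam: "lam > 0" using malthus by (simp add: malthusian_rate_def)
  have PA_law: "((\<lambda>d. pmf H d * (2 + \<beta>) *
              (Gamma (2 + \<beta> + real d * (\<beta> + 1)) * Gamma (real x + real d * (\<beta> + 1))) /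
              (Gamma (real d * (\<beta> + 1)) * Gamma (real x + real d * (\<beta> + 1) + 3 + \<beta>)))
            has_sum Q x) {1..}" if \<beta>: "\<beta> > -1" and f: "\<And>k. k \<ge> 1 \<Longrightarrow> f k = real k + \<beta>" for \<beta> x
  proof -
    have f': "f k = 1 * real k + \<beta>" if "1 \<le> k" for k using f[OF that] by simp
    have lam_eq: "lam = 2 + \<beta>" using malthusian_rate_affine[OF malthus f'] \<beta> by simp
    obtain I where rec: "\<And>d x. (lam + (1 * real x + real d * (1 + \<beta>))) * I d x =
        (if x = 0 then lam else (1 * real (x - 1) + real d * (1 + \<beta>)) * I d (x - 1))"
      and Q: "\<And>x. ((\<lambda>d. pmf H d * I d x) has_sum Q x) {1..}"
      using T.root_in_degree_mixture[OF mark_pos f' lam clock clock_indep] unfolding Q_def by blast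
    have "I d x = lam * (Gamma (lam + real d * (1 + \<beta>)) * Gamma (real x + real d * (1 + \<beta>))) /
       (Gamma (real d * (1 + \<beta>)) * Gamma (real x + real d * (1 + \<beta>) + lam + 1))" if "d \<ge> 1" for d
      using rec[of _ d] \<beta> that by (intro gamma_recurrence_solution lam) simp_all
    then show ?thesis
      using Q[of x] by (subst has_sum_cong[where g = "\<lambda>d. pmf H d * I d x"]) (auto simp: lam_eq add_ac)
  qed
  have UA_law: "((\<lambda>d. pmf H d * (1 / (real d + 1)) * (1 + 1 / real d) powi (- int x)) has_sum Q x) {1..}"
    if \<beta>: "\<beta> > 0" and f: "\<And>k. k \<ge> 1 \<Longrightarrow> f k = \<beta>" for \<beta> x
  proof -
    have f': "f k = 0 * real k + \<beta>" if "1 \<le> k" for k using f[OF that] by simp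
    have lam_eq: "lam = \<beta>" using malthusian_rate_affine[OF malthus f'] \<beta> by simp
    obtain I where rec: "\<And>d x. (lam + (0 * real x + real d * (0 + \<beta>))) * I d x =
        (if x = 0 then lam else (0 * real (x - 1) + real d * (0 + \<beta>)) * I d (x - 1))"
      and Q: "\<And>x. ((\<lambda>d. pmf H d * I d x) has_sum Q x) {1..}"
      using T.root_in_degree_mixture[OF mark_pos f' lam clock clock_indep] unfolding Q_def by blast
    have "I d x = 1 / (real d + 1) * (1 + 1 / real d) powi (- int x)" if "d \<ge> 1" for d
      using rec[of _ d] by (intro geometric_recurrence_solution[OF _ \<beta> that]) (simp add: lam_eq)
    then show ?thesis
      using Q[of x] by (subst has_sum_cong[where g = "\<lambda>d. pmf H d * I d x"]) auto
  qed
  show ?thesis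
    unfolding Q_def[symmetric]
  proof ((rule conjI; rule allI; rule impI; rule impI), goal_cases)
    case (1 \<beta>)
    note \<beta> = \<open>\<beta> > -1\<close>
    have f: "f k = real k + \<beta>" if "k \<ge> 1" for k using 1(2) that by blast
    show ?case
    proof (rule conjI[OF _ conjI[OF pa_l_tendsto[OF \<beta>]]], goal_cases)
      case 1
      show ?case by (rule allI) (rule PA_law[OF \<beta> f])
    next
      case 2
      show ?case
      proof (rule allI, rule impI, rule allI, rule impI, elim conjE, goal_cases)
        case (1 \<gamma> L)
        then have H: "pmf H d = real d powr (- \<gamma>) * L (real d)" if "d \<ge> 1" for d using that by blast
        interpret R: regularly_varying_weights L \<beta> \<gamma> "pa_weight \<beta> \<gamma> L"
          using pmf_weights[OF \<beta> _ _ mark_pos H] 1 by simp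
        have Q_asymp: "Q \<sim>[at_top] (\<lambda>x. pa_K \<beta> \<gamma> L * \<P>(\<omega> in N. X \<omega> * real (Y \<omega>) > real x))"
          if pair: "pa_limit_pair N \<beta> \<gamma> L X Y" and large: "0 \<le> \<beta> \<or> 3 + \<beta> \<le> \<gamma>" for N :: "'b measure" and X Y
        proof (rule asymp_equivI')
          have "(\<lambda>x. (Q x / R.U (real x)) * (R.U (real x) / R.V (real x))) \<longlonglongrightarrow> 1 * 1"
            by (intro tendsto_mult R.gamma_mixture_asymp_U[OF H PA_law[OF \<beta> f]]
                filterlim_compose[OF R.U_asymp_V[OF large] filterlim_real_sequentially])
          moreover have "(Q x / R.U (real x)) * (R.U (real x) / R.V (real x)) = Q x / R.V (real x)" for x
            using R.U_pos[of "real x"] by simp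
          ultimately show "(\<lambda>x. Q x / (pa_K \<beta> \<gamma> L * \<P>(\<omega> in N. X \<omega> * real (Y \<omega>) > real x))) \<longlonglongrightarrow> 1"
            unfolding R.product_tail[OF pair] by (simp only: mult_1)
        qed
        show ?case
        proof (intro conjI allI impI, goal_cases)
          case 1
          show ?case using R.weights_has_sum by (auto simp: summable_on_def)
        next
          case 2
          show ?case by (rule R.K_pos)
        next
          case (3 N X Y)
          then show ?case by (rule Q_asymp)
        next
          case (4 N X Y)
          then show ?case by (rule R.product_regularly_varying)
        next
          case (5 N X Y)
          then show ?case by (rule R.mark_moment(1))
        next
          case (6 N X Y)
          then show ?case by (rule R.product_tail_heavy_mark)
        next
          case (7 N X Y)
          then show ?case by (rule R.product_tail_light_mark(1))
        next
          case (8 N X Y)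
          then show ?case by (rule R.product_tail_light_mark(2))
        qed
      qed
    qed
  next
    case (2 \<beta>)
    note \<beta> = \<open>\<beta> > 0\<close>
    have f: "f k = \<beta>" if "k \<ge> 1" for k using 2(2) that by blast
    show ?case
    proof (rule conjI, goal_cases)
      case 1
      show ?case by (rule allI) (rule UA_law[OF \<beta> f])
    next
      case 2
      show ?case
      proof (intro allI impI, elim conjE, goal_cases)
        case (1 \<gamma> L N W)
        then have H: "pmf H d = real d powr (- \<gamma>) * L (real d)" if "d \<ge> 1" for d using that by blast
        have "\<gamma> > 0" using 1 by simp
        from geometric_mixture_asymp[OF \<open>slowly_varying L\<close> this H UA_law[OF \<beta> f]
            \<open>prob_space N\<close> \<open>distributed N lborel W _\<close>]
        show ?case by (rule conjI)
      qed
    qed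
  qed
qed

end
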